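(* For any $d\in\mathbb{N}$, there exist limit-periodic weights $w$ (with $M^{-1}\le w_{\mathbf n,\mathbf m}\le M$ for some $M>1$ and $w$ symmetric) such that the weighted Laplacian $L_w$ on $\ell^2(\mathbb{Z}^d)$ has purely singular continuous spectrum and $\sigma(L_w)$ is a Cantor set of zero lower box-counting dimension.
   Context: Given positive weights $\{w_{\mathbf n,\mathbf m}\}$ indexed by pairs $\mathbf n,\mathbf m\in\mathbb{Z}^d$ with $\|\mathbf n-\mathbf m\|_1=1$, satisfying $w_{\mathbf n,\mathbf m}=w_{\mathbf m,\mathbf n}$ and $M^{-1}\le w_{\mathbf n,\mathbf m}\le M$, the weighted Laplacian $L_w$ on $\ell^2(\mathbb{Z}^d)$ is $[L_w u]_{\mathbf n} = \sum_{\|\mathbf m-\mathbf n\|_1=1} w_{\mathbf n,\mathbf m}u_{\mathbf m}$ (a bounded self-adjoint operator). $w$ is periodic if there is a full-rank subgroup $G\subseteq\mathbb{Z}^d$ with $w_{\mathbf n+\mathbf g,\mathbf m+\mathbf g}=w_{\mathbf n,\mathbf m}$ for all $\mathbf n,\mathbf m$ and $\mathbf g\in G$; $w$ is limit-periodic if it is a uniform limit of periodic weights. A Cantor set is a compact subset of $\mathbb{R}$ with empty interior and no isolated points. Purely singular continuous spectrum means every spectral measure is supported on a Lebesgue-null set and has no atoms. *)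

theory Defs
  imports "HOL-Analysis.Analysis" "HOL-Probability.Probability"
begin

definition adj :: "int ^ 'd::finite \<Rightarrow> int ^ 'd \<Rightarrow> bool" where
  "adj n m \<longleftrightarrow> (\<Sum>i\<in>UNIV. \<bar>n $ i - m $ i\<bar>) = 1"

definition weights_bounded :: "real \<Rightarrow> (int ^ 'd::finite \<Rightarrow> int ^ 'd \<Rightarrow> real) \<Rightarrow> bool" where
  "weights_bounded M w \<longleftrightarrow>
     (\<forall>n m. adj n m \<longrightarrow> w n m = w m n \<and> inverse M \<le> w n m \<and> w n m \<le> M)"

definition is_weight :: "(int ^ 'd::finite \<Rightarrow> int ^ 'd \<Rightarrow> real) \<Rightarrow> bool" where
  "is_weight w \<longleftrightarrow> (\<exists>M. M \<ge> 1 \<and> weights_bounded M w)"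

definition full_rank_subgroup :: "(int ^ 'd::finite) set \<Rightarrow> bool" where
  "full_rank_subgroup G \<longleftrightarrow> 0 \<in> G \<and> (\<forall>a\<in>G. \<forall>b\<in>G. a - b \<in> G) \<and>
     span ((\<lambda>g. (\<chi> i. real_of_int (g $ i)) :: real ^ 'd) ` G) = UNIV"

definition periodic_weight :: "(int ^ 'd::finite \<Rightarrow> int ^ 'd \<Rightarrow> real) \<Rightarrow> bool" where
  "periodic_weight w \<longleftrightarrow> is_weight w \<and>
     (\<exists>G. full_rank_subgroup G \<and>
        (\<forall>n m g. adj n m \<longrightarrow> g \<in> G \<longrightarrow> w (n + g) (m + g) = w n m))"

definition limit_periodic_weight :: "(int ^ 'd::finite \<Rightarrow> int ^ 'd \<Rightarrow> real) \<Rightarrow> bool" where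
  "limit_periodic_weight w \<longleftrightarrow> is_weight w \<and>
     (\<forall>\<epsilon>>0. \<exists>w'. periodic_weight w' \<and> (\<forall>n m. adj n m \<longrightarrow> \<bar>w n m - w' n m\<bar> < \<epsilon>))"

definition ell2 :: "(int ^ 'd::finite \<Rightarrow> complex) set" where
  "ell2 = {u. (\<lambda>n. (norm (u n))\<^sup>2) summable_on UNIV}"

definition ell2_inner :: "(int ^ 'd::finite \<Rightarrow> complex) \<Rightarrow> (int ^ 'd \<Rightarrow> complex) \<Rightarrow> complex" where
  "ell2_inner u v = infsum (\<lambda>n. cnj (u n) * v n) UNIV"

definition weighted_laplacian ::
  "(int ^ 'd::finite \<Rightarrow> int ^ 'd \<Rightarrow> real) \<Rightarrow> (int ^ 'd \<Rightarrow> complex) \<Rightarrow> (int ^ 'd \<Rightarrow> complex)" where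
  "weighted_laplacian w u = (\<lambda>n. \<Sum>m\<in>{m. adj m n}. complex_of_real (w n m) * u m)"

text \<open>Spectrum of an operator on l^2 (real spectrum; the operators considered are self-adjoint).\<close>
definition op_spectrum :: "((int ^ 'd::finite \<Rightarrow> complex) \<Rightarrow> (int ^ 'd \<Rightarrow> complex)) \<Rightarrow> real set" where
  "op_spectrum L = {E. \<not> bij_betw (\<lambda>u n. L u n - complex_of_real E * u n) ell2 ell2}"

text \<open>Spectral measure of u for a bounded self-adjoint L: the finite Borel measure on R
  whose moments are <u, L^k u>.\<close>
definition is_spectral_measure ::
  "((int ^ 'd::finite \<Rightarrow> complex) \<Rightarrow> (int ^ 'd \<Rightarrow> complex)) \<Rightarrow> (int ^ 'd \<Rightarrow> complex) \<Rightarrow> real measure \<Rightarrow> bool" where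
  "is_spectral_measure L u \<mu> \<longleftrightarrow> sets \<mu> = sets borel \<and> finite_measure \<mu> \<and>
     (\<forall>k::nat. integrable \<mu> (\<lambda>x. x ^ k) \<and>
        complex_of_real (\<integral>x. x ^ k \<partial>\<mu>) = ell2_inner u ((L ^^ k) u))"

definition purely_singular_continuous ::
  "((int ^ 'd::finite \<Rightarrow> complex) \<Rightarrow> (int ^ 'd \<Rightarrow> complex)) \<Rightarrow> bool" where
  "purely_singular_continuous L \<longleftrightarrow>
     (\<forall>u\<in>ell2. \<forall>\<mu>. is_spectral_measure L u \<mu> \<longrightarrow>
        (\<exists>N \<in> null_sets lborel. emeasure \<mu> (UNIV - N) = 0) \<and> (\<forall>x. emeasure \<mu> {x} = 0))"

definition cantor_set :: "real set \<Rightarrow> bool" where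
  "cantor_set S \<longleftrightarrow> compact S \<and> interior S = {} \<and> (\<forall>x\<in>S. x islimpt S)"

definition covering_number :: "real set \<Rightarrow> real \<Rightarrow> nat" where
  "covering_number S \<epsilon> = (LEAST k. \<exists>C. finite C \<and> card C = k \<and> S \<subseteq> (\<Union>c\<in>C. cball c \<epsilon>))"

definition lower_box_dim :: "real set \<Rightarrow> ereal" where
  "lower_box_dim S = Liminf (at_right 0)
      (\<lambda>\<epsilon>. ereal (ln (real (covering_number S \<epsilon>)) / - ln \<epsilon>))"

end

theory Submission
  imports Defs "HOL-Real_Asymp.Real_Asymp"
begin

text \<open>Give all edges in direction \<open>i\<close> the weight \<open>a (n $ i)\<close>. Then \<open>L\<^sub>w\<close> is a sum of commuting
copies of a one-dimensional chain, every point of its spectrum is a sum of spectral values of the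
chain, and the task is to choose the limit-periodic sequence \<open>a\<close>.

Periodic approximants are improved repeatedly. A given energy is moved into a spectral gap by a
small periodic perturbation: over a long period the transfer matrix is nearly \<open>1\<close> or \<open>- 1\<close>, and
scaling a single bond then makes it hyperbolic. By compactness finitely many perturbations serve all
energies. If long blocks of them are concatenated, every approximate eigenvector is exponentially
small in the middle of some block, where the chain may be cut; so the spectrum lies in exponentially
small neighbourhoods of about as many points as the new period has sites. If later perturbations are
small enough, this survives in the limit and gives lower box dimension zero, hence Lebesgue
measure zero. Fast periodic approximation also excludes eigenvalues by an argument of Gordon.

The spectrum has no isolated point, since an isolated point of the spectrum of a self-adjoint
operator is an eigenvalue. A measure with the moments of \<open>L\<^sub>w\<close> at a vector is carried by the
spectrum, and an atom would give an eigenvector as a limit of polynomials in \<open>L\<^sub>w\<close>.\<close>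

section \<open>Polynomials in an operator and joint approximate null vectors\<close>

text \<open>Neither measure zero nor lower box dimension zero survives addition of sets: a sum of
  null sets can have interior, and sets with different good scales can add up to a set of positive
  dimension. Hence all directions use one and the same chain. A cover of its spectrum by
  \<open>N\<close> intervals of radius \<delta> then covers the full spectrum by
  \<open>N ^ d\<close> intervals of radius \<open>d * \<delta>\<close>, and the exponent is merely
  multiplied by \<open>d\<close>.

  The passage to the limit dictates the form of the spectral statements. They are lower bounds
  \<open>c * norm v \<le> norm (A v - x *\<^sub>R v)\<close>, which tolerate every perturbation
  smaller than \<open>c\<close>; so whatever a periodic chain achieves holds on a ball of weights,
  and the later balls are placed inside it.

  Cutting is needed because a chain of period \<open>p\<close> has \<open>p\<close> bands, but
  periodicity alone does not bound their widths. The number of points left by the cuts grows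
  linearly in the block length, while the error decays exponentially.

  Eigenvalues are excluded for the sum itself and not for the chain: on an eigenvector, one
  direction acts as the energy minus the other directions, so Gordon's argument runs with an
  operator as energy.\<close>

definition polyop :: "real poly \<Rightarrow> ('h \<Rightarrow> 'h::real_vector) \<Rightarrow> 'h \<Rightarrow> 'h" where
  "polyop p A v = fold_coeffs (\<lambda>c w. c *\<^sub>R v + A w) p 0"

lemma polyop_0 [simp]: "polyop 0 A v = 0"
  by (simp add: polyop_def)

lemma polyop_pCons [simp]:
  assumes "linear A"
  shows "polyop (pCons c p) A v = c *\<^sub>R v + A (polyop p A v)"
  using linear_0[OF assms]
  by (cases "p = 0 \<and> c = 0") (auto simp: polyop_def)

lemma polyop_add [simp]:
  assumes "linear A"
  shows "polyop (p + q) A v = polyop p A v + polyop q A v"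
  using linear_0[OF assms]
  by (induction p q rule: poly_induct2) (auto simp: assms algebra_simps linear_add[OF assms])

lemma polyop_smult [simp]:
  assumes "linear A"
  shows "polyop (smult c p) A v = c *\<^sub>R polyop p A v"
  using linear_0[OF assms]
  by (induction p) (auto simp: assms algebra_simps linear_scale[OF assms])

lemma polyop_minus [simp]:
  assumes "linear A"
  shows "polyop (- p) A v = - polyop p A v"
  using polyop_smult[OF assms, of "-1" p v] by simp

lemma polyop_diff [simp]:
  assumes "linear A"
  shows "polyop (p - q) A v = polyop p A v - polyop q A v"
  using polyop_add[OF assms, of p "- q" v] by (simp add: assms)

lemma polyop_1 [simp]: "linear A \<Longrightarrow> polyop 1 A v = v"
  by (simp add: one_pCons linear_0)

lemma polyop_mult [simp]:
  assumes "linear A"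
  shows "polyop (p * q) A v = polyop p A (polyop q A v)"
  by (induction p) (auto simp: assms)

lemma bounded_linear_polyop:
  assumes "bounded_linear A"
  shows "bounded_linear (polyop p A)"
proof (induction p)
  case 0
  have "polyop 0 A = (\<lambda>v. 0)" by auto
  then show ?case by simp
next
  case (pCons c p)
  have "polyop (pCons c p) A = (\<lambda>v. c *\<^sub>R v + A (polyop p A v))"
    using assms by (auto simp: bounded_linear.linear)
  moreover have "bounded_linear (\<lambda>v. c *\<^sub>R v + A (polyop p A v))"
    by (intro bounded_linear_add bounded_linear_scaleR_right bounded_linear_compose[OF assms] pCons)
  ultimately show ?case by simp
qed

lemma polyop_commute:
  assumes "linear A" "linear B" and "\<And>v. A (B v) = B (A v)"
  shows "B (polyop p A v) = polyop p A (B v)"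
  by (induction p) (simp_all add: assms(3)[symmetric] assms linear_0 linear_add linear_scale)

text \<open>The operators agree at \<open>u\<close> only, but commutation moves \<open>X\<close>
  past each further factor \<open>A\<close> until that factor meets \<open>u\<close> itself.\<close>

lemma polyop_cong_vector:
  assumes "linear A" "linear X" and "\<And>v. A (X v) = X (A v)" and "A u = X u"
  shows "polyop p A u = polyop p X u"
proof (induction p)
  case (pCons c p)
  have "A (polyop p X u) = polyop p X (A u)"
    by (rule polyop_commute) (use assms in auto)
  also have "\<dots> = X (polyop p X u)"
    using polyop_commute[OF assms(2) assms(2), of p u] assms(4) by simp
  finally show ?case using pCons assms by simp
qed auto

lemma polyop_monom:
  assumes "linear A"
  shows "polyop (monom c k) A v = c *\<^sub>R (A ^^ k) v"
proof -
  have *: "(A ^^ k) v = polyop (monom 1 k) A v" for k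
    using assms by (induction k) (auto simp: monom_Suc monom_0 linear_0)
  have "monom c k = smult c (monom 1 k)" by (simp add: smult_monom)
  then show ?thesis using assms * by simp
qed

section \<open>Bounded symmetric operators\<close>

definition symop :: "('h::real_inner \<Rightarrow> 'h) \<Rightarrow> bool" where
  "symop A \<longleftrightarrow> bounded_linear A \<and> (\<forall>u v. A u \<bullet> v = u \<bullet> A v)"

lemma symopD:
  assumes "symop A"
  shows "bounded_linear A" "linear A" "A u \<bullet> v = u \<bullet> A v"
  using assms bounded_linear.linear unfolding symop_def by auto

lemma symop_polyop:
  assumes "symop A"
  shows "symop (polyop p A)"
  unfolding symop_def
proof (intro conjI allI)
  note A = symopD[OF assms]
  show "bounded_linear (polyop p A)" by (rule bounded_linear_polyop[OF A(1)])
  show "polyop p A u \<bullet> v = u \<bullet> polyop p A v" for u v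
  proof (induction p arbitrary: u v)
    case (pCons c p)
    have "A (polyop p A v) = polyop p A (A v)"
      by (rule polyop_commute) (auto simp: A)
    then show ?case using pCons A by (simp add: inner_add_left inner_add_right)
  qed auto
qed

lemma symop_compose:
  assumes "symop A" "symop B" "\<And>v. A (B v) = B (A v)"
  shows "symop (\<lambda>v. A (B v))"
  using assms by (auto simp: symop_def intro: bounded_linear_compose)

lemma symop_diff: "symop A \<Longrightarrow> symop B \<Longrightarrow> symop (\<lambda>v. A v - B v)"
  by (auto simp: symop_def inner_diff_left inner_diff_right bounded_linear_sub)

lemma symop_add: "symop A \<Longrightarrow> symop B \<Longrightarrow> symop (\<lambda>v. A v + B v)"
  by (auto simp: symop_def inner_add_left inner_add_right bounded_linear_add)

lemma symop_scaleR: "symop (\<lambda>v. c *\<^sub>R v)"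
  by (auto simp: symop_def bounded_linear_scaleR_right)

lemma symop_shift: "symop A \<Longrightarrow> symop (\<lambda>v. A v - x *\<^sub>R v)"
  by (intro symop_diff symop_scaleR)

lemma symop_sum: "finite I \<Longrightarrow> (\<And>i. i \<in> I \<Longrightarrow> symop (A i)) \<Longrightarrow> symop (\<lambda>v. \<Sum>i\<in>I. A i v)"
  by (induction I rule: finite_induct) (auto simp: symop_add, simp add: symop_def)

lemma symop_pos_bound:
  assumes "symop A"
  obtains R where "R > 0" "\<And>v. norm (A v) \<le> R * norm v"
  using bounded_linear.pos_bounded[OF symopD(1)[OF assms]] by (metis mult.commute)

text \<open>For symmetric operators on a complete space the negation means that \<open>x\<close>
  lies in the spectrum, by \<open>bounded_below_imp_bij\<close> and
  \<open>bij_imp_bounded_below\<close>.\<close>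

definition bounded_below_at :: "('h::real_normed_vector \<Rightarrow> 'h) \<Rightarrow> real \<Rightarrow> bool" where
  "bounded_below_at A x \<longleftrightarrow> (\<exists>c>0. \<forall>v. c * norm v \<le> norm (A v - x *\<^sub>R v))"

text \<open>Weyl vectors for a whole family. They play the part of joint eigenvectors, which need
  not exist.\<close>

definition approx_kernel :: "('h::real_normed_vector \<Rightarrow> 'h) set \<Rightarrow> bool" where
  "approx_kernel Fs \<longleftrightarrow> (\<forall>\<epsilon>>0. \<exists>v. norm v = 1 \<and> (\<forall>F\<in>Fs. norm (F v) \<le> \<epsilon>))"

lemma approx_kernelI:
  assumes "\<And>\<epsilon>. \<epsilon> > 0 \<Longrightarrow> \<exists>v. v \<noteq> 0 \<and> (\<forall>F\<in>Fs. norm (F v) \<le> \<epsilon> * norm v)"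
    and "\<And>F. F \<in> Fs \<Longrightarrow> linear F"
  shows "approx_kernel Fs"
  unfolding approx_kernel_def
proof (intro allI impI)
  fix \<epsilon> :: real assume "\<epsilon> > 0"
  then obtain v where v: "v \<noteq> 0" "\<forall>F\<in>Fs. norm (F v) \<le> \<epsilon> * norm v" using assms by blast
  have "norm (F (v /\<^sub>R norm v)) \<le> \<epsilon>" if "F \<in> Fs" for F
    using v that linear_scale[OF assms(2)[OF that], of "inverse (norm v)" v]
    by (auto simp: field_simps)
  then show "\<exists>v. norm v = 1 \<and> (\<forall>F\<in>Fs. norm (F v) \<le> \<epsilon>)"
    using v by (intro exI[of _ "v /\<^sub>R norm v"]) auto
qed

lemma not_bounded_below_at_iff:
  assumes "linear A"
  shows "\<not> bounded_below_at A x \<longleftrightarrow> approx_kernel {\<lambda>v. A v - x *\<^sub>R v}"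
proof
  assume a: "\<not> bounded_below_at A x"
  show "approx_kernel {\<lambda>v. A v - x *\<^sub>R v}"
  proof (rule approx_kernelI)
    fix \<epsilon> :: real assume "\<epsilon> > 0"
    with a obtain v where "norm (A v - x *\<^sub>R v) < \<epsilon> * norm v"
      unfolding bounded_below_at_def by (meson not_le)
    then show "\<exists>v. v \<noteq> 0 \<and> (\<forall>F\<in>{\<lambda>v. A v - x *\<^sub>R v}. norm (F v) \<le> \<epsilon> * norm v)"
      using linear_0[OF assms] by (intro exI[of _ v]) auto
  next
    fix F assume "F \<in> {\<lambda>v. A v - x *\<^sub>R v}"
    then show "linear F" using assms by (auto simp: linear_iff algebra_simps)
  qed
next
  assume a: "approx_kernel {\<lambda>v. A v - x *\<^sub>R v}"
  show "\<not> bounded_below_at A x"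
  proof
    assume "bounded_below_at A x"
    then obtain c where c: "c > 0" "\<And>v. c * norm v \<le> norm (A v - x *\<^sub>R v)"
      by (auto simp: bounded_below_at_def)
    obtain v where "norm v = 1" "norm (A v - x *\<^sub>R v) \<le> c / 2"
      using a c(1) unfolding approx_kernel_def by (metis half_gt_zero singletonI)
    with c(2)[of v] c(1) show False by simp
  qed
qed

lemma bounded_below_at_perturb:
  assumes "\<And>v. c * norm v \<le> norm (A v - x *\<^sub>R v)"
    and "\<And>v. norm (B v - A v) \<le> e * norm v" "\<bar>y - x\<bar> \<le> d"
  shows "(c - e - d) * norm v \<le> norm (B v - y *\<^sub>R v)"
proof -
  have eq: "A v - x *\<^sub>R v = (B v - y *\<^sub>R v) - (B v - A v) + (y - x) *\<^sub>R v"
    by (simp add: algebra_simps)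
  have "c * norm v \<le> norm (A v - x *\<^sub>R v)" by (rule assms)
  also have "\<dots> \<le> norm (B v - y *\<^sub>R v) + norm (B v - A v) + norm ((y - x) *\<^sub>R v)"
    unfolding eq by (meson norm_triangle_ineq norm_triangle_ineq4 add_right_mono order_trans)
  also have "norm (B v - A v) \<le> e * norm v" by (rule assms)
  also have "norm ((y - x) *\<^sub>R v) \<le> d * norm v" using assms(3) by (simp add: mult_right_mono)
  finally show ?thesis by (simp add: algebra_simps)
qed

text \<open>\<open>m\<close> is the least size of \<open>A - x\<close> on approximate joint null vectors of \<open>Fs\<close>. On these, the
  operator \<open>C = (A - x)\<^sup>2 - m\<^sup>2\<close> is approximately nonnegative with infimum \<open>0\<close>, so moving along
  \<open>v - t C v\<close> forces \<open>C v\<close> to be small for near minimizers, and \<open>C\<close> factors.\<close>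

lemma approx_kernel_insert_near:
  fixes A :: "'h::real_inner \<Rightarrow> 'h"
  assumes A: "symop A" and lin: "\<And>F. F \<in> Fs \<Longrightarrow> bounded_linear F"
    and comm: "\<And>F v. F \<in> Fs \<Longrightarrow> F (A v) = A (F v)"
    and near: "\<And>\<epsilon>. \<epsilon> > 0 \<Longrightarrow> \<exists>v. norm v = 1 \<and> (\<forall>F\<in>Fs. norm (F v) \<le> \<epsilon>) \<and> norm (A v - x *\<^sub>R v) \<le> \<theta>"
  shows "\<exists>y. \<bar>y - x\<bar> \<le> \<theta> \<and> approx_kernel (insert (\<lambda>v. A v - y *\<^sub>R v) Fs)"
proof -
  define D where "D = (\<lambda>v. A v - x *\<^sub>R v)"
  have D: "symop D" unfolding D_def by (rule symop_shift[OF A])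
  note Dl = symopD(1,2)[OF D] and Dsym = symopD(3)[OF D]
  have commD: "F (D v) = D (F v)" if "F \<in> Fs" for F v
    using bounded_linear.linear[OF lin[OF that]] comm[OF that] by (simp add: D_def linear_diff linear_scale)
  define S where "S = {r. 0 \<le> r \<and> (\<forall>\<epsilon>>0. \<exists>v. norm v = 1 \<and> (\<forall>F\<in>Fs. norm (F v) \<le> \<epsilon>) \<and> norm (D v) \<le> r)}"
  define m where "m = Inf S"
  have "\<theta> \<ge> 0" using near[of 1] by (meson norm_ge_zero order_trans zero_less_one)
  then have \<theta>S: "\<theta> \<in> S" using near by (simp add: S_def D_def)
  have bdd: "bdd_below S" by (auto simp: S_def bdd_below_def)
  have m0: "0 \<le> m" unfolding m_def using \<theta>S by (intro cInf_greatest) (auto simp: S_def)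
  have m\<theta>: "m \<le> \<theta>" unfolding m_def by (rule cInf_lower[OF \<theta>S bdd])
  have above: "\<exists>v. norm v = 1 \<and> (\<forall>F\<in>Fs. norm (F v) \<le> \<epsilon>) \<and> norm (D v) \<le> m + \<eta>" if "\<epsilon> > 0" "\<eta> > 0" for \<epsilon> \<eta>
  proof -
    obtain r where "r \<in> S" "r < m + \<eta>"
      using cInf_lessD[of S "m + \<eta>"] \<theta>S \<open>\<eta> > 0\<close> m_def by auto
    then show ?thesis using that by (auto simp: S_def) (meson less_imp_le order_trans)
  qed
  have below: "\<exists>\<epsilon>>0. \<forall>v. (\<forall>F\<in>Fs. norm (F v) \<le> \<epsilon> * norm v) \<longrightarrow> (m\<^sup>2 - \<eta>) * (norm v)\<^sup>2 \<le> (norm (D v))\<^sup>2"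
    if "\<eta> > 0" for \<eta>
  proof (cases "m\<^sup>2 - \<eta> \<le> 0")
    case True
    then have "(m\<^sup>2 - \<eta>) * (norm v)\<^sup>2 \<le> (norm (D v))\<^sup>2" for v
      by (meson mult_nonpos_nonneg order_trans zero_le_power2)
    then show ?thesis by (intro exI[of _ 1]) auto
  next
    case False
    define r where "r = sqrt (m\<^sup>2 - \<eta>)"
    have r: "0 \<le> r" "r\<^sup>2 = m\<^sup>2 - \<eta>" using False by (auto simp: r_def)
    have "r\<^sup>2 < m\<^sup>2" using r(2) that by linarith
    then have rm: "r < m" using m0 by (rule power2_less_imp_less)
    have "r \<notin> S"
    proof
      assume "r \<in> S"
      then have "m \<le> r" unfolding m_def by (rule cInf_lower[OF _ bdd])
      with rm show False by simp
    qed
    then have "\<not> (\<forall>\<epsilon>>0. \<exists>v. norm v = 1 \<and> (\<forall>F\<in>Fs. norm (F v) \<le> \<epsilon>) \<and> norm (D v) \<le> r)"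
      using r(1) unfolding S_def by blast
    then obtain \<epsilon> where "\<epsilon> > 0" "\<not> (\<exists>v. norm v = 1 \<and> (\<forall>F\<in>Fs. norm (F v) \<le> \<epsilon>) \<and> norm (D v) \<le> r)"
      by blast
    then have \<epsilon>: "\<epsilon> > 0" "\<And>v. norm v = 1 \<Longrightarrow> (\<forall>F\<in>Fs. norm (F v) \<le> \<epsilon>) \<Longrightarrow> norm (D v) > r"
      by (meson not_le)+
    have "(m\<^sup>2 - \<eta>) * (norm v)\<^sup>2 \<le> (norm (D v))\<^sup>2" if v: "\<forall>F\<in>Fs. norm (F v) \<le> \<epsilon> * norm v" for v
    proof (cases "v = 0")
      case False
      have "norm (F (v /\<^sub>R norm v)) \<le> \<epsilon>" if "F \<in> Fs" for F
        using v that False linear_scale[OF bounded_linear.linear[OF lin[OF that]], of "inverse (norm v)" v]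
        by (auto simp: field_simps)
      then have "norm (D (v /\<^sub>R norm v)) > r" using False by (intro \<epsilon>) auto
      then have "r * norm v \<le> norm (D v)"
        using False linear_scale[OF Dl(2), of "inverse (norm v)" v] by (simp add: field_simps)
      then have "(r * norm v)\<^sup>2 \<le> (norm (D v))\<^sup>2" using r by (intro power_mono) auto
      then show ?thesis by (simp add: power_mult_distrib r)
    qed simp
    then show ?thesis using \<epsilon>(1) by blast
  qed
  define C where "C = (\<lambda>v. D (D v) - m\<^sup>2 *\<^sub>R v)"
  have C: "symop C" unfolding C_def by (rule symop_shift[OF symop_compose[OF D D refl]])
  note Cl = symopD(1,2)[OF C] and Csym = symopD(3)[OF C]
  have commC: "F (C v) = C (F v)" if "F \<in> Fs" for F v
    using bounded_linear.linear[OF lin[OF that]] commD[OF that] by (simp add: C_def linear_diff linear_scale)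
  have Cquad: "v \<bullet> C v = (norm (D v))\<^sup>2 - m\<^sup>2 * (norm v)\<^sup>2" for v
    by (simp add: C_def inner_diff_right power2_norm_eq_inner Dsym)
  obtain K where K: "K > 0" "\<And>v. norm (C v) \<le> K * norm v" using symop_pos_bound[OF C] by blast
  have Csmall: "\<exists>v. norm v = 1 \<and> (\<forall>F\<in>Fs. norm (F v) \<le> \<epsilon>) \<and> norm (C v) \<le> \<eta>" if "\<epsilon> > 0" "\<eta> > 0" for \<epsilon> \<eta>
  proof -
    \<comment> \<open>This \<open>t\<close> keeps the step \<open>t *\<^sub>R C v\<close> below 1/2
      in norm, so \<open>z\<close> is comparable to \<open>v\<close>. The 6 in \<eta>' leaves room
      for the five multiples of \<eta>' that collect below: one from \<open>q1\<close> and four from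
      \<open>q2\<close>.\<close>
    define t where "t = 1 / (2 * K)"
    have t: "t > 0" "t * K = 1 / 2" using K by (auto simp: t_def)
    define \<eta>' where "\<eta>' = t * \<eta>\<^sup>2 / 6"
    have \<eta>': "\<eta>' > 0" using that t by (simp add: \<eta>'_def)
    obtain \<epsilon>0 where \<epsilon>0: "\<epsilon>0 > 0"
      "\<And>v. (\<forall>F\<in>Fs. norm (F v) \<le> \<epsilon>0 * norm v) \<Longrightarrow> (m\<^sup>2 - \<eta>') * (norm v)\<^sup>2 \<le> (norm (D v))\<^sup>2"
      using below[OF \<eta>'] by blast
    define \<epsilon>1 where "\<epsilon>1 = min \<epsilon> (\<epsilon>0 / 4)"
    define \<eta>1 where "\<eta>1 = min 1 (\<eta>' / (2 * m + 1))"
    have "\<epsilon>1 > 0" "\<eta>1 > 0" using \<epsilon>0 that \<eta>' m0 by (auto simp: \<epsilon>1_def \<eta>1_def)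
    then obtain v where v: "norm v = 1" "\<And>F. F \<in> Fs \<Longrightarrow> norm (F v) \<le> \<epsilon>1" "norm (D v) \<le> m + \<eta>1"
      using above by blast
    have "\<eta>1 * \<eta>1 \<le> \<eta>1 * 1" using \<open>\<eta>1 > 0\<close> by (intro mult_left_mono) (auto simp: \<eta>1_def)
    moreover have "\<eta>1 \<le> \<eta>' / (2 * m + 1)" by (simp add: \<eta>1_def)
    then have "\<eta>1 * (2 * m + 1) \<le> \<eta>'" using m0 by (simp add: pos_le_divide_eq)
    ultimately have "(m + \<eta>1)\<^sup>2 \<le> m\<^sup>2 + \<eta>'" by (simp add: power2_eq_square algebra_simps)
    then have q1: "v \<bullet> C v \<le> \<eta>'" using v power_mono[OF v(3), of 2] by (simp add: Cquad)
    define z where "z = v - t *\<^sub>R C v"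
    have "t * norm (C v) \<le> t * K" using K(2)[of v] v(1) t by (intro mult_left_mono) auto
    then have Cv: "norm (t *\<^sub>R C v) \<le> 1/2" using t by simp
    have "norm z \<ge> norm v - norm (t *\<^sub>R C v)"
      unfolding z_def by (rule norm_triangle_ineq2)
    moreover have "norm z \<le> norm v + norm (t *\<^sub>R C v)"
      unfolding z_def by (rule norm_triangle_ineq4)
    ultimately have z: "norm z \<ge> 1/2" "norm z \<le> 2" using Cv v by linarith+
    have "norm (F z) \<le> \<epsilon>0 * norm z" if "F \<in> Fs" for F
    proof -
      have "F z = F v - t *\<^sub>R C (F v)"
        using bounded_linear.linear[OF lin[OF that]] by (simp add: z_def linear_diff linear_scale commC[OF that])
      then have "norm (F z) \<le> norm (F v) + t * norm (C (F v))"
        using t by (metis abs_of_pos norm_scaleR norm_triangle_ineq4)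
      also have "t * norm (C (F v)) \<le> t * (K * norm (F v))" using t K by (intro mult_left_mono) auto
      also have "t * (K * norm (F v)) = norm (F v) / 2" using t by (simp add: mult.assoc[symmetric])
      finally have "norm (F z) \<le> 2 * \<epsilon>1" using v(2)[OF that] norm_ge_zero[of "F v"] by linarith
      also have "\<dots> \<le> \<epsilon>0 * (1/2)" by (auto simp: \<epsilon>1_def)
      also have "\<dots> \<le> \<epsilon>0 * norm z" using z \<epsilon>0 by (intro mult_left_mono) auto
      finally show ?thesis .
    qed
    then have "(m\<^sup>2 - \<eta>') * (norm z)\<^sup>2 \<le> (norm (D z))\<^sup>2" by (intro \<epsilon>0) auto
    then have "z \<bullet> C z \<ge> - \<eta>' * (norm z)\<^sup>2" by (simp add: Cquad algebra_simps)
    moreover have "(norm z)\<^sup>2 \<le> 2\<^sup>2" using z by (intro power_mono) auto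
    then have "\<eta>' * (norm z)\<^sup>2 \<le> \<eta>' * 4" using \<eta>' by (intro mult_left_mono) auto
    ultimately have q2: "z \<bullet> C z \<ge> - 4 * \<eta>'" by simp
    have Cz: "C z = C v - t *\<^sub>R C (C v)"
      using Cl(2) by (simp add: z_def linear_diff linear_scale)
    have "v \<bullet> C (C v) = C v \<bullet> C v" by (simp add: Csym)
    then have "z \<bullet> C z = v \<bullet> C v - 2 * t * (norm (C v))\<^sup>2 + t * (t * (C v \<bullet> C (C v)))"
      unfolding Cz unfolding z_def
      by (simp add: inner_diff_left inner_diff_right power2_norm_eq_inner algebra_simps)
    moreover have "t * (C v \<bullet> C (C v)) \<le> (norm (C v))\<^sup>2"
    proof -
      have "C v \<bullet> C (C v) \<le> norm (C v) * norm (C (C v))" by (rule norm_cauchy_schwarz)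
      also have "\<dots> \<le> norm (C v) * (K * norm (C v))" using K by (intro mult_left_mono) auto
      finally have "t * (C v \<bullet> C (C v)) \<le> t * (norm (C v) * (K * norm (C v)))" using t by (intro mult_left_mono) auto
      also have "\<dots> = (norm (C v))\<^sup>2 / 2" using t by (simp add: power2_eq_square algebra_simps)
      also have "\<dots> \<le> (norm (C v))\<^sup>2" by simp
      finally show ?thesis .
    qed
    ultimately have "t * (norm (C v))\<^sup>2 \<le> 5 * \<eta>'" using q1 q2 t
      mult_left_mono[of "t * (C v \<bullet> C (C v))" "(norm (C v))\<^sup>2" t] by linarith
    also have "5 * \<eta>' \<le> t * \<eta>\<^sup>2" using t by (simp add: \<eta>'_def)
    finally have "norm (C v) \<le> \<eta>" using t that by (auto intro: power2_le_imp_le)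
    then show ?thesis using v by (intro exI[of _ v]) (auto simp: \<epsilon>1_def)
  qed
  define Y where "Y = (\<lambda>y. approx_kernel (insert (\<lambda>v. A v - y *\<^sub>R v) Fs))"
  have linY: "linear F" if "F \<in> insert (\<lambda>v. A v - y *\<^sub>R v) Fs" for F y
    using that bounded_linear.linear[OF lin] symopD(2)[OF symop_shift[OF A]] by auto
  have "Y (x - m) \<or> Y (x + m)"
  proof (rule disjCI)
    assume nY: "\<not> Y (x + m)"
    \<comment> \<open>If \<open>x + m\<close> fails, \<open>B\<close> is bounded below on
      approximate null vectors of \<open>Fs\<close>. For a vector with small \<open>C v\<close>, the
      vector \<open>B v\<close> is then an approximate eigenvector for \<open>x - m\<close>, since
      \<open>A - (x - m)\<close> maps it to \<open>C v\<close>.\<close>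
    define B where "B = (\<lambda>v. A v - (x + m) *\<^sub>R v)"
    have B: "symop B" unfolding B_def by (rule symop_shift[OF A])
    have commB: "F (B v) = B (F v)" if "F \<in> Fs" for F v
      using bounded_linear.linear[OF lin[OF that]] comm[OF that] by (simp add: B_def linear_diff linear_scale)
    obtain K' where K': "K' > 0" "\<And>v. norm (B v) \<le> K' * norm v" using symop_pos_bound[OF B] by blast
    from nY obtain \<epsilon>1 where e: "\<epsilon>1 > 0"
      "\<not> (\<exists>v. norm v = 1 \<and> (\<forall>F\<in>insert B Fs. norm (F v) \<le> \<epsilon>1))"
      unfolding Y_def approx_kernel_def B_def by blast
    have \<epsilon>1: "norm (B v) > \<epsilon>1" if "norm v = 1" "\<forall>F\<in>Fs. norm (F v) \<le> \<epsilon>1" for v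
      using e(2) that not_le by (metis insert_iff)
    show "Y (x - m)" unfolding Y_def
    proof (rule approx_kernelI[OF _ linY])
      fix \<epsilon> :: real assume "\<epsilon> > 0"
      define \<epsilon>2 where "\<epsilon>2 = min \<epsilon>1 (\<epsilon> * \<epsilon>1 / K')"
      have "\<epsilon>2 > 0" "\<epsilon> * \<epsilon>1 > 0" using e(1) \<open>\<epsilon> > 0\<close> K' by (auto simp: \<epsilon>2_def)
      then obtain v where v: "norm v = 1" "\<And>F. F \<in> Fs \<Longrightarrow> norm (F v) \<le> \<epsilon>2" "norm (C v) \<le> \<epsilon> * \<epsilon>1"
        using Csmall by blast
      have Bv: "norm (B v) > \<epsilon>1" using v by (intro \<epsilon>1) (force simp: \<epsilon>2_def)+
      have le: "\<epsilon> * \<epsilon>1 \<le> \<epsilon> * norm (B v)" using Bv \<open>\<epsilon> > 0\<close> by simp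
      have "norm (F (B v)) \<le> \<epsilon> * norm (B v)" if "F \<in> Fs" for F
      proof -
        have "norm (F (B v)) \<le> K' * norm (F v)" using K' commB[OF that] by simp
        also have "\<dots> \<le> K' * (\<epsilon> * \<epsilon>1 / K')" using K' v(2)[OF that] by (intro mult_left_mono) (auto simp: \<epsilon>2_def)
        also have "\<dots> = \<epsilon> * \<epsilon>1" using K' by simp
        finally show ?thesis using le by linarith
      qed
      moreover have "A (B v) - (x - m) *\<^sub>R B v = C v"
        using symopD(2)[OF A] unfolding B_def C_def D_def
        by (simp add: linear_diff linear_scale linear_add algebra_simps power2_eq_square)
      ultimately show "\<exists>w. w \<noteq> 0 \<and> (\<forall>F\<in>insert (\<lambda>v. A v - (x - m) *\<^sub>R v) Fs. norm (F w) \<le> \<epsilon> * norm w)"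
        using v le Bv e(1) by (intro exI[of _ "B v"]) auto
    qed
  qed
  moreover have "\<bar>x - m - x\<bar> \<le> \<theta>" "\<bar>x + m - x\<bar> \<le> \<theta>" using m0 m\<theta> by auto
  ultimately show ?thesis unfolding Y_def by blast
qed

text \<open>The residual of a vector bounds the distance to the spectrum: this is
  \<open>approx_kernel_insert_near\<close> with no constraints.\<close>

lemma approx_eigenvalue_imp_spectrum:
  fixes A :: "'h::real_inner \<Rightarrow> 'h"
  assumes A: "symop A" and v: "v \<noteq> 0" "norm (A v - x *\<^sub>R v) \<le> t * norm v"
  shows "\<exists>y. \<bar>y - x\<bar> \<le> t \<and> \<not> bounded_below_at A y"
proof -
  note Al = symopD(2)[OF A]
  define u where "u = v /\<^sub>R norm v"
  have "A u - x *\<^sub>R u = (A v - x *\<^sub>R v) /\<^sub>R norm v"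
    by (simp add: u_def linear_scale[OF Al] scaleR_diff_right)
  then have "norm (A u - x *\<^sub>R u) = norm ((A v - x *\<^sub>R v) /\<^sub>R norm v)" by (rule arg_cong)
  also have "\<dots> = norm (A v - x *\<^sub>R v) / norm v"
    by (simp only: norm_scaleR abs_inverse abs_norm_cancel divide_inverse_commute)
  also have "\<dots> \<le> t" using v by (simp add: pos_divide_le_eq)
  finally have "norm (A u - x *\<^sub>R u) \<le> t" .
  moreover have "norm u = 1" using v by (simp add: u_def)
  ultimately show ?thesis
    using approx_kernel_insert_near[OF A, of "{}" x t] not_bounded_below_at_iff[OF Al] by auto
qed

section \<open>Spectra of symmetric operators\<close>

lemma norm_diff_scaleR_square:
  "(norm (v - t *\<^sub>R w))\<^sup>2 = (norm v)\<^sup>2 - 2 * t * (v \<bullet> w) + t\<^sup>2 * (norm w)\<^sup>2" for v w :: "'h::real_inner"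
  unfolding power2_norm_eq_inner
  by (simp add: inner_diff_left inner_diff_right inner_commute algebra_simps power2_eq_square)

text \<open>One Richardson step for \<open>D (D v) = 0\<close>. The lower bound is assumed at the
  single vector \<open>v\<close>, so the estimate also applies on the range of an operator that has
  a kernel.\<close>

lemma richardson_contraction:
  fixes D :: "'h::real_inner \<Rightarrow> 'h"
  assumes D: "symop D" and R: "R > 0" "\<And>v. norm (D v) \<le> R * norm v"
    and c: "c \<ge> 0" "c * norm v \<le> norm (D v)"
  shows "norm (v - (1 / R\<^sup>2) *\<^sub>R D (D v)) \<le> sqrt (max 0 (1 - c\<^sup>2 / R\<^sup>2)) * norm v"
proof -
  define \<tau> where "\<tau> = 1 / R\<^sup>2"
  have \<tau>: "\<tau> > 0" "\<tau> * R\<^sup>2 = 1" using R by (auto simp: \<tau>_def)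
  have "(norm (v - \<tau> *\<^sub>R D (D v)))\<^sup>2 = (norm v)\<^sup>2 - 2 * \<tau> * (norm (D v))\<^sup>2 + \<tau>\<^sup>2 * (norm (D (D v)))\<^sup>2"
    by (simp add: norm_diff_scaleR_square flip: power2_norm_eq_inner symopD(3)[OF D])
  also have "\<tau>\<^sup>2 * (norm (D (D v)))\<^sup>2 \<le> \<tau>\<^sup>2 * (R * norm (D v))\<^sup>2"
    using R by (intro mult_left_mono power_mono) auto
  also have "\<tau>\<^sup>2 * (R * norm (D v))\<^sup>2 = \<tau> * (\<tau> * R\<^sup>2) * (norm (D v))\<^sup>2"
    by (simp add: power2_eq_square algebra_simps)
  also have "\<dots> = \<tau> * (norm (D v))\<^sup>2" using \<tau> by simp
  finally have "(norm (v - \<tau> *\<^sub>R D (D v)))\<^sup>2 \<le> (norm v)\<^sup>2 - \<tau> * (norm (D v))\<^sup>2" by simp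
  moreover have "\<tau> * (c * norm v)\<^sup>2 \<le> \<tau> * (norm (D v))\<^sup>2"
    using \<tau> c by (intro mult_left_mono power_mono) auto
  ultimately have "(norm (v - \<tau> *\<^sub>R D (D v)))\<^sup>2 \<le> (1 - c\<^sup>2 / R\<^sup>2) * (norm v)\<^sup>2"
    by (simp add: algebra_simps power_mult_distrib \<tau>_def)
  also have "\<dots> \<le> (sqrt (max 0 (1 - c\<^sup>2 / R\<^sup>2)) * norm v)\<^sup>2" by (simp add: power_mult_distrib mult_right_mono)
  finally show ?thesis unfolding \<tau>_def by (rule power2_le_imp_le) simp
qed

text \<open>Surjectivity: the equation \<open>D (D v) = y\<close> is solved by Banach's fixed point
  theorem, the contraction being the Richardson step; \<open>D v\<close> is then a preimage of
  \<open>y\<close>.\<close>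

lemma bounded_below_imp_bij:
  fixes A :: "'h::{real_inner,banach} \<Rightarrow> 'h"
  assumes A: "symop A" and bb: "bounded_below_at A x"
  shows "bij (\<lambda>v. A v - x *\<^sub>R v)"
proof -
  define D where "D = (\<lambda>v. A v - x *\<^sub>R v)"
  have D: "symop D" unfolding D_def by (rule symop_shift[OF A])
  note Dl = symopD(2)[OF D] and Dsym = symopD(3)[OF D]
  obtain c where c: "c > 0" "\<And>v. c * norm v \<le> norm (D v)"
    using bb by (auto simp: bounded_below_at_def D_def)
  obtain R where R: "R > 0" "\<And>v. norm (D v) \<le> R * norm v"
    using symop_pos_bound[OF D] by blast
  have "inj D"
  proof (rule injI)
    fix u v assume "D u = D v"
    then have "D (u - v) = 0" by (simp add: linear_diff[OF Dl])
    then have "c * norm (u - v) \<le> 0" using c(2)[of "u - v"] by simp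
    then show "u = v" using c(1) by (simp add: mult_le_0_iff)
  qed
  moreover have "\<exists>v. D v = y" for y
  proof -
    define f where "f = (\<lambda>v. v + (1 / R\<^sup>2) *\<^sub>R (y - D (D v)))"
    define q where "q = sqrt (max 0 (1 - c\<^sup>2 / R\<^sup>2))"
    have q: "0 \<le> q" "q < 1" using R c by (auto simp: q_def)
    have "\<exists>!v. v \<in> UNIV \<and> f v = v"
    proof (rule Banach_fix[OF _ _ q])
      show "dist (f u) (f v) \<le> q * dist u v" if "u \<in> UNIV" "v \<in> UNIV" for u v
      proof -
        have "f u - f v = (u - v) - (1 / R\<^sup>2) *\<^sub>R D (D (u - v))"
          by (simp add: f_def linear_diff[OF Dl] algebra_simps)
        then show ?thesis
          using richardson_contraction[OF D R less_imp_le[OF c(1)] c(2), of "u - v"] by (simp only: dist_norm q_def)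
      qed
    qed (auto simp: complete_UNIV)
    then obtain v where "f v = v" by blast
    then have "D (D v) = y" using R by (simp add: f_def)
    then show ?thesis by blast
  qed
  ultimately show ?thesis unfolding D_def[symmetric] bij_def surj_def by metis
qed

text \<open>The inverse of a bijective symmetric operator is everywhere defined and symmetric, hence
  bounded (Hellinger--Toeplitz) by the Baire category theorem.\<close>

lemma bij_imp_bounded_below:
  fixes A :: "'h::{real_inner,banach} \<Rightarrow> 'h"
  assumes A: "symop A" and bij: "bij (\<lambda>v. A v - x *\<^sub>R v)"
  shows "bounded_below_at A x"
proof -
  define D where "D = (\<lambda>v. A v - x *\<^sub>R v)"
  have D: "symop D" unfolding D_def by (rule symop_shift[OF A])
  note Dl = symopD(2)[OF D] and Dsym = symopD(3)[OF D]
  define B where "B = inv D"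
  have DB: "D (B z) = z" and BD: "B (D z) = z" for z
    using bij unfolding B_def D_def[symmetric] by (auto simp: bij_is_surj surj_f_inv_f bij_is_inj)
  have Bsym: "B u \<bullet> v = u \<bullet> B v" for u v by (metis DB Dsym)
  \<comment> \<open>By symmetry of \<open>B\<close>, this is the set where
    \<open>norm (B z) \<le> N\<close>. Written with inner products it is an intersection of closed
    sets, although \<open>B\<close> is not yet known to be continuous.\<close>
  define F where "F = (\<lambda>N::nat. {z. \<forall>v. \<bar>B v \<bullet> z\<bar> \<le> real N * norm v})"
  have Fcl: "closed (F N)" for N
    unfolding F_def by (intro closed_Collect_all closed_Collect_le continuous_intros)
  have cover: "\<exists>N. z \<in> F N" for z
  proof -
    obtain N :: nat where N: "norm (B z) \<le> real N" using real_arch_simple by blast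
    have "\<bar>B v \<bullet> z\<bar> \<le> real N * norm v" for v
    proof -
      have "\<bar>B v \<bullet> z\<bar> \<le> norm v * norm (B z)" unfolding Bsym by (rule Cauchy_Schwarz_ineq2)
      also have "\<dots> \<le> norm v * real N" using N by (intro mult_left_mono) auto
      finally show ?thesis by (simp add: mult.commute)
    qed
    then show ?thesis by (auto simp: F_def)
  qed
  have "\<exists>N. interior (F N) \<noteq> {}"
  proof (rule ccontr)
    assume "\<not> ?thesis"
    then have "Met_TC.mtopology interior_of \<Union>(range F) = {}"
      by (intro Met_TC.metric_Baire_category_alt) (auto simp: Fcl)
    moreover have "\<Union>(range F) = UNIV" using cover by auto
    ultimately show False using open_UNIV by (fastforce simp: interior_of_def)
  qed
  then obtain N z0 where "z0 \<in> interior (F N)" by auto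
  then obtain r where r: "r > 0" "cball z0 r \<subseteq> F N"
    by (meson interior_subset mem_interior_cball subset_trans)
  have bound: "norm (B h) \<le> 2 * real N" if h: "norm h \<le> r" for h
  proof -
    \<comment> \<open>Membership is tested with \<open>v = B h\<close>, which turns
      \<open>B v \<bullet> h\<close> into the square of \<open>norm (B h)\<close>. The factor 2
      comes from subtracting the centre.\<close>
    have "z0 + h \<in> F N" "z0 \<in> F N" using r h by (auto simp: dist_norm)
    then have "\<bar>B (B h) \<bullet> (z0 + h)\<bar> \<le> real N * norm (B h)" "\<bar>B (B h) \<bullet> z0\<bar> \<le> real N * norm (B h)"
      by (auto simp: F_def)
    then have "\<bar>B (B h) \<bullet> h\<bar> \<le> 2 * real N * norm (B h)" by (auto simp: inner_add_right)
    moreover have "B (B h) \<bullet> h = norm (B h) * norm (B h)"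
      by (metis Bsym inner_commute power2_eq_square power2_norm_eq_inner)
    ultimately have "norm (B h) * norm (B h) \<le> 2 * real N * norm (B h)" by simp
    then show ?thesis by (cases "B h = 0") auto
  qed
  have "r / (2 * real N + 1) * norm v \<le> norm (D v)" for v
  proof (cases "D v = 0")
    case True
    then have "v = 0" using BD[of v] BD[of 0] linear_0[OF Dl] by simp
    then show ?thesis by simp
  next
    case False
    define s where "s = r / norm (D v)"
    have s: "s > 0" using False r by (simp add: s_def)
    have "D (s *\<^sub>R v) = s *\<^sub>R D v" by (rule linear_scale[OF Dl])
    then have "norm (B (D (s *\<^sub>R v))) \<le> 2 * real N" using s False r by (intro bound) (simp add: s_def)
    then have "s * norm v \<le> 2 * real N" using s by (simp add: BD)
    then have "r * norm v \<le> 2 * real N * norm (D v)" using False by (simp add: s_def field_simps)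
    also have "\<dots> \<le> (2 * real N + 1) * norm (D v)" by (intro mult_right_mono) auto
    finally show ?thesis by (simp add: field_simps)
  qed
  then show ?thesis unfolding bounded_below_at_def D_def using r
    by (intro exI[of _ "r / (2 * real N + 1)"]) (auto intro: divide_pos_pos)
qed

text \<open>The square minus \<open>y\<close> factors into \<open>A - sqrt y\<close> and
  \<open>A + sqrt y\<close>, and lower bounds of the factors multiply.\<close>

lemma not_bounded_below_square:
  fixes A :: "'h::real_inner \<Rightarrow> 'h"
  assumes A: "symop A" and nb: "\<not> bounded_below_at (\<lambda>v. A (A v)) y" and y: "y > 0"
  shows "\<not> bounded_below_at A (sqrt y) \<or> \<not> bounded_below_at A (- sqrt y)"
proof (rule ccontr)
  assume "\<not> ?thesis"
  then obtain c d where cd: "c > 0" "\<And>v. c * norm v \<le> norm (A v - sqrt y *\<^sub>R v)"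
     "d > 0" "\<And>v. d * norm v \<le> norm (A v - (- sqrt y) *\<^sub>R v)"
    by (auto simp: bounded_below_at_def)
  note Al = symopD(2)[OF A]
  have "c * d * norm v \<le> norm (A (A v) - y *\<^sub>R v)" for v
  proof -
    have eq: "A (A v) - y *\<^sub>R v = A (A v + sqrt y *\<^sub>R v) - sqrt y *\<^sub>R (A v + sqrt y *\<^sub>R v)"
      using y by (simp add: linear_add[OF Al] linear_scale[OF Al] algebra_simps)
    have "c * (d * norm v) \<le> c * norm (A v + sqrt y *\<^sub>R v)"
      using cd(4)[of v] cd(1) by (intro mult_left_mono) auto
    also have "\<dots> \<le> norm (A (A v) - y *\<^sub>R v)" unfolding eq by (rule cd)
    finally show ?thesis by (simp add: mult.assoc)
  qed
  moreover have "c * d > 0" using cd by simp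
  ultimately show False using nb unfolding bounded_below_at_def by blast
qed

text \<open>If the rest of the spectrum keeps away from \<open>0\<close>, then \<open>A\<^sup>2\<close> is bounded below on the range
  of \<open>A\<close>, and the powers of \<open>1 - \<tau> A\<^sup>2\<close> converge geometrically to the projection on the kernel.\<close>

lemma isolated_zero_imp_kernel:
  fixes A :: "'h::{real_inner,banach} \<Rightarrow> 'h"
  assumes A: "symop A" and n0: "\<not> bounded_below_at A 0"
    and \<delta>: "\<delta> > 0" and gap: "\<And>s. 0 < \<bar>s\<bar> \<Longrightarrow> \<bar>s\<bar> < \<delta> \<Longrightarrow> bounded_below_at A s"
  shows "\<exists>v. v \<noteq> 0 \<and> A v = 0"
proof -
  note Al = symopD(2)[OF A] and Asym = symopD(3)[OF A]
  define C where "C = (\<lambda>v. A (A v))"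
  have C: "symop C" unfolding C_def by (rule symop_compose[OF A A refl])
  note Cl = symopD(2)[OF C]
  define c where "c = \<delta>\<^sup>2"
  have c: "c > 0" using \<delta> by (simp add: c_def)
  \<comment> \<open>The spectrum of \<open>C\<close> misses the open interval from 0 to
    \<open>c\<close>, so the midpoint has distance at least \<open>c / 2\<close> from it.\<close>
  have lower: "c / 2 * norm v \<le> norm (C v - (c / 2) *\<^sub>R v)" for v
  proof (rule ccontr)
    assume "\<not> ?thesis"
    then have lt: "norm (C v - (c / 2) *\<^sub>R v) < c / 2 * norm v" by simp
    then have v: "v \<noteq> 0" using linear_0[OF Cl] by auto
    define t where "t = norm (C v - (c / 2) *\<^sub>R v) / norm v"
    have t: "t < c / 2" using lt v by (simp add: t_def pos_divide_less_eq)
    have "norm (C v - (c / 2) *\<^sub>R v) \<le> t * norm v" using v by (simp add: t_def)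
    from approx_eigenvalue_imp_spectrum[OF C v this]
    obtain y where y: "\<bar>y - c / 2\<bar> \<le> t" "\<not> bounded_below_at C y" by blast
    have y0: "0 < y" "y < c" using y(1) t by auto
    then have "\<not> bounded_below_at A (sqrt y) \<or> \<not> bounded_below_at A (- sqrt y)"
      using y(2) unfolding C_def by (intro not_bounded_below_square[OF A])
    moreover have "sqrt y < \<delta>" "sqrt y > 0" using y0 \<delta> by (auto simp: c_def real_less_lsqrt)
    ultimately show False using gap[of "sqrt y"] gap[of "- sqrt y"] by auto
  qed
  \<comment> \<open>On squaring \<open>lower\<close> the terms in \<open>norm v\<close> cancel; what
    remains says that \<open>A\<close> is bounded below by \<delta> on its own range.\<close>
  have AC: "c * (norm (A v))\<^sup>2 \<le> (norm (C v))\<^sup>2" for v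
  proof -
    have "(c / 2 * norm v)\<^sup>2 \<le> (norm (C v - (c / 2) *\<^sub>R v))\<^sup>2" using lower c by (intro power_mono) auto
    also have "\<dots> = (norm (C v))\<^sup>2 - c * (norm (A v))\<^sup>2 + (c / 2 * norm v)\<^sup>2"
      unfolding norm_diff_scaleR_square
      by (simp add: power_divide C_def power_mult_distrib inner_commute[of "A (A v)"] flip: power2_norm_eq_inner Asym)
    finally show ?thesis by simp
  qed
  obtain R where R: "R > 0" "\<And>v. norm (A v) \<le> R * norm v"
    using symop_pos_bound[OF A] by blast
  define \<tau> where "\<tau> = 1 / R\<^sup>2"
  have \<tau>: "\<tau> > 0" using R by (simp add: \<tau>_def)
  define q where "q = sqrt (max 0 (1 - \<delta>\<^sup>2 / R\<^sup>2))"
  have q: "0 \<le> q" "q < 1" using R \<delta> by (auto simp: q_def)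
  define T where "T = (\<lambda>v. v - \<tau> *\<^sub>R C v)"
  have TA: "T (A v) = A (T v)" for v
    by (simp add: T_def C_def linear_diff[OF Al] linear_scale[OF Al])
  have contr: "norm (T (A v)) \<le> q * norm (A v)" for v
  proof -
    have "(\<delta> * norm (A v))\<^sup>2 \<le> (norm (A (A v)))\<^sup>2" using AC[of v] by (simp add: c_def C_def power_mult_distrib)
    then have "\<delta> * norm (A v) \<le> norm (A (A v))" by (rule power2_le_imp_le) simp
    then show ?thesis
      using richardson_contraction[OF A R less_imp_le[OF \<delta>]] by (simp add: T_def C_def \<tau>_def q_def)
  qed
  have contrk: "norm ((T ^^ k) (A v)) \<le> q ^ k * norm (A v)" for k v
  proof (induction k)
    case (Suc k)
    have "(T ^^ k) (A v) = A ((T ^^ k) v)" by (induction k) (auto simp: TA)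
    then have "norm ((T ^^ Suc k) (A v)) \<le> q * norm ((T ^^ k) (A v))" by (simp add: contr)
    also have "\<dots> \<le> q * (q ^ k * norm (A v))" using Suc q by (intro mult_left_mono) auto
    finally show ?case by simp
  qed simp
  \<comment> \<open>With this bound on \<open>norm (A \<phi>)\<close>, the increments of
    \<open>(T ^^ k) \<phi>\<close> sum to at most 1/2 in norm, so the limit of the iteration is not
    zero.\<close>
  define e where "e = (1 - q) / (2 * \<tau> * R)"
  have e: "e > 0" using q \<tau> R by (simp add: e_def)
  obtain \<phi> where \<phi>: "norm \<phi> = 1" "norm (A \<phi>) \<le> e"
    using n0 e unfolding not_bounded_below_at_iff[OF Al] approx_kernel_def by auto
  have Ck: "C ((T ^^ k) \<phi>) = (T ^^ k) (A (A \<phi>))" for k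
  proof (induction k)
    case (Suc k)
    have "C (T ((T ^^ k) \<phi>)) = T (C ((T ^^ k) \<phi>))" unfolding C_def by (simp add: TA)
    then show ?case using Suc by simp
  qed (simp add: C_def)
  define f where "f = (\<lambda>k. (T ^^ Suc k) \<phi> - (T ^^ k) \<phi>)"
  have f: "norm (f k) \<le> \<tau> * norm (A (A \<phi>)) * q ^ k" for k
  proof -
    have "f k = - \<tau> *\<^sub>R C ((T ^^ k) \<phi>)" by (simp add: f_def T_def)
    then show ?thesis using contrk[of k "A \<phi>"] \<tau> by (simp add: Ck mult.commute mult.assoc mult_left_mono)
  qed
  have geo: "summable (\<lambda>k. \<tau> * norm (A (A \<phi>)) * q ^ k)" using q by (intro summable_mult summable_geometric) auto
  have nsum: "summable (\<lambda>k. norm (f k))" by (rule summable_comparison_test'[OF geo, of 0]) (use f in auto)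
  have "norm (\<Sum>k. f k) \<le> (\<Sum>k. norm (f k))" by (rule summable_norm[OF nsum])
  also have "\<dots> \<le> (\<Sum>k. \<tau> * norm (A (A \<phi>)) * q ^ k)" by (rule suminf_le[OF _ nsum geo]) (use f in auto)
  also have "\<dots> = \<tau> * norm (A (A \<phi>)) * (1 / (1 - q))"
    using q by (subst suminf_mult) (auto simp: suminf_geometric summable_geometric)
  also have "\<dots> \<le> \<tau> * (R * e) * (1 / (1 - q))"
    using q \<tau> R \<phi> order_trans[OF R(2)[of "A \<phi>"] mult_left_mono[OF \<phi>(2), of R]]
    by (intro mult_right_mono mult_left_mono) auto
  also have "\<dots> = 1 / 2" using q \<tau> R by (simp add: e_def field_simps)
  finally have half: "norm (\<Sum>k. f k) \<le> 1 / 2" .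
  have sf: "summable f" using nsum by (rule summable_norm_cancel)
  define \<psi> where "\<psi> = \<phi> + (\<Sum>k. f k)"
  have "(\<Sum>j<k. f j) = (T ^^ k) \<phi> - \<phi>" for k
    by (induction k) (auto simp: f_def)
  then have "(\<lambda>k. (T ^^ k) \<phi> - \<phi>) \<longlonglongrightarrow> (\<Sum>k. f k)"
    using summable_LIMSEQ[OF sf] by simp
  from tendsto_add[OF tendsto_const[of \<phi>] this] have lim: "(\<lambda>k. (T ^^ k) \<phi>) \<longlonglongrightarrow> \<psi>"
    by (simp add: \<psi>_def)
  have "\<psi> \<noteq> 0"
  proof
    assume "\<psi> = 0"
    then have "\<phi> = - (\<Sum>k. f k)" by (simp add: \<psi>_def eq_neg_iff_add_eq_0)
    then show False using half \<phi> by simp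
  qed
  moreover have "A \<psi> = 0"
  proof -
    have "(\<lambda>k. C ((T ^^ k) \<phi>)) \<longlonglongrightarrow> C \<psi>"
      by (rule bounded_linear.tendsto[OF symopD(1)[OF C] lim])
    moreover have "(\<lambda>k. C ((T ^^ k) \<phi>)) \<longlonglongrightarrow> 0"
    proof (rule Lim_null_comparison)
      show "\<forall>\<^sub>F k in sequentially. norm (C ((T ^^ k) \<phi>)) \<le> q ^ k * norm (A (A \<phi>))"
        using contrk[of _ "A \<phi>"] by (simp add: Ck)
      show "(\<lambda>k. q ^ k * norm (A (A \<phi>))) \<longlonglongrightarrow> 0"
        using q by (intro tendsto_mult_left_zero LIMSEQ_realpow_zero) auto
    qed
    ultimately have "C \<psi> = 0" by (rule LIMSEQ_unique)
    then have "A \<psi> \<bullet> A \<psi> = 0" unfolding Asym by (simp add: C_def)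
    then show ?thesis by simp
  qed
  ultimately show ?thesis by blast
qed

lemma bounded_below_at_shift:
  "bounded_below_at (\<lambda>v. A v - x *\<^sub>R v) s \<longleftrightarrow> bounded_below_at A (x + s)"
  by (simp add: bounded_below_at_def algebra_simps)

lemma isolated_imp_eigenvector:
  fixes A :: "'h::{real_inner,banach} \<Rightarrow> 'h"
  assumes A: "symop A" and n0: "\<not> bounded_below_at A x"
    and iso: "\<not> x islimpt {y. \<not> bounded_below_at A y}"
  shows "\<exists>v. v \<noteq> 0 \<and> A v = x *\<^sub>R v"
proof -
  from iso obtain \<delta> where \<delta>: "\<delta> > 0" "\<And>y. y \<noteq> x \<Longrightarrow> dist y x < \<delta> \<Longrightarrow> bounded_below_at A y"
    by (auto simp: islimpt_approachable)
  have "\<exists>v. v \<noteq> 0 \<and> A v - x *\<^sub>R v = 0"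
  proof (rule isolated_zero_imp_kernel[OF symop_shift[OF A] _ \<delta>(1)])
    show "\<not> bounded_below_at (\<lambda>v. A v - x *\<^sub>R v) 0" using n0 by (simp add: bounded_below_at_shift)
    show "bounded_below_at (\<lambda>v. A v - x *\<^sub>R v) s" if "0 < \<bar>s\<bar>" "\<bar>s\<bar> < \<delta>" for s
      using \<delta>(2)[of "x + s"] that by (simp add: bounded_below_at_shift dist_norm)
  qed
  then show ?thesis by auto
qed

text \<open>One half of spectral mapping: \<open>p - p(x)\<close> is divisible by the linear factor
  at \<open>x\<close>, and the norm of the quotient is the price for passing from
  \<open>p(A)\<close> to \<open>A\<close>.\<close>

lemma bounded_below_at_polyop:
  fixes A :: "'h::real_normed_vector \<Rightarrow> 'h"
  assumes A: "bounded_linear A" and g: "\<gamma> > 0"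
    and le: "\<And>v. \<gamma> * norm v \<le> norm (polyop p A v - poly p x *\<^sub>R v)"
  shows "bounded_below_at A x"
proof -
  note Al = bounded_linear.linear[OF A]
  have "[:- x, 1:] dvd p - [:poly p x:]" by (simp add: poly_eq_0_iff_dvd[symmetric])
  then obtain q where q: "p - [:poly p x:] = [:- x, 1:] * q" by (auto elim: dvdE)
  obtain K where K: "K > 0" "\<And>v. norm (polyop q A v) \<le> norm v * K"
    using bounded_linear.pos_bounded[OF bounded_linear_polyop[OF A]] by blast
  have "\<gamma> / K * norm v \<le> norm (A v - x *\<^sub>R v)" for v
  proof -
    have "polyop p A v - poly p x *\<^sub>R v = polyop (p - [:poly p x:]) A v"
      by (simp add: Al linear_0)
    also have "\<dots> = polyop (q * [:- x, 1:]) A v" unfolding q by (simp only: mult.commute)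
    also have "\<dots> = polyop q A (A v - x *\<^sub>R v)"
      using Al by (simp only: polyop_mult) (simp add: linear_0)
    finally have "\<gamma> * norm v \<le> norm (A v - x *\<^sub>R v) * K" using le[of v] K(2)[of "A v - x *\<^sub>R v"] by simp
    then show ?thesis using K by (simp add: field_simps)
  qed
  then show ?thesis unfolding bounded_below_at_def using g K by (intro exI[of _ "\<gamma> / K"]) auto
qed

section \<open>Spectra of commuting sums; measures with given moments\<close>

lemma approx_kernel_mono: "approx_kernel Gs \<Longrightarrow> Fs \<subseteq> Gs \<Longrightarrow> approx_kernel Fs"
  unfolding approx_kernel_def by (meson subsetD)

text \<open>Weyl vectors of the sum are refined one direction at a time: \<open>A k\<close> is
  bounded and commutes with the constraints collected so far, so an energy \<open>z\<close> for it
  can be added. A vector that nearly solves all equations forces the energies to add up to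
  \<open>E\<close>.\<close>

lemma spectrum_sum_subset:
  fixes A :: "'i \<Rightarrow> 'h::real_inner \<Rightarrow> 'h"
  assumes I: "finite I" and A: "\<And>i. i \<in> I \<Longrightarrow> symop (A i)"
    and comm: "\<And>i j v. i \<in> I \<Longrightarrow> j \<in> I \<Longrightarrow> A i (A j v) = A j (A i v)"
    and nb: "\<not> bounded_below_at (\<lambda>v. \<Sum>i\<in>I. A i v) E"
  shows "\<exists>y. E = (\<Sum>i\<in>I. y i) \<and> (\<forall>i\<in>I. \<not> bounded_below_at (A i) (y i))"
proof -
  define L where "L = (\<lambda>v. \<Sum>i\<in>I. A i v)"
  have L: "symop L" unfolding L_def by (rule symop_sum[OF I A])
  have commL: "A i (L v) = L (A i v)" if "i \<in> I" for i v
    unfolding L_def using comm that by (simp add: linear_sum[OF symopD(2)[OF A[OF that]]])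
  define G where "G = (\<lambda>y i v. A i v - y i *\<^sub>R v)"
  define F0 where "F0 = (\<lambda>v. L v - E *\<^sub>R v)"
  have "\<exists>y. approx_kernel (insert F0 (G y ` J))" if "J \<subseteq> I" for J
    using finite_subset[OF that I] that
  proof (induction J rule: finite_induct)
    case empty
    show ?case using nb not_bounded_below_at_iff[OF symopD(2)[OF L], of E] by (simp add: L_def F0_def)
  next
    case (insert k J)
    then obtain y where y: "approx_kernel (insert F0 (G y ` J))" by auto
    have k: "k \<in> I" and J: "J \<subseteq> I" using insert by auto
    obtain K where K: "K > 0" "\<And>v. norm (A k v) \<le> K * norm v" using symop_pos_bound[OF A[OF k]] by blast
    have "\<exists>z. \<bar>z - 0\<bar> \<le> K \<and> approx_kernel (insert (\<lambda>v. A k v - z *\<^sub>R v) (insert F0 (G y ` J)))"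
    proof (rule approx_kernel_insert_near[OF A[OF k]])
      fix F assume "F \<in> insert F0 (G y ` J)"
      then consider "F = F0" | i where "i \<in> I" "F = G y i" using J by auto
      note cases = this
      show "bounded_linear F"
        using cases by cases (auto simp: F0_def G_def intro!: symopD(1) symop_shift L A)
      show "F (A k v) = A k (F v)" for v
        using cases
        by cases (auto simp: F0_def G_def commL[OF k] comm[OF k] linear_diff[OF symopD(2)[OF A[OF k]]]
            linear_scale[OF symopD(2)[OF A[OF k]]])
    next
      fix \<epsilon> :: real assume "\<epsilon> > 0"
      then obtain v where v: "norm v = 1" "\<forall>F\<in>insert F0 (G y ` J). norm (F v) \<le> \<epsilon>"
        using y unfolding approx_kernel_def by blast
      then show "\<exists>v. norm v = 1 \<and> (\<forall>F\<in>insert F0 (G y ` J). norm (F v) \<le> \<epsilon>) \<and> norm (A k v - 0 *\<^sub>R v) \<le> K"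
        using K(2)[of v] by (intro exI[of _ v]) auto
    qed
    then obtain z where z: "approx_kernel (insert (\<lambda>v. A k v - z *\<^sub>R v) (insert F0 (G y ` J)))" by blast
    have "G (y(k := z)) ` J = G y ` J" using insert.hyps by (intro image_cong) (auto simp: G_def)
    moreover have "G (y(k := z)) k = (\<lambda>v. A k v - z *\<^sub>R v)" by (simp add: G_def)
    ultimately have "insert F0 (G (y(k := z)) ` insert k J) = insert (\<lambda>v. A k v - z *\<^sub>R v) (insert F0 (G y ` J))"
      by auto
    with z show ?case by metis
  qed
  then obtain y where y: "approx_kernel (insert F0 (G y ` I))" by blast
  have "\<not> bounded_below_at (A i) (y i)" if "i \<in> I" for i
    using that approx_kernel_mono[OF y, of "{G y i}"] not_bounded_below_at_iff[OF symopD(2)[OF A[OF that]], of "y i"]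
    by (auto simp: G_def)
  moreover have "E = (\<Sum>i\<in>I. y i)"
  proof (rule ccontr)
    assume ne: "E \<noteq> (\<Sum>i\<in>I. y i)"
    define e where "e = \<bar>E - (\<Sum>i\<in>I. y i)\<bar> / (2 * (1 + real (card I)))"
    have e: "e > 0" using ne by (simp add: e_def)
    obtain v where v: "norm v = 1" "norm (F0 v) \<le> e" "\<And>i. i \<in> I \<Longrightarrow> norm (G y i v) \<le> e"
      using y e unfolding approx_kernel_def by blast
    have "(E - (\<Sum>i\<in>I. y i)) *\<^sub>R v = (\<Sum>i\<in>I. G y i v) - F0 v"
      by (simp add: G_def F0_def L_def sum_subtractf scaleR_sum_left algebra_simps)
    then have "\<bar>E - (\<Sum>i\<in>I. y i)\<bar> = norm ((\<Sum>i\<in>I. G y i v) - F0 v)"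
      by (metis v(1) norm_scaleR mult.right_neutral)
    also have "\<dots> \<le> norm (\<Sum>i\<in>I. G y i v) + norm (F0 v)" by (rule norm_triangle_ineq4)
    also have "norm (\<Sum>i\<in>I. G y i v) \<le> (\<Sum>i\<in>I. e)" by (rule sum_norm_le) (use v in auto)
    also have "(\<Sum>i\<in>I. e) + norm (F0 v) \<le> real (card I) * e + e" using v by simp
    also have "\<dots> = \<bar>E - (\<Sum>i\<in>I. y i)\<bar> / 2"
    proof -
      have "e * (2 * (1 + real (card I))) = \<bar>E - (\<Sum>i\<in>I. y i)\<bar>" by (simp add: e_def)
      then show ?thesis by (simp add: algebra_simps)
    qed
    finally show False using ne by simp
  qed
  ultimately show ?thesis by blast
qed

section \<open>Closedness and compactness of the spectrum\<close>

lemma closed_spectrum: "closed {x. \<not> bounded_below_at A x}"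
proof -
  have "open {x. bounded_below_at A x}"
  proof (rule openI)
    fix x assume "x \<in> {x. bounded_below_at A x}"
    then obtain c where c: "c > 0" "\<And>v. c * norm v \<le> norm (A v - x *\<^sub>R v)"
      by (auto simp: bounded_below_at_def)
    have "bounded_below_at A y" if "y \<in> ball x (c / 2)" for y
    proof -
      have "(c - 0 - c / 2) * norm v \<le> norm (A v - y *\<^sub>R v)" for v
        by (rule bounded_below_at_perturb[OF c(2)]) (use that in \<open>auto simp: dist_real_def abs_minus_commute\<close>)
      then show ?thesis unfolding bounded_below_at_def using c(1) by (intro exI[of _ "c - 0 - c / 2"]) auto
    qed
    then show "\<exists>e>0. ball x e \<subseteq> {x. bounded_below_at A x}" using c by (intro exI[of _ "c / 2"]) auto
  qed
  then show ?thesis by (simp add: closed_def Compl_eq)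
qed

lemma bounded_below_at_large:
  assumes "\<And>v. norm (A v) \<le> R * norm v"
  shows "(\<bar>x\<bar> - R) * norm v \<le> norm (A v - x *\<^sub>R v)"
proof -
  have "norm (x *\<^sub>R v) - norm (A v) \<le> norm (A v - x *\<^sub>R v)"
    by (metis norm_minus_commute norm_triangle_ineq2)
  then show ?thesis using assms[of v] by (simp add: algebra_simps)
qed

lemma compact_spectrum:
  assumes "\<And>v. norm (A v) \<le> R * norm v"
  shows "compact {x. \<not> bounded_below_at A x}"
proof -
  have "bounded_below_at A x" if "\<bar>x\<bar> > R" for x
    unfolding bounded_below_at_def using bounded_below_at_large[OF assms] that
    by (intro exI[of _ "\<bar>x\<bar> - R"]) auto
  then have "{x. \<not> bounded_below_at A x} \<subseteq> cball 0 R" by force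
  then have "bounded {x. \<not> bounded_below_at A x}" using bounded_subset bounded_cball by blast
  then show ?thesis by (simp add: compact_eq_bounded_closed closed_spectrum)
qed

section \<open>Moments of a measure and of an operator\<close>

lemma polyop_altdef:
  assumes "linear A"
  shows "polyop p A v = (\<Sum>i\<le>degree p. coeff p i *\<^sub>R (A ^^ i) v)"
proof -
  have "polyop (\<Sum>i\<in>S. monom (coeff p i) i) A v = (\<Sum>i\<in>S. coeff p i *\<^sub>R (A ^^ i) v)" if "finite S" for S
    using that by (induction S rule: finite_induct) (auto simp: assms polyop_monom)
  from this[of "{..degree p}"] show ?thesis by (simp add: poly_as_sum_of_monoms)
qed

text \<open>Only the moments tie \<mu> to \<open>A\<close>; that its support is bounded, and where
  it lies, is deduced from their growth.\<close>

locale moment_measure =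
  fixes A :: "'h::{real_inner,banach} \<Rightarrow> 'h" and u :: 'h and \<mu> :: "real measure"
  assumes A: "symop A" and sets: "sets \<mu> = sets borel" and fin: "finite_measure \<mu>"
    and int: "integrable \<mu> (\<lambda>x. x ^ k)"
    and mom: "(\<integral>x. x ^ k \<partial>\<mu>) = u \<bullet> (A ^^ k) u"
begin

lemmas lin = symopD(2)[OF A]

lemma integrable_poly: "integrable \<mu> (poly p)"
  unfolding poly_altdef by (intro Bochner_Integration.integrable_sum integrable_mult_right int)

lemma integral_poly: "(\<integral>x. poly p x \<partial>\<mu>) = u \<bullet> polyop p A u"
proof -
  have "(\<integral>x. poly p x \<partial>\<mu>) = (\<Sum>i\<le>degree p. \<integral>x. coeff p i * x ^ i \<partial>\<mu>)"
    unfolding poly_altdef by (intro Bochner_Integration.integral_sum integrable_mult_right int)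
  also have "\<dots> = (\<Sum>i\<le>degree p. coeff p i * (u \<bullet> (A ^^ i) u))"
    using int mom by (intro sum.cong) auto
  finally show ?thesis by (simp add: polyop_altdef[OF lin] inner_sum_right)
qed

lemma norm_polyop: "(norm (polyop p A u))\<^sup>2 = (\<integral>x. (poly p x)\<^sup>2 \<partial>\<mu>)"
proof -
  have "(norm (polyop p A u))\<^sup>2 = u \<bullet> polyop (p * p) A u"
    using symopD(3)[OF symop_polyop[OF A, of p]] by (simp add: power2_norm_eq_inner lin)
  then show ?thesis by (simp add: power2_eq_square flip: integral_poly)
qed

lemma space_mu [simp]: "space \<mu> = UNIV"
  using sets_eq_imp_space_eq[OF sets] by simp

lemma integrable_const_mu: "integrable \<mu> (\<lambda>x. c :: real)"
  using fin by (rule finite_measure.integrable_const)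

lemma integrable_indicator_mu: "S \<in> sets \<mu> \<Longrightarrow> integrable \<mu> (indicator S :: real \<Rightarrow> real)"
  using finite_measure.emeasure_finite[OF fin, of S]
  by (intro integrable_real_indicator) (auto simp: less_top[symmetric])

lemma integral_indicator_mu: "S \<in> sets \<mu> \<Longrightarrow> (\<integral>x. indicator S x \<partial>\<mu>) = measure \<mu> S"
  by (simp add: sets_eq_imp_space_eq[OF sets])

lemma null_sets_mu: "S \<in> sets \<mu> \<Longrightarrow> measure \<mu> S \<le> 0 \<Longrightarrow> S \<in> null_sets \<mu>"
  using fin by (simp add: null_sets_def finite_measure.emeasure_eq_measure measure_le_0_iff)

text \<open>A set on which \<open>\<bar>poly p x\<bar> \<ge> r > R\<close> contributes at least its
  mass times \<open>r ^ (2 * k)\<close> to the integral of \<open>p ^ (2 * k)\<close>. That integral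
  is the square of \<open>norm (polyop (p ^ k) A u)\<close> and grows at most like
  \<open>R ^ (2 * k)\<close>, so the mass is zero.\<close>

lemma AE_polyop_bounded:
  assumes R: "R > 0" "\<And>v. norm (polyop p A v) \<le> R * norm v"
  shows "AE x in \<mu>. \<bar>poly p x\<bar> \<le> R"
proof -
  have bound: "norm (polyop (p ^ k) A u) \<le> R ^ k * norm u" for k
  proof (induction k)
    case (Suc k)
    have "norm (polyop (p ^ Suc k) A u) \<le> R * norm (polyop (p ^ k) A u)" using R by (simp add: lin)
    also have "\<dots> \<le> R * (R ^ k * norm u)" using Suc R by (intro mult_left_mono) auto
    finally show ?case by simp
  qed (simp add: lin)
  have "AE x in \<mu>. \<bar>poly p x\<bar> < R + 1 / real (Suc n)" for n
  proof -
    define r where "r = R + 1 / real (Suc n)"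
    have r: "r > R" by (simp add: r_def)
    define S where "S = {x. r \<le> \<bar>poly p x\<bar>}"
    have "closed S" unfolding S_def by (intro closed_Collect_le continuous_intros)
    then have S: "S \<in> sets \<mu>" by (simp add: sets)
    have "measure \<mu> S \<le> (norm u)\<^sup>2 * ((R / r)\<^sup>2) ^ k" for k
    proof -
      have "measure \<mu> S * (r ^ k)\<^sup>2 = (\<integral>x. (r ^ k)\<^sup>2 * indicator S x \<partial>\<mu>)" using S by (simp add: mult.commute)
      also have "\<dots> \<le> (\<integral>x. (poly (p ^ k) x)\<^sup>2 \<partial>\<mu>)"
      proof (rule integral_mono)
        show "integrable \<mu> (\<lambda>x. (r ^ k)\<^sup>2 * indicator S x)"
          by (intro integrable_mult_right integrable_indicator_mu S)
        have "(\<lambda>x. (poly (p ^ k) x)\<^sup>2) = poly (p ^ k * p ^ k)" by (auto simp: power2_eq_square)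
        then show "integrable \<mu> (\<lambda>x. (poly (p ^ k) x)\<^sup>2)" using integrable_poly by metis
        show "(r ^ k)\<^sup>2 * indicator S x \<le> (poly (p ^ k) x)\<^sup>2" for x
        proof (cases "x \<in> S")
          case True
          then have "r ^ k \<le> \<bar>poly p x\<bar> ^ k" using r R by (intro power_mono) (auto simp: S_def)
          then have "(r ^ k)\<^sup>2 \<le> (\<bar>poly p x\<bar> ^ k)\<^sup>2" by (rule power_mono) (use r R in simp)
          then show ?thesis using True by (simp add: poly_power flip: power_abs)
        qed auto
      qed
      also have "\<dots> = (norm (polyop (p ^ k) A u))\<^sup>2" by (rule norm_polyop[symmetric])
      also have "\<dots> \<le> (R ^ k * norm u)\<^sup>2" using bound by (intro power_mono) auto
      finally show ?thesis using r R by (simp add: field_simps power_mult_distrib power_divide flip: power_mult)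
    qed
    moreover have "(\<lambda>k. (norm u)\<^sup>2 * ((R / r)\<^sup>2) ^ k) \<longlonglongrightarrow> 0"
      using r R by (intro tendsto_mult_right_zero LIMSEQ_realpow_zero) (auto simp: power_less_one_iff abs_square_less_1)
    ultimately have "measure \<mu> S \<le> 0" by (intro LIMSEQ_le_const) auto
    then have "S \<in> null_sets \<mu>" using S by (intro null_sets_mu)
    then show ?thesis by (rule AE_I') (auto simp: S_def r_def)
  qed
  then have "AE x in \<mu>. \<forall>n. \<bar>poly p x\<bar> < R + 1 / real (Suc n)" by (simp add: AE_all_countable)
  then show ?thesis
  proof (rule AE_mp, intro AE_I2 impI)
    fix x assume a: "\<forall>n. \<bar>poly p x\<bar> < R + 1 / real (Suc n)"
    show "\<bar>poly p x\<bar> \<le> R"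
    proof (rule field_le_epsilon)
      fix e :: real assume "e > 0"
      then obtain n where "1 / real (Suc n) < e" using nat_approx_posE by (metis of_nat_Suc)
      then show "\<bar>poly p x\<bar> \<le> R + e" using a[rule_format, of n] by linarith
    qed
  qed
qed

lemma AE_bounded:
  assumes "R > 0" "\<And>v. norm (A v) \<le> R * norm v"
  shows "AE x in \<mu>. \<bar>x\<bar> \<le> R"
  using AE_polyop_bounded[of R "[:0, 1:]"] assms by (simp add: lin linear_0[OF lin])

text \<open>As an operator this is the Richardson step for \<open>A - E\<close>. As a function it
  lies between 0 and 1 within distance \<open>K\<close> of \<open>E\<close> and reaches 1 only at
  \<open>E\<close>, so there its powers tend to the indicator of \<open>{E}\<close>.\<close>

definition peak :: "real \<Rightarrow> real \<Rightarrow> real poly" where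
  "peak E K = 1 - smult (1 / K\<^sup>2) ([:- E, 1:] * [:- E, 1:])"

lemma poly_peak: "poly (peak E K) x = 1 - ((x - E) / K)\<^sup>2"
  by (simp add: peak_def power2_eq_square algebra_simps add_divide_distrib diff_divide_distrib)

lemma AE_dist_bounded:
  obtains K where "K > 0" "AE x in \<mu>. \<bar>x - E\<bar> \<le> K"
proof -
  obtain R where R: "R > 0" "\<And>v. norm (A v) \<le> R * norm v" using symop_pos_bound[OF A] by blast
  have "AE x in \<mu>. \<bar>x - E\<bar> \<le> R + \<bar>E\<bar>"
    using AE_bounded[OF R] by (rule AE_mp) (auto intro!: AE_I2)
  with that[of "R + \<bar>E\<bar>"] R show ?thesis by auto
qed

text \<open>The Richardson contraction bounds \<open>peak\<close> of the operator by some
  \<open>q < 1\<close>; the same bound for the function, almost everywhere, keeps \<open>x\<close>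
  away from \<open>E\<close>.\<close>

lemma AE_gap:
  assumes "bounded_below_at A E"
  shows "\<exists>c>0. AE x in \<mu>. c \<le> \<bar>x - E\<bar>"
proof -
  define D where "D = (\<lambda>v. A v - E *\<^sub>R v)"
  have D: "symop D" unfolding D_def by (rule symop_shift[OF A])
  obtain c where c: "c > 0" "\<And>v. c * norm v \<le> norm (D v)"
    using assms by (auto simp: bounded_below_at_def D_def)
  obtain R where R: "R > 0" "\<And>v. norm (D v) \<le> R * norm v" using symop_pos_bound[OF D] by blast
  \<comment> \<open>The maximum with 1/2 makes \<open>q\<close> positive, as
    \<open>AE_polyop_bounded\<close> asks of its bound.\<close>
  define q where "q = max (1 / 2) (sqrt (max 0 (1 - c\<^sup>2 / R\<^sup>2)))"
  have q: "0 < q" "q < 1" using R c by (auto simp: q_def)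
  have "polyop [:- E, 1:] A v = D v" for v by (simp add: D_def lin linear_0)
  then have "polyop (peak E R) A v = v - (1 / R\<^sup>2) *\<^sub>R D (D v)" for v
    unfolding peak_def by (simp add: lin del: polyop_pCons mult_pCons_left mult_pCons_right)
  moreover have "norm (v - (1 / R\<^sup>2) *\<^sub>R D (D v)) \<le> q * norm v" for v
    using richardson_contraction[OF D R less_imp_le[OF c(1)] c(2), of v]
    by (rule order_trans) (simp add: q_def mult_right_mono)
  ultimately have "AE x in \<mu>. \<bar>poly (peak E R) x\<bar> \<le> q" using q by (intro AE_polyop_bounded) auto
  then have "AE x in \<mu>. R * sqrt (1 - q) \<le> \<bar>x - E\<bar>"
  proof (rule AE_mp, intro AE_I2 impI)
    fix x assume "\<bar>poly (peak E R) x\<bar> \<le> q"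
    then have "1 - q \<le> ((x - E) / R)\<^sup>2" by (simp add: poly_peak abs_le_iff)
    then have "sqrt (1 - q) \<le> sqrt (((x - E) / R)\<^sup>2)" by (rule real_sqrt_le_mono)
    then have "sqrt (1 - q) \<le> \<bar>x - E\<bar> / R" using R by (simp add: abs_divide)
    then show "R * sqrt (1 - q) \<le> \<bar>x - E\<bar>" using R by (simp add: pos_le_divide_eq mult.commute)
  qed
  then show ?thesis using R q by (intro exI[of _ "R * sqrt (1 - q)"]) auto
qed

text \<open>Every point outside \<open>S\<close> has a ball of measure zero around it, and by
  Lindelof countably many such balls cover the complement.\<close>

lemma AE_in_closed_superset:
  assumes "closed S" "\<And>x. x \<notin> S \<Longrightarrow> bounded_below_at A x"
  shows "AE x in \<mu>. x \<in> S"
proof -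
  have "\<exists>c>0. AE y in \<mu>. c \<le> \<bar>y - x\<bar>" if "x \<notin> S" for x
    by (rule AE_gap[OF assms(2)[OF that]])
  then obtain c where c: "\<And>x. x \<notin> S \<Longrightarrow> c x > 0" "\<And>x. x \<notin> S \<Longrightarrow> AE y in \<mu>. c x \<le> \<bar>y - x\<bar>"
    by metis
  define \<F> where "\<F> = (\<lambda>x. ball x (c x)) ` (- S)"
  obtain \<G> where G: "\<G> \<subseteq> \<F>" "countable \<G>" "\<Union>\<G> = \<Union>\<F>"
    using Lindelof[of \<F>] by (auto simp: \<F>_def)
  have "AE y in \<mu>. y \<notin> B" if B: "B \<in> \<G>" for B
  proof -
    obtain x where x: "x \<notin> S" "B = ball x (c x)" using B G(1) by (auto simp: \<F>_def)
    show ?thesis using c(2)[OF x(1)] by (rule AE_mp) (auto intro!: AE_I2 simp: x dist_real_def abs_minus_commute)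
  qed
  then have "AE y in \<mu>. \<forall>B\<in>\<G>. y \<notin> B" using G by (simp add: AE_ball_countable)
  then show ?thesis
  proof (rule AE_mp, intro AE_I2 impI)
    fix y assume "\<forall>B\<in>\<G>. y \<notin> B"
    then have "y \<notin> \<Union>\<F>" using G by auto
    then show "y \<in> S" using c by (force simp: \<F>_def)
  qed
qed

text \<open>The vectors \<open>p\<^sup>k(A) u\<close>, with \<open>p\<close> a polynomial peaked at \<open>E\<close>, converge to the component of
  \<open>u\<close> in the eigenspace of \<open>E\<close>; its squared norm is the mass of the atom.\<close>

lemma atom_imp_eigenvector:
  assumes "emeasure \<mu> {E} \<noteq> 0"
  shows "\<exists>v. v \<noteq> 0 \<and> A v = E *\<^sub>R v"
proof -
  obtain K where K: "K > 0" "AE x in \<mu>. \<bar>x - E\<bar> \<le> K" using AE_dist_bounded by blast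
  define p where "p = peak E K"
  have bnd: "AE x in \<mu>. 0 \<le> poly p x \<and> poly p x \<le> 1"
    using K(2)
  proof (rule AE_mp, intro AE_I2 impI)
    fix x assume x: "\<bar>x - E\<bar> \<le> K"
    have "\<bar>(x - E) / K\<bar> \<le> 1" using x K by (simp add: abs_divide)
    then show "0 \<le> poly p x \<and> poly p x \<le> 1" by (simp add: p_def poly_peak abs_square_le_1)
  qed
  define m where "m = (\<lambda>k. \<integral>x. poly (p ^ k) x \<partial>\<mu>)"
  have dec: "decseq m"
    unfolding m_def decseq_Suc_iff
  proof (intro allI integral_mono_AE integrable_poly)
    show "AE x in \<mu>. poly (p ^ Suc k) x \<le> poly (p ^ k) x" for k
      using bnd by (rule AE_mp) (auto intro!: AE_I2 mult_left_le_one_le)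
  qed
  have lower: "measure \<mu> {E} \<le> m k" for k
  proof -
    have S: "{E} \<in> sets \<mu>" by (simp add: sets)
    have "measure \<mu> {E} = (\<integral>x. indicator {E} x \<partial>\<mu>)" using S by (simp only: integral_indicator_mu)
    also have "\<dots> \<le> m k" unfolding m_def
    proof (intro integral_mono_AE integrable_poly)
      show "integrable \<mu> (indicator {E} :: real \<Rightarrow> real)"
        by (rule integrable_indicator_mu[OF S])
      show "AE x in \<mu>. indicator {E} x \<le> poly (p ^ k) x"
        using bnd by (rule AE_mp) (auto intro!: AE_I2 simp: indicator_def p_def poly_peak poly_power)
    qed
    finally show ?thesis .
  qed
  obtain l where l: "m \<longlonglongrightarrow> l"
    using decseq_convergent[OF dec, of "measure \<mu> {E}"] lower by blast
  define v where "v = (\<lambda>k. polyop (p ^ k) A u)"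
  \<comment> \<open>The Gram matrix depends on \<open>k + j\<close> alone, so convergence of the
    decreasing sequence \<open>m\<close> makes \<open>v\<close> Cauchy.\<close>
  have vv: "v k \<bullet> v j = m (k + j)" for k j
    unfolding v_def m_def integral_poly power_add polyop_mult[OF lin]
    by (simp add: symopD(3)[OF symop_polyop[OF A]])
  have "Cauchy v"
  proof (rule metric_CauchyI)
    fix e :: real assume e: "e > 0"
    then have "e\<^sup>2 / 4 > 0" by simp
    then obtain M where M: "\<And>n. n \<ge> M \<Longrightarrow> \<bar>m n - l\<bar> < e\<^sup>2 / 4"
      using LIMSEQ_D[OF l, of "e\<^sup>2 / 4"] by auto
    have "dist (v i) (v j) < e" if "i \<ge> M" "j \<ge> M" for i j
    proof -
      have "(dist (v i) (v j))\<^sup>2 = m (i + i) - 2 * m (i + j) + m (j + j)"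
        unfolding dist_norm power2_norm_eq_inner
        by (simp add: inner_diff_left inner_diff_right inner_commute vv add.commute)
      also have "\<dots> < e\<^sup>2"
        using M[of "i + i"] M[of "i + j"] M[of "j + j"] that by linarith
      finally show ?thesis using e by (auto intro: power2_less_imp_less)
    qed
    then show "\<exists>M. \<forall>i\<ge>M. \<forall>j\<ge>M. dist (v i) (v j) < e" by blast
  qed
  then obtain w where w: "v \<longlonglongrightarrow> w" using convergent_eq_Cauchy convergent_def by blast
  have "(\<lambda>k. m (k + k)) \<longlonglongrightarrow> w \<bullet> w" using tendsto_inner[OF w w] by (simp add: vv)
  then have "measure \<mu> {E} \<le> w \<bullet> w" using lower by (intro LIMSEQ_le_const) auto
  moreover have "measure \<mu> {E} > 0"
    using assms fin by (simp add: finite_measure.emeasure_eq_measure zero_less_measure_iff)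
  ultimately have "w \<noteq> 0" by auto
  have "A w - E *\<^sub>R w = 0"
  proof -
    have "(\<lambda>k. A (v k) - E *\<^sub>R v k) \<longlonglongrightarrow> A w - E *\<^sub>R w"
      by (rule tendsto_diff[OF bounded_linear.tendsto[OF symopD(1)[OF A] w] tendsto_scaleR[OF tendsto_const w]])
    then have "(\<lambda>k. (norm (A (v k) - E *\<^sub>R v k))\<^sup>2) \<longlonglongrightarrow> (norm (A w - E *\<^sub>R w))\<^sup>2"
      by (intro tendsto_power tendsto_norm)
    \<comment> \<open>Because \<open>(x - E)\<^sup>2 = K\<^sup>2 * (1 - poly p x)\<close>, the
      squared residual is a difference of consecutive terms of the convergent sequence
      \<open>m\<close>.\<close>
    moreover have "(norm (A (v k) - E *\<^sub>R v k))\<^sup>2 = K\<^sup>2 * (m (k + k) - m (Suc (k + k)))" for k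
    proof -
      have "A (v k) - E *\<^sub>R v k = polyop ([:- E, 1:] * p ^ k) A u"
        unfolding v_def polyop_mult[OF lin] by (simp add: lin linear_0)
      then have "(norm (A (v k) - E *\<^sub>R v k))\<^sup>2 = (\<integral>x. (poly ([:- E, 1:] * p ^ k) x)\<^sup>2 \<partial>\<mu>)"
        by (simp only: norm_polyop)
      also have "\<dots> = (\<integral>x. K\<^sup>2 * (poly (p ^ (k + k)) x - poly (p ^ Suc (k + k)) x) \<partial>\<mu>)"
      proof (rule arg_cong[of _ _ "integral\<^sup>L \<mu>"], rule ext)
        fix x
        have "K\<^sup>2 * (1 - poly p x) = (x - E)\<^sup>2" using K by (simp add: p_def poly_peak power_divide)
        moreover have "(poly ([:- E, 1:] * p ^ k) x)\<^sup>2 = (x - E)\<^sup>2 * poly p x ^ (k + k)"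
          by (simp add: power_mult_distrib power_add power2_eq_square poly_power algebra_simps)
        moreover have "K\<^sup>2 * (poly (p ^ (k + k)) x - poly (p ^ Suc (k + k)) x) = K\<^sup>2 * (1 - poly p x) * poly p x ^ (k + k)"
          by (simp add: poly_power algebra_simps)
        ultimately show "(poly ([:- E, 1:] * p ^ k) x)\<^sup>2 = K\<^sup>2 * (poly (p ^ (k + k)) x - poly (p ^ Suc (k + k)) x)"
          by (simp only:)
      qed
      also have "\<dots> = K\<^sup>2 * (m (k + k) - m (Suc (k + k)))"
        unfolding m_def
        by (simp only: integral_mult_right_zero Bochner_Integration.integral_diff[OF integrable_poly integrable_poly])
      finally show ?thesis .
    qed
    moreover have "(\<lambda>k. K\<^sup>2 * (m (k + k) - m (Suc (k + k)))) \<longlonglongrightarrow> K\<^sup>2 * (l - l)"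
    proof (intro tendsto_intros)
      show "(\<lambda>k. m (k + k)) \<longlonglongrightarrow> l"
        using LIMSEQ_subseq_LIMSEQ[OF l, of "\<lambda>k. k + k"] by (simp add: strict_mono_def o_def)
      show "(\<lambda>k. m (Suc (k + k))) \<longlonglongrightarrow> l"
        using LIMSEQ_subseq_LIMSEQ[OF l, of "\<lambda>k. Suc (k + k)"] by (simp add: strict_mono_def o_def)
    qed
    ultimately have "(norm (A w - E *\<^sub>R w))\<^sup>2 = 0" using LIMSEQ_unique by fastforce
    then show ?thesis by simp
  qed
  then show ?thesis using \<open>w \<noteq> 0\<close> by auto
qed

end

section \<open>Square-summable functions as a Hilbert space\<close>

text \<open>Complex functions made into a real Hilbert space. The operators have real coefficients,
  so the real inner product, which is the real part of \<open>ell2_inner\<close>, is enough.\<close>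

typedef 'a l2 = "{u :: 'a \<Rightarrow> complex. (\<lambda>n. (norm (u n))\<^sup>2) summable_on UNIV}"
  morphisms entry Abs_l2
  by (rule exI[of _ "\<lambda>_. 0"]) simp

lemma summable_entry: "(\<lambda>n. (norm (entry u n))\<^sup>2) summable_on UNIV"
  using entry[of u] by simp

lemma l2_eqI: "(\<And>n. entry u n = entry v n) \<Longrightarrow> u = v"
  by (metis entry_inject ext)

lemma summable_on_square_add:
  fixes f g :: "'a \<Rightarrow> complex"
  assumes "(\<lambda>n. (norm (f n))\<^sup>2) summable_on A" "(\<lambda>n. (norm (g n))\<^sup>2) summable_on A"
  shows "(\<lambda>n. (norm (f n + g n))\<^sup>2) summable_on A"
proof (rule summable_on_comparison_test)
  show "(\<lambda>n. 2 * (norm (f n))\<^sup>2 + 2 * (norm (g n))\<^sup>2) summable_on A"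
    using assms by (intro summable_on_add summable_on_cmult_right)
  show "(norm (f n + g n))\<^sup>2 \<le> 2 * (norm (f n))\<^sup>2 + 2 * (norm (g n))\<^sup>2" for n
  proof -
    have "(norm (f n + g n))\<^sup>2 \<le> (norm (f n) + norm (g n))\<^sup>2"
      by (intro power_mono norm_triangle_ineq) auto
    also have "\<dots> \<le> 2 * (norm (f n))\<^sup>2 + 2 * (norm (g n))\<^sup>2"
      using sum_squares_bound[of "norm (f n)" "norm (g n)"] by (simp add: power2_sum)
    finally show ?thesis .
  qed
qed auto

lemma summable_on_square_scaleR:
  "(\<lambda>n. (norm (f n))\<^sup>2) summable_on A \<Longrightarrow> (\<lambda>n. (norm (c *\<^sub>R f n :: complex))\<^sup>2) summable_on A"
  by (simp add: power_mult_distrib summable_on_cmult_right)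

lemma summable_on_inner:
  fixes f g :: "'a \<Rightarrow> complex"
  assumes "(\<lambda>n. (norm (f n))\<^sup>2) summable_on A" "(\<lambda>n. (norm (g n))\<^sup>2) summable_on A"
  shows "(\<lambda>n. f n \<bullet> g n) summable_on A"
proof -
  have "(\<lambda>n. norm (f n \<bullet> g n)) summable_on A"
  proof (rule summable_on_comparison_test)
    show "(\<lambda>n. (norm (f n))\<^sup>2 + (norm (g n))\<^sup>2) summable_on A"
      using assms by (intro summable_on_add)
    show "norm (f n \<bullet> g n) \<le> (norm (f n))\<^sup>2 + (norm (g n))\<^sup>2" for n
    proof -
      have "norm (f n \<bullet> g n) \<le> norm (f n) * norm (g n)" by (simp add: Cauchy_Schwarz_ineq2)
      also have "\<dots> \<le> (norm (f n))\<^sup>2 + (norm (g n))\<^sup>2"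
        using sum_squares_bound[of "norm (f n)" "norm (g n)"]
        mult_nonneg_nonneg[OF norm_ge_zero norm_ge_zero, of "f n" "g n"] by linarith
      finally show ?thesis .
    qed
  qed auto
  then show ?thesis by (rule abs_summable_summable)
qed

instantiation l2 :: (type) real_vector
begin
definition "0 = Abs_l2 (\<lambda>_. 0)"
definition "u + v = Abs_l2 (\<lambda>n. entry u n + entry v n)"
definition "- u = Abs_l2 (\<lambda>n. - entry u n)"
definition "u - v = Abs_l2 (\<lambda>n. entry u n - entry v n)"
definition "c *\<^sub>R u = Abs_l2 (\<lambda>n. c *\<^sub>R entry u n)"

lemma entry_zero [simp]: "entry 0 n = 0"
  by (simp add: zero_l2_def Abs_l2_inverse)

lemma entry_add [simp]: "entry (u + v) n = entry u n + entry v n"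
  using summable_on_square_add[OF summable_entry summable_entry, of u v]
  by (simp add: plus_l2_def Abs_l2_inverse)

lemma entry_minus [simp]: "entry (- u) n = - entry u n"
  using summable_entry[of u] by (simp add: uminus_l2_def Abs_l2_inverse)

lemma entry_diff [simp]: "entry (u - v) n = entry u n - entry v n"
  using summable_on_square_add[OF summable_entry summable_entry, of u "- v"]
  by (simp add: minus_l2_def Abs_l2_inverse)

lemma entry_scaleR [simp]: "entry (c *\<^sub>R u) n = c *\<^sub>R entry u n"
  using summable_on_square_scaleR[OF summable_entry, of c u]
  by (simp add: scaleR_l2_def Abs_l2_inverse)

instance
  by standard (auto intro!: l2_eqI simp: algebra_simps)

end

lemma entry_sum [simp]: "entry (\<Sum>i\<in>I. u i) n = (\<Sum>i\<in>I. entry (u i) n)"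
  by (induction I rule: infinite_finite_induct) auto

instantiation l2 :: (type) real_inner
begin
definition "u \<bullet> v = (\<Sum>\<^sub>\<infinity>n. entry u n \<bullet> entry v n)"
definition "norm (u :: 'a l2) = sqrt (u \<bullet> u)"
definition "sgn (u :: 'a l2) = u /\<^sub>R norm u"
definition "dist (u :: 'a l2) v = norm (u - v)"
definition [code del]:
  "(uniformity :: ('a l2 \<times> 'a l2) filter) = (INF e\<in>{0 <..}. principal {(x, y). dist x y < e})"
definition [code del]:
  "open (S :: 'a l2 set) = (\<forall>x\<in>S. \<forall>\<^sub>F (x', y) in uniformity. x' = x \<longrightarrow> y \<in> S)"

lemma summable_inner_l2: "(\<lambda>n. entry u n \<bullet> entry v n) summable_on UNIV"
  by (rule summable_on_inner[OF summable_entry summable_entry])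

instance
proof
  fix x y z :: "'a l2" and r :: real
  show "dist x y = norm (x - y)" by (rule dist_l2_def)
  show "sgn x = x /\<^sub>R norm x" by (rule sgn_l2_def)
  show "uniformity = (INF e\<in>{0 <..}. principal {(x :: 'a l2, y). dist x y < e})"
    by (rule uniformity_l2_def)
  show "open S = (\<forall>x\<in>S. \<forall>\<^sub>F (x', y) in uniformity. x' = x \<longrightarrow> y \<in> S)" for S :: "'a l2 set"
    by (rule open_l2_def)
  show "x \<bullet> y = y \<bullet> x" by (simp add: inner_l2_def inner_commute)
  show "(x + y) \<bullet> z = x \<bullet> z + y \<bullet> z"
    by (simp add: inner_l2_def inner_add_left infsum_add summable_inner_l2)
  show "(r *\<^sub>R x) \<bullet> y = r * (x \<bullet> y)"
    by (simp add: inner_l2_def infsum_cmult_right')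
  show "0 \<le> x \<bullet> x" by (simp add: inner_l2_def infsum_nonneg)
  show "(x \<bullet> x = 0) = (x = 0)"
  proof
    assume a: "x \<bullet> x = 0"
    show "x = 0"
    proof (rule l2_eqI)
      fix n
      have "sum (\<lambda>n. entry x n \<bullet> entry x n) {n} \<le> x \<bullet> x"
        unfolding inner_l2_def by (rule finite_sum_le_infsum[OF summable_inner_l2]) auto
      then have "entry x n \<bullet> entry x n \<le> 0" using a by simp
      then have "entry x n \<bullet> entry x n = 0" using inner_ge_zero[of "entry x n"] by linarith
      then show "entry x n = entry 0 n" by simp
    qed
  qed (simp add: inner_l2_def)
  show "norm x = sqrt (x \<bullet> x)" by (rule norm_l2_def)
qed

end

lemma norm_l2_square: "(norm u)\<^sup>2 = (\<Sum>\<^sub>\<infinity>n. (norm (entry u n))\<^sup>2)" for u :: "'a l2"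
  by (simp add: power2_norm_eq_inner inner_l2_def)

lemma sum_entry_le_norm:
  "finite F \<Longrightarrow> (\<Sum>n\<in>F. (norm (entry u n))\<^sup>2) \<le> (norm u)\<^sup>2" for u :: "'a l2"
  unfolding norm_l2_square by (rule finite_sum_le_infsum[OF summable_entry]) auto

lemma norm_entry_le: "norm (entry u n) \<le> norm u" for u :: "'a l2"
proof -
  have "(norm (entry u n))\<^sup>2 \<le> (norm u)\<^sup>2" using sum_entry_le_norm[of "{n}" u] by simp
  then show ?thesis by (rule power2_le_imp_le) simp
qed

lemma norm_l2_le:
  fixes u :: "'a l2"
  assumes "\<And>F. finite F \<Longrightarrow> (\<Sum>n\<in>F. (norm (entry u n))\<^sup>2) \<le> b\<^sup>2" "b \<ge> 0"
  shows "norm u \<le> b"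
proof -
  have "(norm u)\<^sup>2 \<le> b\<^sup>2"
    unfolding norm_l2_square by (rule infsum_le_finite_sums[OF summable_entry]) (use assms in auto)
  then show ?thesis using assms(2) by (rule power2_le_imp_le)
qed

lemma summable_on_square_dominated:
  fixes u :: "'a l2" and f :: "'b \<Rightarrow> complex"
  assumes "inj s" "\<And>n. norm (f n) \<le> C * norm (entry u (s n))"
  shows "(\<lambda>n. (norm (f n))\<^sup>2) summable_on UNIV"
proof (rule summable_on_comparison_test)
  have "(\<lambda>n. (norm (entry u n))\<^sup>2) summable_on range s"
    using summable_entry by (rule summable_on_subset_banach) auto
  then have "((\<lambda>n. (norm (entry u n))\<^sup>2) \<circ> s) summable_on UNIV"
    using summable_on_reindex[OF assms(1)] by blast
  then show "(\<lambda>n. C\<^sup>2 * (norm (entry u (s n)))\<^sup>2) summable_on UNIV"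
    by (intro summable_on_cmult_right) (simp add: o_def)
  show "(norm (f n))\<^sup>2 \<le> C\<^sup>2 * (norm (entry u (s n)))\<^sup>2" for n
    using power_mono[OF assms(2)[of n], of 2] by (simp add: power_mult_distrib)
qed auto

lemma norm_le_entrywise:
  fixes u :: "'a l2" and v :: "'b l2"
  assumes s: "inj s" and le: "\<And>n. norm (entry v n) \<le> C * norm (entry u (s n))" and C: "C \<ge> 0"
  shows "norm v \<le> C * norm u"
proof (rule norm_l2_le)
  fix F :: "'b set" assume F: "finite F"
  have "(\<Sum>n\<in>F. (norm (entry v n))\<^sup>2) \<le> (\<Sum>n\<in>F. (C * norm (entry u (s n)))\<^sup>2)"
    by (intro sum_mono power_mono le) auto
  also have "\<dots> = C\<^sup>2 * (\<Sum>n\<in>s ` F. (norm (entry u n))\<^sup>2)"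
    using s by (subst sum.reindex) (auto simp: inj_on_def inj_def power_mult_distrib sum_distrib_left)
  also have "\<dots> \<le> C\<^sup>2 * (norm u)\<^sup>2" using F by (intro mult_left_mono sum_entry_le_norm) auto
  finally show "(\<Sum>n\<in>F. (norm (entry v n))\<^sup>2) \<le> (C * norm u)\<^sup>2" by (simp add: power_mult_distrib)
qed (use C in auto)

instance l2 :: (type) banach
proof
  fix X :: "nat \<Rightarrow> 'a l2"
  assume X: "Cauchy X"
  have "Cauchy (\<lambda>k. entry (X k) n)" for n
  proof (rule metric_CauchyI)
    fix e :: real assume "e > 0"
    then obtain M where M: "\<And>i j. i \<ge> M \<Longrightarrow> j \<ge> M \<Longrightarrow> dist (X i) (X j) < e"
      using X metric_CauchyD by metis
    have "dist (entry (X i) n) (entry (X j) n) \<le> dist (X i) (X j)" for i j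
      using norm_entry_le[of "X i - X j" n] by (simp add: dist_norm)
    then show "\<exists>M. \<forall>i\<ge>M. \<forall>j\<ge>M. dist (entry (X i) n) (entry (X j) n) < e"
      using M by (meson le_less_trans)
  qed
  then have "\<forall>n. \<exists>l. (\<lambda>k. entry (X k) n) \<longlonglongrightarrow> l"
    by (simp add: Cauchy_convergent_iff convergent_def)
  then obtain f where f: "\<And>n. (\<lambda>k. entry (X k) n) \<longlonglongrightarrow> f n"
    by metis
  have key: "(\<Sum>n\<in>F. (norm (entry (X k) n - f n))\<^sup>2) \<le> e\<^sup>2"
    if "finite F" "e > 0" "k \<ge> M" "\<And>i j. i \<ge> M \<Longrightarrow> j \<ge> M \<Longrightarrow> dist (X i) (X j) < e" for F e k M
  proof (rule LIMSEQ_le_const2)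
    show "(\<lambda>j. \<Sum>n\<in>F. (norm (entry (X k) n - entry (X j) n))\<^sup>2) \<longlonglongrightarrow> (\<Sum>n\<in>F. (norm (entry (X k) n - f n))\<^sup>2)"
      by (intro tendsto_sum tendsto_power tendsto_norm tendsto_diff tendsto_const f)
    have "(\<Sum>n\<in>F. (norm (entry (X k) n - entry (X j) n))\<^sup>2) \<le> e\<^sup>2" if "j \<ge> M" for j
    proof -
      have "(\<Sum>n\<in>F. (norm (entry (X k - X j) n))\<^sup>2) \<le> (norm (X k - X j))\<^sup>2"
        by (rule sum_entry_le_norm) fact
      also have "\<dots> \<le> e\<^sup>2" using \<open>\<And>i j. i \<ge> M \<Longrightarrow> j \<ge> M \<Longrightarrow> dist (X i) (X j) < e\<close>[of k j] that \<open>k \<ge> M\<close>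
        by (intro power_mono) (auto simp: dist_norm)
      finally show ?thesis by simp
    qed
    then show "\<exists>N. \<forall>j\<ge>N. (\<Sum>n\<in>F. (norm (entry (X k) n - entry (X j) n))\<^sup>2) \<le> e\<^sup>2" by blast
  qed
  obtain M1 where M1: "\<And>i j. i \<ge> M1 \<Longrightarrow> j \<ge> M1 \<Longrightarrow> dist (X i) (X j) < 1"
    using X metric_CauchyD[of X 1] by auto
  have "(\<lambda>n. (norm (entry (X M1) n - f n))\<^sup>2) summable_on UNIV"
    by (rule nonneg_bdd_above_summable_on)
      (auto intro!: bdd_aboveI[of _ "1\<^sup>2"] key[where M = M1] M1)
  then have D: "(\<lambda>n. entry (X M1) n - f n) \<in> {u. (\<lambda>n. (norm (u n))\<^sup>2) summable_on UNIV}" by simp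
  \<comment> \<open>Only the difference of \<open>f\<close> to a member of the sequence is
    estimated; square-summability of \<open>f\<close> itself follows from it.\<close>
  define Y where "Y = X M1 - Abs_l2 (\<lambda>n. entry (X M1) n - f n)"
  have Y: "entry Y n = f n" for n by (simp add: Y_def Abs_l2_inverse[OF D])
  have "X \<longlonglongrightarrow> Y"
  proof (rule metric_LIMSEQ_I)
    fix e :: real assume e: "e > 0"
    then have "e / 2 > 0" by simp
    then obtain M where M: "\<And>i j. i \<ge> M \<Longrightarrow> j \<ge> M \<Longrightarrow> dist (X i) (X j) < e / 2"
      using X metric_CauchyD by metis
    have "dist (X k) Y < e" if "k \<ge> M" for k
    proof -
      have "norm (X k - Y) \<le> e / 2"
        by (rule norm_l2_le) (use key[OF _ \<open>e / 2 > 0\<close> that M] e in \<open>auto simp: Y\<close>)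
      then show ?thesis using e by (simp add: dist_norm)
    qed
    then show "\<exists>M. \<forall>k\<ge>M. dist (X k) Y < e" by blast
  qed
  then show "convergent X" by (auto simp: convergent_def)
qed

section \<open>Weighted shifts\<close>

definition wshift :: "('a \<Rightarrow> real) \<Rightarrow> ('a \<Rightarrow> 'a) \<Rightarrow> 'a l2 \<Rightarrow> 'a l2" where
  "wshift g s u = Abs_l2 (\<lambda>n. g n *\<^sub>R entry u (s n))"

lemma entry_wshift [simp]:
  assumes "inj s" "bounded (range g)"
  shows "entry (wshift g s u) n = g n *\<^sub>R entry u (s n)"
proof -
  obtain C where C: "\<And>n. \<bar>g n\<bar> \<le> C" using assms(2) by (auto simp: bounded_iff)
  have "(\<lambda>n. (norm (g n *\<^sub>R entry u (s n)))\<^sup>2) summable_on UNIV"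
    by (rule summable_on_square_dominated[OF assms(1), of _ C u]) (simp add: C mult_right_mono)
  then show ?thesis by (simp add: wshift_def Abs_l2_inverse)
qed

lemma norm_wshift_le:
  assumes "inj s" "\<And>n. \<bar>g n\<bar> \<le> C"
  shows "norm (wshift g s u) \<le> C * norm u"
proof (rule norm_le_entrywise[OF assms(1)])
  have "bounded (range g)" using assms(2) by (auto simp: bounded_iff)
  then show "norm (entry (wshift g s u) n) \<le> C * norm (entry u (s n))" for n
    using assms by (simp add: mult_right_mono)
  show "C \<ge> 0" using assms(2)[of undefined] by linarith
qed

lemma bounded_linear_wshift:
  assumes "inj s" "bounded (range g)"
  shows "bounded_linear (wshift g s)"
proof -
  obtain C where C: "\<And>n. \<bar>g n\<bar> \<le> C" using assms(2) by (auto simp: bounded_iff)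
  show ?thesis
  proof (rule bounded_linear_intro)
    show "norm (wshift g s x) \<le> norm x * C" for x
      using norm_wshift_le[OF assms(1), of g C x] C by (simp add: mult.commute)
  qed (auto intro!: l2_eqI simp: assms algebra_simps)
qed

lemma wshift_inner:
  assumes "bij s" "bounded (range g)"
  shows "wshift g s u \<bullet> v = u \<bullet> wshift (g \<circ> inv s) (inv s) v"
proof -
  have inj: "inj s" "inj (inv s)" and s: "inv s (s n) = n" for n
    using assms(1) by (auto simp: bij_is_inj bij_imp_bij_inv)
  have bg: "bounded (range (g \<circ> inv s))"
    by (rule bounded_subset[OF assms(2)]) auto
  have "u \<bullet> wshift (g \<circ> inv s) (inv s) v = (\<Sum>\<^sub>\<infinity>n. g (inv s n) * (entry u n \<bullet> entry v (inv s n)))"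
    by (simp add: inner_l2_def entry_wshift[OF inj(2) bg])
  also have "\<dots> = (\<Sum>\<^sub>\<infinity>n. g (inv s (s n)) * (entry u (s n) \<bullet> entry v (inv s (s n))))"
    by (rule infsum_reindex_bij_betw[OF assms(1), symmetric])
  also have "\<dots> = wshift g s u \<bullet> v"
    by (simp add: inner_l2_def inj assms s)
  finally show ?thesis by simp
qed

section \<open>Transfer matrices and discriminants\<close>

lemma polyop_swap:
  "linear A \<Longrightarrow> polyop p A (polyop q A u) = polyop q A (polyop p A u)"
  by (simp only: polyop_mult[symmetric] mult.commute)

definition mat2 :: "'a \<Rightarrow> 'a \<Rightarrow> 'a \<Rightarrow> 'a \<Rightarrow> 'a::comm_ring_1 ^ 2 ^ 2" where
  "mat2 a b c d = vector [vector [a, b], vector [c, d]]"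

lemma mat2_nth [simp]:
  "mat2 a b c d $ 1 $ 1 = a" "mat2 a b c d $ 1 $ 2 = b" "mat2 a b c d $ 2 $ 1 = c" "mat2 a b c d $ 2 $ 2 = d"
  by (simp_all add: mat2_def vector_2)

lemma mat2_eqI:
  fixes M N :: "'a::comm_ring_1 ^ 2 ^ 2"
  assumes "M $ 1 $ 1 = N $ 1 $ 1" "M $ 1 $ 2 = N $ 1 $ 2" "M $ 2 $ 1 = N $ 2 $ 1" "M $ 2 $ 2 = N $ 2 $ 2"
  shows "M = N"
  using assms by (auto simp: vec_eq_iff forall_2)

lemma mm_nth: "(M ** N) $ i $ j = M $ i $ 1 * N $ 1 $ j + M $ i $ 2 * N $ 2 $ j"
  for M N :: "'a::comm_ring_1 ^ 2 ^ 2"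
  by (simp add: matrix_matrix_mult_def sum_2)

lemma trace_2: "trace M = M $ 1 $ 1 + M $ 2 $ 2" for M :: "'a::comm_ring_1 ^ 2 ^ 2"
  by (simp add: trace_def sum_2)

lemma mat_one_nth:
  "(mat 1 :: 'a::comm_ring_1 ^ 2 ^ 2) $ 1 $ 1 = 1" "(mat 1 :: 'a ^ 2 ^ 2) $ 1 $ 2 = 0"
  "(mat 1 :: 'a ^ 2 ^ 2) $ 2 $ 1 = 0" "(mat 1 :: 'a ^ 2 ^ 2) $ 2 $ 2 = 1"
  by (simp_all add: mat_def)

text \<open>A solution of \<open>a j * u (j + 1) + a (j - 1) * u (j - 1) = x * u j\<close> is propagated through the
  states \<open>(u (j + 1), a j * u j)\<close>; with this normalization the step matrices are unimodular. The
  coercion \<open>c\<close> allows for \<open>x\<close> both a number and the indeterminate.\<close>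

definition transfer_step :: "(real \<Rightarrow> 'r) \<Rightarrow> 'r \<Rightarrow> (int \<Rightarrow> real) \<Rightarrow> int \<Rightarrow> 'r::comm_ring_1 ^ 2 ^ 2" where
  "transfer_step c x a j = mat2 (c (1 / a j) * x) (- c (1 / a j)) (c (a j)) 0"

primrec transfer_mat :: "(real \<Rightarrow> 'r) \<Rightarrow> 'r \<Rightarrow> (int \<Rightarrow> real) \<Rightarrow> int \<Rightarrow> nat \<Rightarrow> 'r::comm_ring_1 ^ 2 ^ 2" where
  "transfer_mat c x a j 0 = mat 1"
| "transfer_mat c x a j (Suc k) = transfer_step c x a (j + int k + 1) ** transfer_mat c x a j k"

lemma transfer_mat_Suc_right:
  "transfer_mat c x a j (Suc k) = transfer_mat c x a (j + 1) k ** transfer_step c x a (j + 1)"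
proof (induction k)
  case (Suc k)
  have "transfer_mat c x a j (Suc (Suc k)) = transfer_step c x a (j + int (Suc k) + 1) ** transfer_mat c x a j (Suc k)"
    by (rule transfer_mat.simps)
  also have "\<dots> = transfer_step c x a (j + 1 + int k + 1) ** (transfer_mat c x a (j + 1) k ** transfer_step c x a (j + 1))"
    by (simp only: Suc) (simp add: algebra_simps)
  finally show ?case by (simp add: matrix_mul_assoc)
qed simp

lemma transfer_mat_cong:
  assumes "\<And>i. 0 < i \<Longrightarrow> i \<le> int k \<Longrightarrow> a (j + i) = b (j' + i)"
  shows "transfer_mat c x a j k = transfer_mat c x b j' k"
  using assms
proof (induction k)
  case (Suc k)
  have "transfer_step c x a (j + int k + 1) = transfer_step c x b (j' + int k + 1)"
    using Suc.prems[of "int k + 1"] by (simp add: transfer_step_def add.assoc)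
  then show ?case using Suc by simp
qed simp

lemma transfer_mat_shift:
  assumes "\<And>j. a (j + int q) = a j"
  shows "transfer_mat c x a (j + int q) k = transfer_mat c x a j k"
proof (rule transfer_mat_cong)
  show "a (j + int q + i) = a (j + i)" for i
    using assms[of "j + i"] by (simp add: algebra_simps)
qed

lemma transfer_mat_add:
  "transfer_mat c x a j (k + l) = transfer_mat c x a (j + int k) l ** transfer_mat c x a j k"
  by (induction l) (simp_all add: matrix_mul_assoc algebra_simps)

lemma det_transfer_step:
  assumes "c (1 / a j) * c (a j) = 1"
  shows "det (transfer_step c x a j) = 1"
  using assms by (simp add: det_2 transfer_step_def)

lemma det_transfer_mat:
  assumes "\<And>j. c (1 / a j) * c (a j) = 1"
  shows "det (transfer_mat c x a j k) = 1"
  by (induction k) (simp_all add: det_mul det_transfer_step assms)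

text \<open>Moving the base point by one site conjugates the period matrix by a step matrix
  \<open>S\<close>. Its inverse \<open>T\<close> is the adjugate, which is available over a
  polynomial ring because the determinant is 1.\<close>

lemma trace_transfer_mat_base:
  assumes c: "\<And>j. c (1 / a j) * c (a j) = 1" and per: "\<And>j. a (j + int q) = a j"
  shows "trace (transfer_mat c x a j q) = trace (transfer_mat c x a 0 q)"
proof -
  have step: "trace (transfer_mat c x a (j + 1) q) = trace (transfer_mat c x a j q)" for j
  proof -
    define S where "S = transfer_step c x a (j + 1)"
    define T where "T = mat2 (S $ 2 $ 2) (- S $ 1 $ 2) (- S $ 2 $ 1) (S $ 1 $ 1)"
    have dS: "S $ 1 $ 1 * S $ 2 $ 2 - S $ 1 $ 2 * S $ 2 $ 1 = 1"
      using det_transfer_step[of c a "j + 1" x] c by (simp add: S_def det_2)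
    have "S $ 1 $ 1 * S $ 2 $ 2 = 1 + S $ 1 $ 2 * S $ 2 $ 1" using dS by (simp add: algebra_simps)
    then have ST: "S ** T = mat 1" and TS: "T ** S = mat 1"
      by (auto intro!: mat2_eqI simp: mm_nth T_def mat_one_nth mult.commute)
    have S': "transfer_step c x a (j + int q + 1) = S"
      using per[of "j + 1"] by (simp add: S_def transfer_step_def algebra_simps)
    have "transfer_mat c x a (j + 1) q ** S = S ** transfer_mat c x a j q"
      using transfer_mat_Suc_right[of c x a j q] by (simp add: S_def[symmetric] S')
    then have "transfer_mat c x a (j + 1) q = S ** transfer_mat c x a j q ** T"
      by (metis ST matrix_mul_assoc matrix_mul_rid)
    then show ?thesis
      by (metis TS matrix_mul_assoc matrix_mul_lid trace_mul_sym)
  qed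
  show ?thesis
  proof (induction j rule: int_induct[where k = 0])
    case (step1 i)
    then show ?case using step[of i] by simp
  next
    case (step2 i)
    then show ?case using step[of "i - 1"] by simp
  qed simp
qed

text \<open>The Floquet discriminant, kept as a polynomial so that it can be applied to an operator
  as well as to an energy.\<close>

definition discriminant :: "(int \<Rightarrow> real) \<Rightarrow> nat \<Rightarrow> real poly" where
  "discriminant a q = trace (transfer_mat (\<lambda>r. [:r:]) [:0, 1:] a 0 q)"

lemma poly_discriminant: "poly (discriminant a q) x = trace (transfer_mat (\<lambda>r. r) x a 0 q)"
proof -
  have "poly (transfer_mat (\<lambda>r. [:r:]) [:0, 1:] a j k $ r $ s) x = transfer_mat (\<lambda>r. r) x a j k $ r $ s" for j k r s
  proof (induction k arbitrary: r s)
    case 0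
    show ?case by (simp add: mat_def)
  next
    case (Suc k)
    have "poly (transfer_step (\<lambda>r. [:r:]) [:0, 1:] a l $ r $ s) x = transfer_step (\<lambda>r. r) x a l $ r $ s" for l
      using exhaust_2[of r] exhaust_2[of s] by (auto simp: transfer_step_def)
    moreover have "poly (transfer_step (\<lambda>r. [:r:]) [:0, 1:] a l $ r $ s) x = transfer_step (\<lambda>r. r) x a l $ r $ s" for l r s
      using exhaust_2[of r] exhaust_2[of s] by (auto simp: transfer_step_def)
    ultimately show ?case using Suc by (simp add: mm_nth)
  qed
  then show ?thesis by (simp add: discriminant_def trace_2)
qed

text \<open>\<open>E j\<close> stands for evaluation at the \<open>j\<close>-th site of a line in the lattice.\<close>

locale hopping =
  fixes A :: "'v::real_vector \<Rightarrow> 'v" and E :: "int \<Rightarrow> 'v \<Rightarrow> 'c::real_vector" and a :: "int \<Rightarrow> real"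
  assumes linA: "linear A" and linE: "\<And>j. linear (E j)"
    and EA: "\<And>j u. E j (A u) = a j *\<^sub>R E (j + 1) u + a (j - 1) *\<^sub>R E (j - 1) u"
begin

definition state :: "int \<Rightarrow> 2 \<Rightarrow> 'v \<Rightarrow> 'c" where
  "state j r u = (if r = 1 then E (j + 1) u else a j *\<^sub>R E j u)"

lemma state_simps: "state j 1 u = E (j + 1) u" "state j 2 u = a j *\<^sub>R E j u"
  by (simp_all add: state_def)

lemma linear_state: "linear (state j r)"
  using linE unfolding linear_iff by (auto simp: state_def algebra_simps)

text \<open>The matrix entries are polynomials in \<open>A\<close> that act on \<open>u\<close>
  before evaluation. This reverses the order of the factors, which is harmless since polynomials in
  \<open>A\<close> commute.\<close>

lemma state_transfer:
  assumes a0: "\<And>j. a j \<noteq> 0"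
  shows "state (j + int k) r u = (\<Sum>s\<in>UNIV. state j s (polyop (transfer_mat (\<lambda>r. [:r:]) [:0, 1:] a j k $ r $ s) A u))"
proof (induction k arbitrary: r u)
  case 0
  have "linear (state j s)" for s by (rule linear_state)
  then show ?case using exhaust_2[of r] by (auto simp: sum_2 mat_one_nth linA linear_0)
next
  case (Suc k)
  let ?M = "transfer_mat (\<lambda>r. [:r:]) [:0, 1:] a j k"
  let ?S = "transfer_step (\<lambda>r. [:r:]) [:0, 1:] a (j + int k + 1)"
  define l where "l = j + int k"
  have "state (l + 1) r u = (\<Sum>s\<in>UNIV. state l s (polyop (?S $ r $ s) A u))"
  proof (cases "r = 1")
    case True
    have "E (l + 1) (A u) = a (l + 1) *\<^sub>R E (l + 1 + 1) u + a l *\<^sub>R E l u"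
      using EA[of "l + 1" u] by simp
    then have "(1 / a (l + 1)) *\<^sub>R E (l + 1) (A u) = E (l + 1 + 1) u + (1 / a (l + 1)) *\<^sub>R a l *\<^sub>R E l u"
      using a0[of "l + 1"] by (simp add: scaleR_right_distrib)
    then show ?thesis using True linE
      by (simp add: sum_2 transfer_step_def state_simps linA l_def[symmetric] linear_0 linear_scale linear_neg)
  next
    case False
    then have "r = 2" using exhaust_2 by blast
    then show ?thesis using linE
      by (simp add: sum_2 transfer_step_def state_simps linA l_def[symmetric] linear_0 linear_scale)
  qed
  also have "\<dots> = (\<Sum>s\<in>UNIV. \<Sum>t\<in>UNIV. state j t (polyop (?M $ s $ t) A (polyop (?S $ r $ s) A u)))"
    using Suc unfolding l_def by simp
  also have "\<dots> = (\<Sum>t\<in>UNIV. state j t (polyop ((?S ** ?M) $ r $ t) A u))"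
    by (simp add: sum_2 mm_nth linA linear_add[OF linear_state] polyop_swap[OF linA, of "?M $ _ $ _" "?S $ _ $ _"])
  finally show ?case by (simp add: l_def add_ac)
qed

text \<open>Cayley--Hamilton for the transfer matrix \<open>M\<close> over one period: \<open>M + M\<^sup>-\<^sup>1 = trace M\<close>.\<close>

lemma discriminant_shift:
  assumes a0: "\<And>j. a j \<noteq> 0" and per: "\<And>j. a (j + int q) = a j"
  shows "E j (polyop (discriminant a q) A u) = E (j + int q) u + E (j - int q) u"
proof -
  \<comment> \<open>The first component of the state at \<open>i\<close> is the value at
    \<open>i + 1\<close>, that is, at \<open>j\<close>.\<close>
  define i where "i = j - 1"
  define M where "M = transfer_mat (\<lambda>r. [:r:]) [:0, 1:] a i q"
  have cc: "[:1 / a j:] * [:a j:] = 1" for j using a0[of j] by (simp add: one_pCons)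
  have "det M = 1" unfolding M_def by (rule det_transfer_mat) (rule cc)
  then have det: "M $ 1 $ 1 * M $ 2 $ 2 - M $ 1 $ 2 * M $ 2 $ 1 = 1" by (simp add: det_2)
  have tr: "discriminant a q = M $ 1 $ 1 + M $ 2 $ 2"
    unfolding discriminant_def M_def trace_2[symmetric]
    by (rule trace_transfer_mat_base[symmetric]) (use cc per in auto)
  have fwd: "state (i + int q) 1 u = state i 1 (polyop (M $ 1 $ 1) A u) + state i 2 (polyop (M $ 1 $ 2) A u)" for u
    using state_transfer[OF a0, of i q 1 u] by (simp add: M_def sum_2)
  have M': "transfer_mat (\<lambda>r. [:r:]) [:0, 1:] a (i - int q) q = M"
    using transfer_mat_shift[where a = a and q = q, OF per, of "\<lambda>r. [:r:]" "[:0, 1:]" "i - int q" q] by (simp add: M_def)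
  have bwd: "state i r u = state (i - int q) 1 (polyop (M $ r $ 1) A u) + state (i - int q) 2 (polyop (M $ r $ 2) A u)" for r u
    using state_transfer[OF a0, of "i - int q" q r u] by (simp add: M' sum_2)
  \<comment> \<open>As \<open>det M = 1\<close>, the first row of the inverse of \<open>M\<close> is
    \<open>M $ 2 $ 2\<close>, \<open>- M $ 1 $ 2\<close>; it recovers the value one period back from
    the state at \<open>i\<close>.\<close>
  have "state (i - int q) 1 u = state (i - int q) 1 (polyop (M $ 1 $ 1 * M $ 2 $ 2 - M $ 1 $ 2 * M $ 2 $ 1) A u)"
    unfolding det by (simp add: linA)
  also have "\<dots> = state i 1 (polyop (M $ 2 $ 2) A u) - state i 2 (polyop (M $ 1 $ 2) A u)"
    unfolding bwd[of 1] bwd[of 2]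
    by (simp add: linA linear_diff[OF linear_state] polyop_swap[OF linA, of "M $ 2 $ _" "M $ 1 $ 2"])
  finally have "state (i + int q) 1 u + state (i - int q) 1 u = state i 1 (polyop (M $ 1 $ 1 + M $ 2 $ 2) A u)"
    unfolding fwd by (simp add: linA linear_add[OF linear_state])
  then show ?thesis by (simp add: state_simps tr i_def algebra_simps)
qed

end

text \<open>The characteristic polynomial of the Jacobi block on the sites \<open>m + 1\<close> to
  \<open>m + k\<close>, with zero diagonal and inner bonds \<open>a (m + 1)\<close> to
  \<open>a (m + k - 1)\<close>.\<close>

fun block_poly :: "(int \<Rightarrow> real) \<Rightarrow> int \<Rightarrow> nat \<Rightarrow> real poly" where
  "block_poly a m 0 = 1"
| "block_poly a m (Suc 0) = [:0, 1:]"
| "block_poly a m (Suc (Suc k)) = [:0, 1:] * block_poly a m (Suc k) - smult ((a (m + int k + 1))\<^sup>2) (block_poly a m k)"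

lemma block_poly_cong:
  assumes "\<And>i. 0 < i \<Longrightarrow> i < int k \<Longrightarrow> a (m + i) = b (m' + i)"
  shows "block_poly a m k = block_poly b m' k"
  using assms
proof (induction a m k rule: block_poly.induct)
  case (3 a m k)
  then show ?case using "3.prems"[of "int k + 1"] by (simp add: add.assoc)
qed auto

lemma degree_block_poly: "degree (block_poly a m k) = k \<and> block_poly a m k \<noteq> 0"
proof (induction a m k rule: block_poly.induct)
  case (3 a m k)
  let ?p = "[:0, 1:] * block_poly a m (Suc k)" and ?q = "smult ((a (m + int k + 1))\<^sup>2) (block_poly a m k)"
  have "degree ?p = Suc (Suc k)" using "3.IH" by (subst degree_mult_eq) auto
  moreover have "degree ?q < Suc (Suc k)" using "3.IH" by (simp add: le_less_trans[OF degree_smult_le])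
  ultimately have "degree (?p - ?q) = Suc (Suc k)"
    using degree_add_eq_left[of "- ?q" ?p] by simp
  then show ?case by force
qed auto

context hopping
begin

text \<open>With bond \<open>m\<close> cut, site \<open>m + 1\<close> is an end of the chain. Its
  neighbours are then generated from it by the orthogonal polynomials of the block, up to the
  product of the bonds passed.\<close>

lemma block_poly_eval:
  assumes m: "a m = 0"
  shows "E (m + 1) (polyop (block_poly a m k) A u) = (\<Prod>i<k. a (m + 1 + int i)) *\<^sub>R E (m + 1 + int k) u"
  using m
proof (induction k arbitrary: u rule: induct_nat_012)
  case 1
  then show ?case using EA[of "m + 1" u] by (simp add: linA linear_0)
next
  case (ge2 k)
  let ?P = "\<Prod>i<k. a (m + 1 + int i)"
  have e: "m + (2 + int k) = m + 1 + int (Suc k)" by simp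
  have "E (m + 1) (polyop (block_poly a m (Suc (Suc k))) A u) =
     E (m + 1) (polyop (block_poly a m (Suc k)) A (A u)) - (a (m + int k + 1))\<^sup>2 *\<^sub>R E (m + 1) (polyop (block_poly a m k) A u)"
  proof -
    have "A (polyop (block_poly a m (Suc k)) A u) = polyop (block_poly a m (Suc k)) A (A u)"
      by (rule polyop_commute[OF linA linA refl])
    then show ?thesis using linE
      by (simp add: linA linear_diff linear_scale linear_0)
  qed
  also have "\<dots> = (?P * a (m + 1 + int k)) *\<^sub>R E (m + 1 + int (Suc k)) (A u) - (a (m + int k + 1))\<^sup>2 *\<^sub>R ?P *\<^sub>R E (m + 1 + int k) u"
    using ge2 by simp
  also have "E (m + 1 + int (Suc k)) (A u) = a (m + 1 + int (Suc k)) *\<^sub>R E (m + 1 + int (Suc (Suc k))) u + a (m + 1 + int k) *\<^sub>R E (m + 1 + int k) u"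
    using EA[of "m + 1 + int (Suc k)" u] by (simp add: algebra_simps)
  finally show ?case by (simp add: scaleR_right_distrib power2_eq_square algebra_simps)
qed (simp add: linA)

text \<open>Cayley--Hamilton for the diagonal blocks of a decoupled chain.\<close>

lemma block_poly_annihilates:
  assumes m: "a m = 0" "a (m + int q) = 0" and a0: "\<And>i. 0 < i \<Longrightarrow> i < int q \<Longrightarrow> a (m + i) \<noteq> 0"
    and j: "0 < j" "j \<le> int q"
  shows "E (m + j) (polyop (block_poly a m q) A u) = 0"
proof -
  have q: "q > 0" using j by simp
  define D where "D = block_poly a m q"
  have D0: "E (m + 1) (polyop D A w) = 0" for w
  proof -
    have "a (m + 1 + int (q - 1)) = 0" using m(2) q by (simp add: of_nat_diff)
    moreover have "q - 1 \<in> {..<q}" using q by simp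
    ultimately have "\<exists>i\<in>{..<q}. a (m + 1 + int i) = 0" by blast
    then have "(\<Prod>i<q. a (m + 1 + int i)) = 0" by (rule prod_zero[OF finite_lessThan])
    then show ?thesis unfolding D_def block_poly_eval[OF m(1)] by simp
  qed
  define k where "k = nat (j - 1)"
  have k: "m + 1 + int k = m + j" "k < q" using j by (auto simp: k_def)
  have "(\<Prod>i<k. a (m + 1 + int i)) \<noteq> 0"
    using a0[of "int _ + 1"] k(2) by (auto simp: add.assoc add.commute[of 1])
  \<comment> \<open>Annihilation at the end site spreads to site \<open>m + j\<close>: the block
    polynomial of the sites before it expresses its value through the end site and commutes with
    \<open>D\<close>.\<close>
  moreover have "(\<Prod>i<k. a (m + 1 + int i)) *\<^sub>R E (m + j) (polyop D A u) = 0"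
  proof -
    have "(\<Prod>i<k. a (m + 1 + int i)) *\<^sub>R E (m + j) (polyop D A u) = E (m + 1) (polyop (block_poly a m k) A (polyop D A u))"
      unfolding block_poly_eval[OF m(1)] k(1) ..
    also have "\<dots> = E (m + 1) (polyop D A (polyop (block_poly a m k) A u))"
      by (simp only: polyop_swap[OF linA, of D])
    finally show ?thesis by (simp add: D0)
  qed
  ultimately show ?thesis by (simp add: D_def)
qed

end

section \<open>Hopping operators on the lattice\<close>

lemma bij_translation: "bij (\<lambda>n. n + c)" for c :: "'a::ab_group_add"
  by (rule bij_betwI[of _ _ _ "\<lambda>n. n - c"]) auto

lemma inj_translation: "inj (\<lambda>n. n + c)" for c :: "'a::ab_group_add"
  by (rule injI) simp

lemma inv_translation: "inv (\<lambda>n. n + c) = (\<lambda>n. n - c)" for c :: "'a::ab_group_add"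
  by (rule inv_unique_comp) auto

lemma bounded_range_reindex: "bounded (range a) \<Longrightarrow> bounded (range (\<lambda>n. a (f n)))"
  by (erule bounded_subset) auto

lemma axis_0 [simp]: "axis i 0 = (0 :: int ^ 'd)"
  by (simp add: axis_eq_0_iff)

text \<open>Acting on the whole lattice puts the chains of all directions on one space, where they
  commute and where the one-dimensional estimates are proved directly.\<close>

definition hop :: "(int \<Rightarrow> real) \<Rightarrow> 'd::finite \<Rightarrow> (int ^ 'd) l2 \<Rightarrow> (int ^ 'd) l2" where
  "hop a i u = wshift (\<lambda>n. a (n $ i)) (\<lambda>n. n + axis i 1) u + wshift (\<lambda>n. a (n $ i - 1)) (\<lambda>n. n + axis i (- 1)) u"

definition translate :: "'d::finite \<Rightarrow> int \<Rightarrow> (int ^ 'd) l2 \<Rightarrow> (int ^ 'd) l2" where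
  "translate i k = wshift (\<lambda>_. 1) (\<lambda>n. n + axis i k)"

lemma entry_hop:
  assumes "bounded (range a)"
  shows "entry (hop a i u) n = a (n $ i) *\<^sub>R entry u (n + axis i 1) + a (n $ i - 1) *\<^sub>R entry u (n + axis i (- 1))"
proof -
  have b: "bounded (range (\<lambda>n :: int ^ 'a. a (n $ i)))" "bounded (range (\<lambda>n :: int ^ 'a. a (n $ i - 1)))"
    by (rule bounded_range_reindex[OF assms])+
  show ?thesis by (simp add: hop_def entry_wshift[OF inj_translation b(1)] entry_wshift[OF inj_translation b(2)])
qed

lemma entry_translate [simp]: "entry (translate i k u) n = entry u (n + axis i k)"
  unfolding translate_def by (subst entry_wshift) (auto simp: inj_translation bounded_iff)

lemma norm_translate_le: "norm (translate i k u) \<le> norm u"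
  unfolding translate_def using norm_wshift_le[OF inj_translation, of "\<lambda>_. 1" 1 _ u] by simp

lemma symop_hop:
  assumes "bounded (range a)"
  shows "symop (hop a i)"
  unfolding symop_def
proof (intro conjI allI)
  have b: "bounded (range (\<lambda>n :: int ^ 'a. a (n $ i)))" "bounded (range (\<lambda>n :: int ^ 'a. a (n $ i - 1)))"
    by (rule bounded_range_reindex[OF assms])+
  have "hop a i = (\<lambda>u. wshift (\<lambda>n. a (n $ i)) (\<lambda>n. n + axis i 1) u + wshift (\<lambda>n. a (n $ i - 1)) (\<lambda>n. n + axis i (- 1)) u)"
    by (auto simp: hop_def)
  then show "bounded_linear (hop a i)"
    using bounded_linear_add[OF bounded_linear_wshift[OF inj_translation b(1)] bounded_linear_wshift[OF inj_translation b(2)]]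
    by simp
  fix u v
  have n1: "n - axis i 1 = n + axis i (- 1)" "n - axis i (- 1) = n + axis i 1" for n :: "int ^ 'a"
    by (auto simp: vec_eq_iff axis_def)
  have c: "(\<lambda>n. a (n $ i)) \<circ> (\<lambda>n. n + axis i (- 1)) = (\<lambda>n. a (n $ i - 1))"
    "(\<lambda>n. a (n $ i - 1)) \<circ> (\<lambda>n. n + axis i 1) = (\<lambda>n. a (n $ i))"
    by auto
  show "hop a i u \<bullet> v = u \<bullet> hop a i v"
    unfolding hop_def inner_add_left inner_add_right
      wshift_inner[OF bij_translation b(1)] wshift_inner[OF bij_translation b(2)] inv_translation n1 c
    by (rule add.commute)
qed

lemma norm_hop_le:
  assumes "\<And>j. \<bar>a j\<bar> \<le> C"
  shows "norm (hop a i u) \<le> 2 * C * norm u"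
proof -
  have "norm (hop a i u) \<le> C * norm u + C * norm u"
    unfolding hop_def
    by (intro norm_triangle_le add_mono norm_wshift_le inj_translation assms)
  then show ?thesis by simp
qed

lemma bounded_range_abs: "(\<And>j. \<bar>a j\<bar> \<le> C) \<Longrightarrow> bounded (range a)" for a :: "'a \<Rightarrow> real"
  by (auto simp: bounded_iff)

lemma norm_hop_diff_le:
  assumes "bounded (range a)" "bounded (range b)" and e: "\<And>j. \<bar>b j - a j\<bar> \<le> e"
  shows "norm (hop b i u - hop a i u) \<le> 2 * e * norm u"
proof -
  have "hop b i u - hop a i u = hop (\<lambda>j. b j - a j) i u"
    by (rule l2_eqI) (simp add: entry_hop assms bounded_range_abs[of _ e] algebra_simps)
  then have "norm (hop b i u - hop a i u) = norm (hop (\<lambda>j. b j - a j) i u)" by (rule arg_cong)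
  also have "\<dots> \<le> 2 * e * norm u" by (rule norm_hop_le[OF e])
  finally show ?thesis .
qed

lemma hop_commute:
  fixes i j :: "'d::finite"
  assumes a: "bounded (range a)" and b: "bounded (range b)" and ij: "i \<noteq> j"
  shows "hop a i (hop b j u) = hop b j (hop a i u)"
proof (rule l2_eqI)
  fix n :: "int ^ 'd"
  have nth: "axis i x $ j = 0" "axis j x $ i = 0" for x :: int
    using ij by (auto simp: axis_def)
  show "entry (hop a i (hop b j u)) n = entry (hop b j (hop a i u)) n"
    by (simp add: entry_hop a b nth algebra_simps)
qed

lemma hopping_hop:
  fixes i :: "'d::finite" and n :: "int ^ 'd"
  assumes "bounded (range a)"
  shows "hopping (hop a i) (\<lambda>j u. entry u (n + axis i (j - n $ i))) a"
proof (rule hopping.intro)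
  show "linear (hop a i)" by (rule symopD(2)[OF symop_hop[OF assms]])
  show "linear (\<lambda>u. entry u (n + axis i (j - n $ i)))" for j by (auto simp: linear_iff)
  fix j and u :: "(int ^ 'd) l2"
  have e: "n + axis i (j - n $ i) + axis i 1 = n + axis i (j + 1 - n $ i)"
    "n + axis i (j - n $ i) + axis i (- 1) = n + axis i (j - 1 - n $ i)"
    by (auto simp: vec_eq_iff axis_def)
  show "entry (hop a i u) (n + axis i (j - n $ i)) =
      a j *\<^sub>R entry u (n + axis i (j + 1 - n $ i)) + a (j - 1) *\<^sub>R entry u (n + axis i (j - 1 - n $ i))"
    unfolding entry_hop[OF assms] e by simp
qed

lemma polyop_discriminant_hop:
  fixes i :: "'d::finite"
  assumes b: "bounded (range a)" and a0: "\<And>j. a j \<noteq> 0" and per: "\<And>j. a (j + int q) = a j"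
  shows "polyop (discriminant a q) (hop a i) u = translate i (int q) u + translate i (- int q) u"
proof (rule l2_eqI)
  fix n :: "int ^ 'd"
  interpret hopping "hop a i" "\<lambda>j u. entry u (n + axis i (j - n $ i))" a by (rule hopping_hop[OF b])
  show "entry (polyop (discriminant a q) (hop a i) u) n = entry (translate i (int q) u + translate i (- int q) u) n"
    using discriminant_shift[OF a0 per, where j = "n $ i" and u = u] by simp
qed

text \<open>The discriminant of the operator is a sum of two translations and has norm at most 2, so
  it keeps away from any value of modulus above 2.\<close>

lemma hop_bounded_below_discriminant:
  fixes i :: "'d::finite"
  assumes b: "bounded (range a)" and a0: "\<And>j. a j \<noteq> 0" and per: "\<And>j. a (j + int q) = a j"
    and x: "\<bar>poly (discriminant a q) x\<bar> > 2"
  shows "bounded_below_at (hop a i) x"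
proof (rule bounded_below_at_polyop[of _ "\<bar>poly (discriminant a q) x\<bar> - 2" "discriminant a q"])
  show "bounded_linear (hop a i)" by (rule symopD(1)[OF symop_hop[OF b]])
  fix v :: "(int ^ 'd) l2"
  have "norm (translate i (int q) v + translate i (- int q) v) \<le> norm v + norm v"
    by (intro norm_triangle_le add_mono norm_translate_le)
  then show "(\<bar>poly (discriminant a q) x\<bar> - 2) * norm v \<le> norm (polyop (discriminant a q) (hop a i) v - poly (discriminant a q) x *\<^sub>R v)"
    unfolding polyop_discriminant_hop[OF assms(1-3)]
    using norm_triangle_ineq2[of "poly (discriminant a q) x *\<^sub>R v" "translate i (int q) v + translate i (- int q) v"]
    by (simp add: norm_minus_commute algebra_simps)
qed (use x in auto)

text \<open>The block polynomial annihilates every block, so as an operator it vanishes; off its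
  roots it is then bounded away from its value.\<close>

lemma hop_decoupled_spectrum:
  fixes i :: "'d::finite"
  assumes b: "bounded (range a)" and q: "q > 0" and per: "\<And>j. a (j + int q) = a j"
    and m: "a m = 0" and a0: "\<And>j. 0 < j \<Longrightarrow> j < int q \<Longrightarrow> a (m + j) \<noteq> 0"
    and nb: "\<not> bounded_below_at (hop a i) y"
  shows "poly (block_poly a m q) y = 0"
proof (rule ccontr)
  assume ne: "poly (block_poly a m q) y \<noteq> 0"
  have perk: "a (j + int q * t) = a j" for j t
  proof (induction t arbitrary: j rule: int_induct[where k = 0])
    case (step1 t)
    then show ?case using per[of "j + int q * t"] by (simp add: algebra_simps)
  next
    case (step2 t)
    then show ?case using per[of "j + int q * (t - 1)"] by (simp add: algebra_simps)
  qed simp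
  have "polyop (block_poly a m q) (hop a i) u = 0" for u
  proof (rule l2_eqI)
    fix n :: "int ^ 'd"
    interpret hopping "hop a i" "\<lambda>j u. entry u (n + axis i (j - n $ i))" a by (rule hopping_hop[OF b])
    \<comment> \<open>The blocks consist of the sites \<open>m + q * t + 1\<close> to
      \<open>m + q * t + q\<close>; hence the shift by one here and in \<open>j\<close>.\<close>
    define t where "t = (n $ i - m - 1) div int q"
    define j where "j = (n $ i - m - 1) mod int q + 1"
    have "0 \<le> (n $ i - m - 1) mod int q" "(n $ i - m - 1) mod int q < int q" using q by simp_all
    then have j: "0 < j" "j \<le> int q" unfolding j_def by linarith+
    have nt: "m + int q * t + j = n $ i"
      using div_mult_mod_eq[of "n $ i - m - 1" "int q"] by (simp add: t_def j_def algebra_simps)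
    have bp: "block_poly a (m + int q * t) q = block_poly a m q"
    proof (rule block_poly_cong)
      show "a (m + int q * t + k) = a (m + k)" for k using perk[of "m + k" t] by (simp add: algebra_simps)
    qed
    have "entry (polyop (block_poly a (m + int q * t) q) (hop a i) u) (n + axis i (m + int q * t + j - n $ i)) = 0"
    proof (rule block_poly_annihilates[OF _ _ _ j])
      show "a (m + int q * t) = 0" using m perk by simp
      show "a (m + int q * t + int q) = 0" using m perk per by simp
      show "a (m + int q * t + k) \<noteq> 0" if "0 < k" "k < int q" for k
        using a0[OF that] perk[of "m + k" t] by (simp add: algebra_simps)
    qed
    then show "entry (polyop (block_poly a m q) (hop a i) u) n = entry 0 n" by (simp add: nt bp)
  qed
  then have "bounded_below_at (hop a i) y"
    using ne by (intro bounded_below_at_polyop[of _ "\<bar>poly (block_poly a m q) y\<bar>" "block_poly a m q"])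
      (auto simp: symopD(1)[OF symop_hop[OF b]])
  then show False using nb by simp
qed

section \<open>Exponential localization and removal of bonds\<close>

lemma power_step_diff:
  fixes g :: real
  assumes "g > 0" "k \<le> l + 1" "l \<le> k + 1"
  shows "\<bar>(1 + g) ^ k - (1 + g) ^ l\<bar> \<le> g * (1 + g) ^ k"
proof -
  consider "k = l" | "k = Suc l" | "l = Suc k" using assms by linarith
  then show ?thesis
  proof cases
    case 2
    have "(1 + g) ^ l * g \<le> (1 + g) ^ Suc l * g"
      using assms by (intro mult_right_mono power_increasing) auto
    then show ?thesis using 2 assms by (simp add: algebra_simps)
  qed (use assms in \<open>auto simp: algebra_simps\<close>)
qed

text \<open>Combes--Thomas estimate: conjugating with a weight that grows exponentially at rate \<open>g\<close>
  into the region where \<open>a\<close> agrees with \<open>w\<close> perturbs the operator only by \<open>O(g)\<close>.\<close>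

lemma hop_localization:
  fixes i :: "'d::finite" and h :: "int \<Rightarrow> nat"
  assumes a: "\<And>j. \<bar>a j\<bar> \<le> 3" and w: "bounded (range w)"
    and h: "\<And>j. h (j + 1) \<le> h j + 1" "\<And>j. h j \<le> h (j + 1) + 1" "\<And>j. h j \<le> N"
    and agree: "\<And>j. h j > 0 \<or> h (j + 1) > 0 \<Longrightarrow> a j = w j"
    and \<beta>: "\<beta> > 0" "\<And>v. \<beta> * norm v \<le> norm (hop w i v - x *\<^sub>R v)"
    and g: "g > 0" "12 * g \<le> \<beta>"
  shows "norm (wshift (\<lambda>n. (1 + g) ^ h (n $ i) - 1) (\<lambda>n. n) v)
      \<le> norm v + 2 / \<beta> * (1 + g) ^ N * norm (hop a i v - x *\<^sub>R v)"
proof -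
  \<comment> \<open>Subtracting 1 makes the weight vanish where \<open>h\<close> is 0, so
    \<open>R v\<close> is supported where \<open>h > 0\<close>, and each bond touching that region
    has the same weight in \<open>a\<close> and \<open>w\<close>.\<close>
  define \<rho> where "\<rho> = (\<lambda>j. (1 + g) ^ h j - 1)"
  have \<rho>: "0 \<le> \<rho> j" "\<rho> j \<le> (1 + g) ^ N" for j
  proof -
    have "(1 + g) ^ h j \<le> (1 + g) ^ N" using g h(3) by (intro power_increasing) auto
    then show "\<rho> j \<le> (1 + g) ^ N" unfolding \<rho>_def by linarith
  qed (use g in \<open>simp add: \<rho>_def\<close>)
  have b\<rho>: "bounded (range (\<lambda>n :: int ^ 'd. \<rho> (n $ i)))"
    by (rule bounded_range_abs[of _ "(1 + g) ^ N"]) (use \<rho> in auto)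
  have inj: "inj (\<lambda>n :: int ^ 'd. n)" by simp
  define R where "R = wshift (\<lambda>n :: int ^ 'd. \<rho> (n $ i)) (\<lambda>n. n)"
  have eR [simp]: "entry (R u) n = \<rho> (n $ i) *\<^sub>R entry u n" for u n
    unfolding R_def by (rule entry_wshift[OF inj b\<rho>])
  have ba: "bounded (range a)" by (rule bounded_range_abs) (rule a)
  have wa: "hop w i (R v) = hop a i (R v)"
  proof (rule l2_eqI)
    fix n
    have "w (n $ i) * \<rho> (n $ i + 1) = a (n $ i) * \<rho> (n $ i + 1)"
      using agree[of "n $ i"] by (cases "h (n $ i + 1) = 0") (auto simp: \<rho>_def)
    then have 1: "w (n $ i) *\<^sub>R \<rho> (n $ i + 1) *\<^sub>R y = a (n $ i) *\<^sub>R \<rho> (n $ i + 1) *\<^sub>R y" for y :: complex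
      by (simp only: scaleR_scaleR)
    have "w (n $ i - 1) * \<rho> (n $ i - 1) = a (n $ i - 1) * \<rho> (n $ i - 1)"
      using agree[of "n $ i - 1"] by (cases "h (n $ i - 1) = 0") (auto simp: \<rho>_def)
    then have 2: "w (n $ i - 1) *\<^sub>R \<rho> (n $ i - 1) *\<^sub>R y = a (n $ i - 1) *\<^sub>R \<rho> (n $ i - 1) *\<^sub>R y" for y :: complex
      by (simp only: scaleR_scaleR)
    show "entry (hop w i (R v)) n = entry (hop a i (R v)) n"
      using 1[of "entry v (n + axis i 1)"] 2[of "entry v (n + axis i (- 1))"]
      by (simp only: entry_hop[OF w] entry_hop[OF ba] eR vector_add_component axis_nth add_uminus_conv_diff)
  qed
  define f where "f = hop a i v - x *\<^sub>R v"
  define g1 where "g1 = (\<lambda>n :: int ^ 'd. a (n $ i) * (\<rho> (n $ i + 1) - \<rho> (n $ i)))"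
  define g2 where "g2 = (\<lambda>n :: int ^ 'd. a (n $ i - 1) * (\<rho> (n $ i - 1) - \<rho> (n $ i)))"
  have ab: "\<bar>a j * y\<bar> \<le> 3 * z" if "\<bar>y\<bar> \<le> z" for j y z
    unfolding abs_mult by (intro mult_mono a that) auto
  have g1: "\<bar>g1 n\<bar> \<le> 3 * (g * (1 + \<rho> (n $ i + 1)))" for n
    unfolding g1_def \<rho>_def using power_step_diff[OF g(1) h(1)[of "n $ i"] h(2)[of "n $ i"]] by (intro ab) simp
  have g2: "\<bar>g2 n\<bar> \<le> 3 * (g * (1 + \<rho> (n $ i - 1)))" for n
    unfolding g2_def \<rho>_def using power_step_diff[OF g(1) h(2)[of "n $ i - 1"] h(1)[of "n $ i - 1"]] by (intro ab) simp
  have bg: "bounded (range g1)" "bounded (range g2)"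
  proof -
    have "\<bar>g1 n\<bar> \<le> 3 * (g * (1 + (1 + g) ^ N))" "\<bar>g2 n\<bar> \<le> 3 * (g * (1 + (1 + g) ^ N))" for n
      using g \<rho> by (auto intro!: order_trans[OF g1] order_trans[OF g2] mult_left_mono)
    then show "bounded (range g1)" "bounded (range g2)" by (auto intro: bounded_range_abs)
  qed
  \<comment> \<open>Commuting \<open>R\<close> past the hopping produces only differences of \<rho>
    at neighbouring sites, each of relative size \<open>g\<close>.\<close>
  have comm: "hop a i (R v) - x *\<^sub>R R v = R f + (wshift g1 (\<lambda>n. n + axis i 1) v + wshift g2 (\<lambda>n. n + axis i (- 1)) v)"
  proof (rule l2_eqI)
    fix n
    show "entry (hop a i (R v) - x *\<^sub>R R v) n =
        entry (R f + (wshift g1 (\<lambda>n. n + axis i 1) v + wshift g2 (\<lambda>n. n + axis i (- 1)) v)) n"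
      by (simp add: f_def entry_hop ba entry_wshift[OF inj_translation bg(1)] entry_wshift[OF inj_translation bg(2)],
          simp add: g1_def g2_def algebra_simps)
  qed
  have shifted: "norm (wshift c (\<lambda>n. n + axis i k) v) \<le> 3 * g * norm (v + R v)"
    if bc: "bounded (range c)" and c: "\<And>n. \<bar>c n\<bar> \<le> 3 * (g * (1 + \<rho> (n $ i + k)))" for c k
  proof (rule norm_le_entrywise[OF inj_translation])
    fix n :: "int ^ 'd"
    have "entry (v + R v) (n + axis i k) = (1 + \<rho> (n $ i + k)) *\<^sub>R entry v (n + axis i k)"
      by (simp add: algebra_simps)
    then have "norm (entry (v + R v) (n + axis i k)) = (1 + \<rho> (n $ i + k)) * norm (entry v (n + axis i k))"
      using \<rho>(1)[of "n $ i + k"] by simp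
    then show "norm (entry (wshift c (\<lambda>n. n + axis i k) v) n) \<le> 3 * g * norm (entry (v + R v) (n + axis i k))"
      using mult_right_mono[OF c[of n], of "norm (entry v (n + axis i k))"]
      by (simp add: entry_wshift[OF inj_translation bc] mult.assoc del: entry_add)
  qed (use g in auto)
  have n1: "norm (wshift g1 (\<lambda>n. n + axis i 1) v) \<le> 3 * g * norm (v + R v)"
    by (rule shifted[OF bg(1)]) (use g1 in simp)
  have n2: "norm (wshift g2 (\<lambda>n. n + axis i (- 1)) v) \<le> 3 * g * norm (v + R v)"
    by (rule shifted[OF bg(2)]) (use g2 in simp)
  have nf: "norm (R f) \<le> (1 + g) ^ N * norm f"
    unfolding R_def by (rule norm_wshift_le[OF inj]) (use \<rho> in auto)
  have "\<beta> * norm (R v) \<le> norm (hop a i (R v) - x *\<^sub>R R v)" using \<beta>(2)[of "R v"] by (simp add: wa)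
  also have "\<dots> \<le> (1 + g) ^ N * norm f + (3 * g * norm (v + R v) + 3 * g * norm (v + R v))"
    unfolding comm by (intro norm_triangle_le add_mono nf n1 n2)
  also have "\<dots> = (1 + g) ^ N * norm f + 6 * g * norm (v + R v)" by simp
  \<comment> \<open>By \<open>12 * g \<le> \<beta>\<close> the commutator takes at most half of
    \<open>\<beta> * norm (R v)\<close>, which is absorbed on the left.\<close>
  also have "6 * g * norm (v + R v) \<le> \<beta> / 2 * (norm v + norm (R v))"
    using g by (intro mult_mono norm_triangle_ineq) auto
  finally have "\<beta> / 2 * norm (R v) \<le> \<beta> / 2 * norm v + (1 + g) ^ N * norm f"
    by (simp add: algebra_simps)
  then have "2 / \<beta> * (\<beta> / 2 * norm (R v)) \<le> 2 / \<beta> * (\<beta> / 2 * norm v + (1 + g) ^ N * norm f)"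
    using \<beta> by (intro mult_left_mono) auto
  then have "norm (R v) \<le> norm v + 2 / \<beta> * (1 + g) ^ N * norm f"
    using \<beta> by (simp add: algebra_simps)
  then show ?thesis by (simp add: R_def \<rho>_def f_def)
qed

text \<open>Both ends of a removed bond carry at least the weight \<theta>, so the removed terms are
  bounded by the weighted vector divided by \<theta>. The exponent \<open>N - 1\<close> allows for
  the neighbour of a site of height \<open>N\<close>.\<close>

lemma hop_decoupling:
  fixes i :: "'d::finite" and h :: "int \<Rightarrow> nat"
  assumes a: "\<And>j. \<bar>a j\<bar> \<le> 3" and h: "\<And>j. h j \<le> N"
    and P: "\<And>j. P j \<Longrightarrow> h j \<ge> N - 1 \<and> h (j + 1) \<ge> N - 1" and g: "g > 0" and N: "N > 1"
  shows "norm (hop a i v - hop (\<lambda>j. if P j then 0 else a j) i v)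
     \<le> 6 / ((1 + g) ^ (N - 1) - 1) * norm (wshift (\<lambda>n. (1 + g) ^ h (n $ i) - 1) (\<lambda>n. n) v)"
proof -
  define \<theta> where "\<theta> = (1 + g) ^ (N - 1) - 1"
  have \<theta>: "\<theta> > 0" using g N by (simp add: \<theta>_def one_less_power)
  define \<rho> where "\<rho> = (\<lambda>j. (1 + g) ^ h j - 1)"
  have \<rho>: "0 \<le> \<rho> j" "\<rho> j \<le> (1 + g) ^ N" for j
  proof -
    have "(1 + g) ^ h j \<le> (1 + g) ^ N" using g h by (intro power_increasing) auto
    then show "\<rho> j \<le> (1 + g) ^ N" unfolding \<rho>_def by linarith
  qed (use g in \<open>simp add: \<rho>_def\<close>)
  have b\<rho>: "bounded (range (\<lambda>n :: int ^ 'd. \<rho> (n $ i)))"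
    by (rule bounded_range_abs[of _ "(1 + g) ^ N"]) (use \<rho> in auto)
  have inj: "inj (\<lambda>n :: int ^ 'd. n)" by simp
  define R where "R = wshift (\<lambda>n :: int ^ 'd. \<rho> (n $ i)) (\<lambda>n. n)"
  have eR [simp]: "entry (R u) n = \<rho> (n $ i) *\<^sub>R entry u n" for u n
    unfolding R_def by (rule entry_wshift[OF inj b\<rho>])
  define c where "c = (\<lambda>j. if P j then a j else 0)"
  have P\<rho>: "\<theta> \<le> \<rho> j" "\<theta> \<le> \<rho> (j + 1)" if "P j" for j
    using P[OF that] g by (auto simp: \<theta>_def \<rho>_def intro!: power_increasing)
  have c: "\<bar>c j\<bar> * r \<le> 3 / \<theta> * (\<rho> j * r)" "\<bar>c j\<bar> * r \<le> 3 / \<theta> * (\<rho> (j + 1) * r)" if "r \<ge> 0" for j r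
  proof -
    have "\<bar>c j\<bar> \<le> 3 / \<theta> * \<rho> j" "\<bar>c j\<bar> \<le> 3 / \<theta> * \<rho> (j + 1)"
    proof -
      have "3 \<le> 3 / \<theta> * \<rho> j \<and> 3 \<le> 3 / \<theta> * \<rho> (j + 1)" if "P j"
        using P\<rho>[OF that] \<theta> by (simp add: field_simps)
      then show "\<bar>c j\<bar> \<le> 3 / \<theta> * \<rho> j" "\<bar>c j\<bar> \<le> 3 / \<theta> * \<rho> (j + 1)"
        using a[of j] \<theta> \<rho>(1)[of j] \<rho>(1)[of "j + 1"] by (auto simp: c_def)
    qed
    then show "\<bar>c j\<bar> * r \<le> 3 / \<theta> * (\<rho> j * r)" "\<bar>c j\<bar> * r \<le> 3 / \<theta> * (\<rho> (j + 1) * r)"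
      using that by (metis mult.assoc mult_right_mono)+
  qed
  have bc: "bounded (range (\<lambda>n :: int ^ 'd. c (n $ i)))" "bounded (range (\<lambda>n :: int ^ 'd. c (n $ i - 1)))"
    using a by (auto simp: c_def bounded_iff intro!: exI[of _ 3])
  have ba: "bounded (range a)" "bounded (range (\<lambda>j. if P j then 0 else a j))"
    using a by (auto simp: bounded_iff intro!: exI[of _ 3])
  have "hop a i v - hop (\<lambda>j. if P j then 0 else a j) i v =
     wshift (\<lambda>n. c (n $ i)) (\<lambda>n. n + axis i 1) v + wshift (\<lambda>n. c (n $ i - 1)) (\<lambda>n. n + axis i (- 1)) v"
  proof (rule l2_eqI)
    fix n
    show "entry (hop a i v - hop (\<lambda>j. if P j then 0 else a j) i v) n =
        entry (wshift (\<lambda>n. c (n $ i)) (\<lambda>n. n + axis i 1) v + wshift (\<lambda>n. c (n $ i - 1)) (\<lambda>n. n + axis i (- 1)) v) n"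
      by (simp add: entry_hop[OF ba(1)] entry_hop[OF ba(2)] entry_wshift[OF inj_translation bc(1)] entry_wshift[OF inj_translation bc(2)],
          simp add: c_def)
  qed
  also have "norm \<dots> \<le> 3 / \<theta> * norm (R v) + 3 / \<theta> * norm (R v)"
  proof (intro norm_triangle_le add_mono)
    show "norm (wshift (\<lambda>n. c (n $ i)) (\<lambda>n. n + axis i 1) v) \<le> 3 / \<theta> * norm (R v)"
    proof (rule norm_le_entrywise[OF inj_translation])
      show "norm (entry (wshift (\<lambda>n. c (n $ i)) (\<lambda>n. n + axis i 1) v) n) \<le> 3 / \<theta> * norm (entry (R v) (n + axis i 1))" for n
        using c(2)[of "norm (entry v (n + axis i 1))" "n $ i"] \<rho>(1)[of "n $ i + 1"]
        by (simp add: entry_wshift[OF inj_translation bc(1)])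
    qed (use \<theta> in simp)
    show "norm (wshift (\<lambda>n. c (n $ i - 1)) (\<lambda>n. n + axis i (- 1)) v) \<le> 3 / \<theta> * norm (R v)"
    proof (rule norm_le_entrywise[OF inj_translation])
      show "norm (entry (wshift (\<lambda>n. c (n $ i - 1)) (\<lambda>n. n + axis i (- 1)) v) n) \<le> 3 / \<theta> * norm (entry (R v) (n + axis i (- 1)))" for n
        using c(1)[of "norm (entry v (n + axis i (- 1)))" "n $ i - 1"] \<rho>(1)[of "n $ i - 1"]
        by (simp add: entry_wshift[OF inj_translation bc(2)])
    qed (use \<theta> in simp)
  qed
  finally show ?thesis by (simp add: R_def \<rho>_def \<theta>_def)
qed

section \<open>Moving an energy into a gap\<close>

lemma periodic_multiple:
  fixes a :: "int \<Rightarrow> 'a"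
  assumes "\<And>j. a (j + int p) = a j"
  shows "a (j + int (p * k)) = a j"
proof (induction k)
  case (Suc k)
  then show ?case using assms[of "j + int (p * k)"] by (simp add: algebra_simps)
qed simp

text \<open>Cayley-Hamilton for a unimodular matrix, multiplied by \<open>D\<close> and
  traced.\<close>

lemma trace_mult_recurrence:
  fixes M D X :: "real ^ 2 ^ 2"
  assumes "det M = 1"
  shows "trace (D ** (M ** (M ** X))) = trace M * trace (D ** (M ** X)) - trace (D ** X)"
proof -
  have d: "M $ 1 $ 1 * M $ 2 $ 2 - M $ 1 $ 2 * M $ 2 $ 1 = 1" using assms by (simp add: det_2)
  have "M ** (M ** X) = trace M *\<^sub>R (M ** X) - X"
  proof (rule mat2_eqI)
  qed (simp_all add: mm_nth trace_2, (use d in algebra)+)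
  then have e: "(M ** (M ** X)) $ r $ s = trace M * (M ** X) $ r $ s - X $ r $ s" for r s by simp
  show ?thesis
    unfolding trace_2[of "D ** _"] mm_nth[of D] e by (simp add: algebra_simps)
qed

text \<open>With \<open>\<tau> = 2 cos \<theta>\<close>, the recurrence rotates by the angle \<open>\<theta>\<close>; at an approximate
  return time \<open>m\<close> the value \<open>t m\<close> is close to \<open>t 0\<close> or \<open>- t 0\<close>.\<close>

lemma elliptic_recurrence_returns:
  fixes t :: "nat \<Rightarrow> real"
  assumes rec: "\<And>m. t (Suc (Suc m)) = \<tau> * t (Suc m) - t m" and \<tau>: "\<bar>\<tau>\<bar> < 2" and t0: "t 0 > 2"
  shows "\<exists>m>0. \<bar>t m\<bar> > 2"
proof -
  define \<theta> where "\<theta> = arccos (\<tau> / 2)"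
  have cos\<theta>: "2 * cos \<theta> = \<tau>" using \<tau> by (simp add: \<theta>_def)
  have "0 < \<theta>" "\<theta> < pi" using arccos_lt_bounded[of "\<tau> / 2"] \<tau> by (auto simp: \<theta>_def)
  then have sin\<theta>: "sin \<theta> > 0" by (rule sin_gt_zero)
  have sol: "t m * sin \<theta> = t 0 * (sin \<theta> * cos (real m * \<theta>) - cos \<theta> * sin (real m * \<theta>)) + t 1 * sin (real m * \<theta>)" for m
  proof (induction m rule: induct_nat_012)
    case (ge2 m)
    have e: "real (Suc (Suc m)) * \<theta> = real (Suc m) * \<theta> + \<theta>" "real m * \<theta> = real (Suc m) * \<theta> - \<theta>"
      by (auto simp: algebra_simps)
    have s2: "sin (real (Suc (Suc m)) * \<theta>) = 2 * cos \<theta> * sin (real (Suc m) * \<theta>) - sin (real m * \<theta>)"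
      unfolding e(1) e(2) sin_add sin_diff by simp
    have c2: "cos (real (Suc (Suc m)) * \<theta>) = 2 * cos \<theta> * cos (real (Suc m) * \<theta>) - cos (real m * \<theta>)"
      unfolding e(1) e(2) cos_add cos_diff by simp
    have "t (Suc (Suc m)) * sin \<theta> = 2 * cos \<theta> * (t (Suc m) * sin \<theta>) - t m * sin \<theta>"
      unfolding rec cos\<theta> by (simp add: algebra_simps)
    then show ?case unfolding ge2 s2 c2 by (simp add: algebra_simps)
  qed simp_all
  \<comment> \<open>In the solution formula \<open>K\<close> times \<eta>, the modulus of the sine,
    bounds the loss against \<open>t 0 * sin \<theta>\<close>, and \<open>B\<close> is the margin
    above \<open>2 * sin \<theta>\<close>. Dirichlet approximation of \<theta> / pi makes \<eta>
    small enough.\<close>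
  define K where "K = t 0 * sin \<theta> + t 0 + \<bar>t 1\<bar>"
  have K: "K > 0" using t0 sin\<theta> by (simp add: K_def add_pos_nonneg)
  define B where "B = (t 0 - 2) * sin \<theta>"
  have B: "B > 0" using t0 sin\<theta> by (simp add: B_def)
  obtain N :: nat where N: "real N > pi * K / B" using reals_Archimedean2 by blast
  have "pi * K / B > 0" using K B by simp
  with N have N0: "N > 0" by (auto intro: gr0I)
  obtain p m where m: "0 < m" "\<bar>of_int m * (\<theta> / pi) - of_int p\<bar> < 1 / real N"
    using Dirichlet_approx[OF N0, of "\<theta> / pi"] by metis
  define k where "k = nat m"
  have k: "k > 0" "real k = of_int m" using m by (auto simp: k_def)
  define \<eta> where "\<eta> = \<bar>sin (real k * \<theta>)\<bar>"
  have "\<bar>real k * \<theta> - pi * of_int p\<bar> < pi / real N"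
  proof -
    have "real k * \<theta> - pi * of_int p = pi * (of_int m * (\<theta> / pi) - of_int p)"
      by (simp add: k algebra_simps)
    then have "\<bar>real k * \<theta> - pi * of_int p\<bar> = pi * \<bar>of_int m * (\<theta> / pi) - of_int p\<bar>"
      by (simp add: abs_mult)
    also have "\<dots> < pi * (1 / real N)" using m by (intro mult_strict_left_mono) auto
    finally show ?thesis by simp
  qed
  moreover have "\<bar>sin (real k * \<theta> - pi * of_int p)\<bar> = \<eta>"
    unfolding \<eta>_def sin_diff by (simp add: abs_mult)
  ultimately have \<eta>: "\<eta> < pi / real N" using abs_sin_x_le_abs_x[of "real k * \<theta> - pi * of_int p"] by linarith
  have \<eta>1: "0 \<le> \<eta>" "\<eta> \<le> 1" by (auto simp: \<eta>_def)
  have "\<eta> * K < (t 0 - 2) * sin \<theta>"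
  proof -
    have "\<eta> * K \<le> pi / real N * K" using \<eta> K by (intro mult_right_mono) auto
    also have "\<dots> < (t 0 - 2) * sin \<theta>"
      using N N0 B unfolding B_def[symmetric] by (simp add: pos_divide_less_eq mult.commute)
    finally show ?thesis .
  qed
  moreover have "t 0 * sin \<theta> * (1 - \<eta>) - (t 0 + \<bar>t 1\<bar>) * \<eta> \<le> \<bar>t k\<bar> * sin \<theta>"
  proof -
    let ?c = "cos (real k * \<theta>)" and ?s = "sin (real k * \<theta>)"
    have "?c\<^sup>2 \<le> \<bar>?c\<bar>" by (metis abs_cos_le_one abs_ge_zero mult_left_le power2_abs power2_eq_square)
    moreover have "?s\<^sup>2 \<le> \<eta>" unfolding \<eta>_def by (metis abs_sin_le_one abs_ge_zero mult_left_le power2_abs power2_eq_square)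
    ultimately have c1: "1 - \<eta> \<le> \<bar>?c\<bar>" using sin_cos_squared_add[of "real k * \<theta>"] by linarith
    have "t 0 * sin \<theta> * (1 - \<eta>) \<le> t 0 * sin \<theta> * \<bar>?c\<bar>"
      using c1 t0 sin\<theta> by (intro mult_left_mono) auto
    also have "\<dots> = \<bar>t 0 * sin \<theta> * ?c\<bar>" using t0 sin\<theta> by (simp add: abs_mult)
    also have "t 0 * sin \<theta> * ?c = t k * sin \<theta> + (t 0 * cos \<theta> - t 1) * ?s" unfolding sol by (simp add: algebra_simps)
    also have "\<bar>\<dots>\<bar> \<le> \<bar>t k * sin \<theta>\<bar> + \<bar>(t 0 * cos \<theta> - t 1) * ?s\<bar>" by (rule abs_triangle_ineq)
    also have "\<bar>(t 0 * cos \<theta> - t 1) * ?s\<bar> \<le> (t 0 + \<bar>t 1\<bar>) * \<eta>"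
    proof -
      have "\<bar>t 0 * cos \<theta>\<bar> \<le> t 0 * 1" unfolding abs_mult using t0 by (intro mult_mono) auto
      then have "\<bar>t 0 * cos \<theta> - t 1\<bar> \<le> t 0 + \<bar>t 1\<bar>" by linarith
      then show ?thesis unfolding abs_mult \<eta>_def by (intro mult_right_mono) auto
    qed
    finally show ?thesis using sin\<theta> by (simp add: abs_mult)
  qed
  ultimately have "2 * sin \<theta> < \<bar>t k\<bar> * sin \<theta>" by (simp add: K_def algebra_simps)
  then show ?thesis using sin\<theta> k by (auto intro!: exI[of _ k])
qed

lemma transfer_mat_mult_period:
  assumes per: "\<And>j. a (j + int q) = a j"
  shows "transfer_mat c x a 0 (m * q) = (((**) (transfer_mat c x a 0 q)) ^^ m) (mat 1)"
proof (induction m)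
  case (Suc m)
  have "transfer_mat c x a (0 + int (m * q)) q = transfer_mat c x a 0 q"
  proof (rule transfer_mat_cong)
    show "a (0 + int (m * q) + i) = a (0 + i)" for i
      using periodic_multiple[of a q i m, OF per] by (simp add: algebra_simps)
  qed
  then show ?case using transfer_mat_add[of c x a 0 "m * q" q] Suc by (simp add: add.commute)
qed simp

section \<open>Scaling one bond per period\<close>

definition scale_bonds :: "nat \<Rightarrow> real \<Rightarrow> (int \<Rightarrow> real) \<Rightarrow> int \<Rightarrow> real" where
  "scale_bonds p s a = (\<lambda>j. if int p dvd j then a j / s else a j)"

lemma scale_bonds_periodic:
  assumes per: "\<And>j. a (j + int q) = a j" and dvd: "q dvd p"
  shows "scale_bonds p s a (j + int p) = scale_bonds p s a j"
proof -
  obtain k where "p = q * k" using dvd by blast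
  then have "a (j + int p) = a j" using periodic_multiple[of a q j k, OF per] by simp
  then show ?thesis by (simp add: scale_bonds_def)
qed

lemma scale_bonds_close:
  assumes a: "0 < a j" "a j \<le> 2" and s: "1 < s" "s \<le> 1 + d"
  shows "0 < scale_bonds p s a j" "scale_bonds p s a j \<le> a j" "\<bar>scale_bonds p s a j - a j\<bar> \<le> 2 * d"
proof -
  have le: "a j / s \<le> a j" using a s by (simp add: pos_divide_le_eq)
  have "a j - a j / s = a j * ((s - 1) / s)" using s by (simp add: field_simps)
  also have "\<dots> \<le> 2 * (s - 1)" using a s by (intro mult_mono) (auto simp: pos_divide_le_eq)
  also have "\<dots> \<le> 2 * d" using s by simp
  finally have "a j - a j / s \<le> 2 * d" .
  then show "0 < scale_bonds p s a j" "scale_bonds p s a j \<le> a j" "\<bar>scale_bonds p s a j - a j\<bar> \<le> 2 * d"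
    using a s le by (auto simp: scale_bonds_def)
qed

text \<open>The scaled bond is the last of the sites 1 to \<open>p\<close>, so the diagonal factor
  comes out on the left; the rows of a step matrix scale inversely to each other.\<close>

lemma transfer_mat_scale_bonds:
  assumes "p > 0"
  shows "transfer_mat (\<lambda>r. r) x (scale_bonds p s a) 0 p = mat2 s 0 0 (1 / s) ** transfer_mat (\<lambda>r. r) x a 0 p"
proof -
  obtain k where k: "p = Suc k" using assms gr0_implies_Suc by blast
  have "transfer_mat (\<lambda>r. r) x (scale_bonds p s a) 0 k = transfer_mat (\<lambda>r. r) x a 0 k"
    by (rule transfer_mat_cong) (auto simp: scale_bonds_def k dest: zdvd_imp_le)
  moreover have "transfer_step (\<lambda>r. r) x (scale_bonds p s a) (1 + int k) = mat2 s 0 0 (1 / s) ** transfer_step (\<lambda>r. r) x a (1 + int k)"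
    by (rule mat2_eqI) (simp_all add: transfer_step_def mm_nth scale_bonds_def k)
  ultimately show ?thesis by (simp add: k matrix_mul_assoc add.commute)
qed

text \<open>Scaling one bond by \<open>1/s\<close> inserts the factor \<open>diag(s, 1/s)\<close>. If the transfer matrix over a
  long period is nearly \<open>\<plusminus>1\<close>, the trace becomes nearly \<open>\<plusminus>(s + 1/s)\<close>.\<close>

lemma exists_hyperbolic_perturbation:
  assumes q: "q > 0" and per: "\<And>j. a (j + int q) = a j" and a: "\<And>j. 0 < a j" "\<And>j. a j \<le> 2" and e: "\<epsilon> > 0"
  shows "\<exists>w p. p > 0 \<and> (\<forall>j. w (j + int p) = w j) \<and> (\<forall>j. 0 < w j \<and> \<bar>w j - a j\<bar> \<le> \<epsilon>) \<and> \<bar>poly (discriminant w p) x\<bar> > 2"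
proof -
  \<comment> \<open>At most two scalings are made, and each moves the weights by at most
    \<open>2 * d\<close>.\<close>
  define d where "d = \<epsilon> / 4"
  have d: "d > 0" using e by (simp add: d_def)
  define T where "T = (\<lambda>w p. transfer_mat (\<lambda>r. r) x w 0 p)"
  define M where "M = T a q"
  have fin: "finite {s. poly [:M $ 2 $ 2, c, M $ 1 $ 1:] s = 0}" if "c \<noteq> 0" for c
    using that by (intro poly_roots_finite) auto
  \<comment> \<open>The roots are the values of \<open>s\<close> for which the new trace would be
    exactly -2 or 2. The linear coefficient makes both polynomials nonzero whatever \<open>M\<close>
    is.\<close>
  define S where "S = {s. poly [:M $ 2 $ 2, 2, M $ 1 $ 1:] s = 0} \<union> {s. poly [:M $ 2 $ 2, - 2, M $ 1 $ 1:] s = 0}"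
  have "finite S" unfolding S_def by (rule finite_UnI[OF fin fin]) simp_all
  moreover have "infinite {1<..<1 + d}" using d by simp
  ultimately have "\<not> {1<..<1 + d} \<subseteq> S" using finite_subset by blast
  then obtain s where "s \<in> {1<..<1 + d}" "s \<notin> S" by blast
  then have s: "1 < s" "s < 1 + d"
    "poly [:M $ 2 $ 2, 2, M $ 1 $ 1:] s \<noteq> 0" "poly [:M $ 2 $ 2, - 2, M $ 1 $ 1:] s \<noteq> 0"
    unfolding S_def by (simp_all del: poly_pCons)
  define b where "b = scale_bonds q s a"
  have Tb: "T b q = mat2 s 0 0 (1 / s) ** M" unfolding T_def b_def M_def by (rule transfer_mat_scale_bonds[OF q])
  have b: "0 < b j" "b j \<le> 2" "\<bar>b j - a j\<bar> \<le> 2 * d" for j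
    using scale_bonds_close[where a = a and j = j and s = s and d = d and p = q, OF a(1) a(2) s(1) less_imp_le[OF s(2)]]
      a(2)[of j] unfolding b_def by auto
  have perb: "b (j + int q) = b j" for j unfolding b_def by (rule scale_bonds_periodic[where a = a, OF per]) simp_all
  have "trace (T b q) = s * M $ 1 $ 1 + M $ 2 $ 2 / s" by (simp add: Tb trace_2 mm_nth)
  then have st: "s * trace (T b q) = M $ 2 $ 2 + s * (s * M $ 1 $ 1)" using s by (simp add: algebra_simps)
  have "trace (T b q) \<noteq> 2" using st s(4) by (auto simp: algebra_simps)
  moreover have "trace (T b q) \<noteq> - 2" using st s(3) by (auto simp: algebra_simps)
  ultimately have "\<bar>trace (T b q)\<bar> \<noteq> 2" by linarith
  then consider "\<bar>trace (T b q)\<bar> > 2" | "\<bar>trace (T b q)\<bar> < 2" by linarith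
  then show ?thesis
  proof cases
    case 1
    have "2 * d \<le> \<epsilon>" using e by (simp add: d_def)
    then have "0 < b j \<and> \<bar>b j - a j\<bar> \<le> \<epsilon>" for j using b[of j] by linarith
    then show ?thesis using 1 q perb by (intro exI[of _ b] exI[of _ q]) (auto simp: T_def poly_discriminant)
  next
    case 2
    define N where "N = T b q"
    define r where "r = 1 + d"
    have r: "r > 1" using d by (simp add: r_def)
    define D where "D = mat2 r 0 0 (1 / r)"
    \<comment> \<open>In the elliptic case another bond is scaled, once in \<open>m\<close> periods,
      and \<open>t m\<close> is the resulting trace. As \<open>t 0 = r + 1 / r\<close> exceeds 2,
      the recurrence yields a positive \<open>m\<close> with trace beyond 2 in modulus.\<close>
    define t where "t = (\<lambda>m. trace (D ** (((**) N ^^ m) (mat 1))))"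
    have "b j \<noteq> 0" for j using b(1)[of j] by simp
    then have detN: "det N = 1" unfolding N_def T_def by (intro det_transfer_mat) simp
    have "t (Suc (Suc m)) = trace N * t (Suc m) - t m" for m
      using trace_mult_recurrence[OF detN, of D "((**) N ^^ m) (mat 1)"] by (simp add: t_def)
    moreover have "t 0 > 2"
    proof -
      have "(r - 1)\<^sup>2 > 0" using r by simp
      then have "r * r + 1 > 2 * r" by (simp add: power2_eq_square algebra_simps)
      then have "r + 1 / r > 2" using r by (simp add: field_simps)
      then show ?thesis by (simp add: t_def D_def trace_2)
    qed
    ultimately obtain m where m: "m > 0" "\<bar>t m\<bar> > 2" using elliptic_recurrence_returns[of t "trace N"] 2 N_def by auto
    define p where "p = m * q"
    have p: "p > 0" using m q by (simp add: p_def)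
    define w where "w = scale_bonds p r b"
    have "T w p = D ** T b p" unfolding T_def w_def D_def by (rule transfer_mat_scale_bonds[OF p])
    also have "T b p = ((**) N ^^ m) (mat 1)" unfolding T_def p_def N_def by (rule transfer_mat_mult_period[where a = b, OF perb])
    finally have "trace (T w p) = t m" by (simp add: t_def)
    then have "\<bar>poly (discriminant w p) x\<bar> > 2" using m by (simp add: T_def poly_discriminant)
    moreover have "w (j + int p) = w j" for j
      unfolding w_def by (rule scale_bonds_periodic[where a = b, OF perb]) (simp add: p_def)
    moreover have "0 < w j \<and> \<bar>w j - a j\<bar> \<le> \<epsilon>" for j
    proof -
      have "0 < w j" "\<bar>w j - b j\<bar> \<le> 2 * d"
        using scale_bonds_close[where a = b and j = j and s = r and d = d and p = p, OF b(1) b(2) r]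
        unfolding w_def by (auto simp: r_def)
      moreover have "4 * d = \<epsilon>" by (simp add: d_def)
      ultimately show ?thesis using b(3)[of j] by linarith
    qed
    ultimately show ?thesis using p by blast
  qed
qed

section \<open>Lower bounds uniform in the energy\<close>

lemma bounded_range_close:
  fixes a w :: "int \<Rightarrow> real"
  assumes "bounded (range a)" "\<And>j. \<bar>w j - a j\<bar> \<le> e"
  shows "bounded (range w)"
proof -
  obtain C where C: "\<And>j. \<bar>a j\<bar> \<le> C" using assms(1) by (auto simp: bounded_iff)
  have "\<bar>w j\<bar> \<le> C + e" for j using C[of j] assms(2)[of j] by linarith
  then show ?thesis by (rule bounded_range_abs)
qed

lemma uniform_bounded_below:
  fixes F :: "'i::finite \<Rightarrow> 'h::real_normed_vector \<Rightarrow> 'h"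
  assumes "\<And>i. bounded_below_at (F i) x"
  shows "\<exists>c>0. \<forall>i v. c * norm v \<le> norm (F i v - x *\<^sub>R v)"
proof -
  obtain c where c: "\<And>i. c i > 0" "\<And>i v. c i * norm v \<le> norm (F i v - x *\<^sub>R v)"
    using assms unfolding bounded_below_at_def by metis
  have "Min (range c) * norm v \<le> norm (F i v - x *\<^sub>R v)" for i v
    by (rule order_trans[OF mult_right_mono c(2)]) auto
  then show ?thesis using c(1) by (intro exI[of _ "Min (range c)"]) auto
qed

text \<open>A lower bound \<open>c x\<close> at \<open>x\<close> leaves \<open>c x / 2\<close> on
  the ball of radius \<open>c x / 2\<close>; compactness selects finitely many balls, and the
  product of the periods serves as a common one.\<close>

lemma exists_hyperbolic_family:
  fixes i0 :: "'d::finite"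
  assumes q: "q > 0" and per: "\<And>j. a (j + int q) = a j" and a: "\<And>j. 0 < a j" "\<And>j. a j \<le> 2" and e: "\<epsilon> > 0"
  shows "\<exists>(s::nat) W P \<beta>. P > 0 \<and> \<beta> > 0 \<and> (\<forall>j<s. (\<forall>n. W j (n + int P) = W j n \<and> \<bar>W j n - a n\<bar> \<le> \<epsilon>)) \<and>
     (\<forall>x. \<bar>x\<bar> \<le> R \<longrightarrow> (\<exists>j<s. \<forall>(i::'d) v. \<beta> * norm v \<le> norm (hop (W j) i v - x *\<^sub>R v)))"
proof -
  have "\<bar>a j\<bar> \<le> 2" for j using a(1)[of j] a(2)[of j] by linarith
  then have ba: "bounded (range a)" by (rule bounded_range_abs)
  have "\<exists>w p c. p > 0 \<and> c > 0 \<and> (\<forall>j. w (j + int p) = w j \<and> \<bar>w j - a j\<bar> \<le> \<epsilon>) \<and>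
     (\<forall>(i::'d) v. c * norm v \<le> norm (hop w i v - x *\<^sub>R v))" for x
  proof -
    obtain w p where w: "p > 0" "\<And>j. w (j + int p) = w j" "\<And>j. 0 < w j" "\<And>j. \<bar>w j - a j\<bar> \<le> \<epsilon>"
      "\<bar>poly (discriminant w p) x\<bar> > 2"
      using exists_hyperbolic_perturbation[where a = a and q = q and x = x, OF q per a e] by blast
    have "bounded_below_at (hop w i) x" for i :: 'd
      by (rule hop_bounded_below_discriminant[OF bounded_range_close[OF ba w(4)] _ w(2) w(5)]) (use w(3) in \<open>simp add: less_imp_neq[symmetric]\<close>)
    then have "\<And>i :: 'd. bounded_below_at (hop w i) x" .
    then have "\<exists>c>0. \<forall>(i::'d) v. c * norm v \<le> norm (hop w i v - x *\<^sub>R v)"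
      by (rule uniform_bounded_below)
    then obtain c where "c > 0" "\<forall>(i::'d) v. c * norm v \<le> norm (hop w i v - x *\<^sub>R v)"
      by blast
    then show ?thesis using w(1,2,4) by (intro exI[of _ w] exI[of _ p] exI[of _ c]) simp
  qed
  then obtain w p c where w: "\<And>x. p x > 0" "\<And>x. c x > 0" "\<And>x j. w x (j + int (p x)) = w x j"
     "\<And>x j. \<bar>w x j - a j\<bar> \<le> \<epsilon>" "\<And>x (i::'d) v. c x * norm v \<le> norm (hop (w x) i v - x *\<^sub>R v)"
    by metis
  have cover: "{-R..R} \<subseteq> (\<Union>x\<in>{-R..R}. ball x (c x / 2))" using w(2) by force
  obtain X where X: "X \<subseteq> {-R..R}" "finite X" "{-R..R} \<subseteq> (\<Union>x\<in>X. ball x (c x / 2))"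
    using compactE_image[OF compact_Icc _ cover] by (metis open_ball)
  obtain xs where xs: "set xs = X" using X(2) finite_list by blast
  define P where "P = (\<Prod>x\<in>X. p x)"
  \<comment> \<open>The inserted 1 gives the minimum a value when no point is selected.\<close>
  define \<beta> where "\<beta> = Min (insert 1 ((\<lambda>x. c x / 2) ` X))"
  have \<beta>: "\<beta> > 0" unfolding \<beta>_def using X(2) w(2) by (subst Min_gr_iff) auto
  have \<beta>le: "\<beta> \<le> c x / 2" if "x \<in> X" for x unfolding \<beta>_def using X(2) that by (intro Min_le) auto
  have wP: "w x (n + int P) = w x n" if "x \<in> X" for x n
  proof -
    have "p x dvd P" unfolding P_def using that X(2) by (rule dvd_prodI[rotated])
    then obtain k where "P = p x * k" by blast
    then show ?thesis using periodic_multiple[of "w x" "p x" n k, OF w(3)] by simp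
  qed
  have "\<exists>j<length xs. \<forall>(i::'d) v. \<beta> * norm v \<le> norm (hop (w (xs ! j)) i v - y *\<^sub>R v)" if y: "\<bar>y\<bar> \<le> R" for y
  proof -
    have "y \<in> {-R..R}" using y by auto
    then obtain x where x: "x \<in> X" "y \<in> ball x (c x / 2)" using X(3) by blast
    obtain j where j: "j < length xs" "xs ! j = x" using x xs by (auto simp: in_set_conv_nth)
    have "\<beta> * norm v \<le> norm (hop (w x) i v - y *\<^sub>R v)" for i :: 'd and v
    proof -
      have "(c x - 0 - c x / 2) * norm v \<le> norm (hop (w x) i v - y *\<^sub>R v)"
        by (rule bounded_below_at_perturb[OF w(5)]) (use x in \<open>auto simp: dist_real_def abs_minus_commute\<close>)
      moreover have "\<beta> * norm v \<le> (c x - 0 - c x / 2) * norm v" using \<beta>le[OF x(1)] by (intro mult_right_mono) auto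
      ultimately show ?thesis by linarith
    qed
    then show ?thesis using j by auto
  qed
  moreover have "P > 0" using w(1) by (simp add: P_def prod_pos)
  moreover have "xs ! j \<in> X" if "j < length xs" for j using xs that nth_mem by blast
  ultimately show ?thesis using \<beta> wP w(4)
    by (intro exI[of _ "length xs"], intro exI[of _ "\<lambda>j. w (xs ! j)"], intro exI[of _ P] exI[of _ \<beta>]) auto
qed

lemma eventually_cover_count:
  fixes g \<kappa> c :: real
  assumes "g > 0" "\<kappa> > 0" "c > 0"
  shows "eventually (\<lambda>n::nat. 12 / ((1 + g) ^ n - 1) < \<kappa> \<and> c * real (Suc n) \<le> (12 / ((1 + g) ^ n - 1)) powr (- \<kappa>)) sequentially"
proof -
  have "eventually (\<lambda>n::nat. 12 / ((1 + g) ^ n - 1) < \<kappa>) sequentially" using assms by real_asymp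
  moreover have "eventually (\<lambda>n::nat. c * real (Suc n) \<le> (12 / ((1 + g) ^ n - 1)) powr (- \<kappa>)) sequentially"
    using assms by real_asymp
  ultimately show ?thesis by eventually_elim auto
qed

section \<open>Periodic chains with small spectrum\<close>

text \<open>There will be \<open>s\<close> cut chains with \<open>2 * s * N\<close> points each:
  linear in \<open>N\<close>, while the radius decays exponentially, so every negative power of the
  radius eventually exceeds the count.\<close>

lemma block_count_exists:
  fixes g \<kappa> :: real
  assumes "g > 0" "\<kappa> > 0" "s > 0" "P > (0::nat)"
  obtains N where "P dvd N" "N \<ge> 2" "N \<ge> k" "12 / ((1 + g) ^ (N - 1) - 1) < \<kappa>"
    "real s * real (s * (2 * N)) \<le> (12 / ((1 + g) ^ (N - 1) - 1)) powr (- \<kappa>)"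
proof -
  have "2 * real s * real s > 0" using assms by simp
  from eventually_cover_count[OF assms(1,2) this] obtain n0 where n0: "\<And>n. n \<ge> n0 \<Longrightarrow>
      12 / ((1 + g) ^ n - 1) < \<kappa> \<and> 2 * real s * real s * real (Suc n) \<le> (12 / ((1 + g) ^ n - 1)) powr (- \<kappa>)"
    unfolding eventually_sequentially by blast
  define N where "N = P * (n0 + k + 2)"
  have "1 * (n0 + k + 2) \<le> N" unfolding N_def using assms by (intro mult_right_mono) auto
  then have N: "N \<ge> 2" "N \<ge> k" "N - 1 \<ge> n0" "Suc (N - 1) = N" by auto
  show ?thesis
    using that[of N] N n0[OF N(3)] by (simp add: N_def algebra_simps)
qed

text \<open>Concatenate long blocks of the weights of a hyperbolic family. At each energy, approximate
  eigenvectors are exponentially small in the middle of some kind of block, where the chain may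
  then be cut. The pieces have at most one eigenvalue per site.\<close>

lemma exists_small_cover:
  assumes q: "q > 0" and per: "\<And>j. a (j + int q) = a j" and a: "\<And>j. 1 / 2 \<le> a j" "\<And>j. a j \<le> 2"
    and e: "0 < \<epsilon>" "\<epsilon> \<le> 1 / 4" and \<kappa>: "\<kappa> > 0"
  shows "\<exists>b p C \<delta> \<beta>. p > 0 \<and> k \<le> p \<and> (\<forall>n. b (n + int p) = b n \<and> \<bar>b n - a n\<bar> \<le> \<epsilon>) \<and>
    finite C \<and> 0 < \<delta> \<and> \<delta> < \<kappa> \<and> real (card C) \<le> \<delta> powr (- \<kappa>) \<and> \<beta> > 0 \<and>
    (\<forall>(i::'d::finite) x v. (\<forall>c\<in>C. \<delta> \<le> \<bar>x - c\<bar>) \<longrightarrow> \<beta> * norm v \<le> norm (hop b i v - x *\<^sub>R v))"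
proof -
  have a2: "\<bar>a j\<bar> \<le> 2" for j using a[of j] by linarith
  have "0 < a j" for j using a(1)[of j] by linarith
  \<comment> \<open>The new weights stay below 3, so the operator has norm at most 6 and energies
    beyond 7 have the lower bound 1; the family is needed for the rest.\<close>
  from exists_hyperbolic_family[where ?'d = 'd and a = a and q = q and R = 7, OF q per this a(2) e(1)]
  obtain s :: nat and W P \<beta> where P: "P > 0" and \<beta>: "\<beta> > 0"
    and W: "\<And>j n. j < s \<Longrightarrow> W j (n + int P) = W j n" "\<And>j n. j < s \<Longrightarrow> \<bar>W j n - a n\<bar> \<le> \<epsilon>"
    and hyp: "\<And>x. \<bar>x\<bar> \<le> 7 \<Longrightarrow> \<exists>j<s. \<forall>(i::'d) v. \<beta> * norm v \<le> norm (hop (W j) i v - x *\<^sub>R v)"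
    by blast
  have s: "s > 0" using hyp[of 0] by auto
  define g where "g = \<beta> / 12"
  have g: "g > 0" "12 * g \<le> \<beta>" using \<beta> by (auto simp: g_def)
  obtain N where N: "P dvd N" "N \<ge> 2" "N \<ge> k" "12 / ((1 + g) ^ (N - 1) - 1) < \<kappa>"
    "real s * real (s * (2 * N)) \<le> (12 / ((1 + g) ^ (N - 1) - 1)) powr (- \<kappa>)"
    using block_count_exists[OF g(1) \<kappa> s P, where k = k] by blast
  \<comment> \<open>In one period each of the \<open>s\<close> kinds of weight fills a block of
    length \<open>2 * N\<close>. As \<open>P\<close> divides \<open>N\<close>, the period of every
    \<open>W j\<close> divides \<open>p\<close>.\<close>
  define p where "p = s * (2 * N)"
  have "1 * (1 * N) \<le> p" unfolding p_def using s by (intro mult_mono) auto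
  then have p: "p > 0" "k \<le> p" using N by auto
  have ip: "int p > 0" using p by simp
  define r where "r = (\<lambda>n. n mod int p)"
  have r: "0 \<le> r n" "r n < int p" for n using ip by (simp_all add: r_def)
  have rsuc: "r (n + 1) = (if r n = int p - 1 then 0 else r n + 1)" for n
  proof -
    have "r (n + 1) = (r n + 1) mod int p" by (simp add: r_def mod_add_left_eq)
    then show ?thesis using r[of n] by (auto simp: mod_pos_pos_trivial)
  qed
  have rper: "r (n + int p) = r n" for n by (simp add: r_def)
  define idx where "idx = (\<lambda>n. nat (r n div int (2 * N)))"
  have idx: "idx n < s" for n
  proof -
    have "r n div int (2 * N) * int (2 * N) \<le> r n" using N(2) by (simp add: minus_mod_eq_div_mult[symmetric] del: of_nat_mult)
    also have "r n < int s * int (2 * N)" using r(2)[of n] by (simp add: p_def)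
    finally have "r n div int (2 * N) < int s" by (simp only: mult_less_cancel_right)
    moreover have "0 \<le> r n div int (2 * N)" using r(1)[of n] N(2) by (simp add: pos_imp_zdiv_nonneg_iff)
    ultimately show ?thesis by (simp add: idx_def nat_less_iff)
  qed
  define b where "b = (\<lambda>n. W (idx n) n)"
  have b_close: "\<bar>b n - a n\<bar> \<le> \<epsilon>" for n unfolding b_def by (rule W(2)[OF idx])
  have b_pos: "0 < b n" "\<bar>b n\<bar> \<le> 3" for n using b_close[of n] a[of n] e by linarith+
  have b_per: "b (n + int p) = b n" for n
  proof -
    have "P dvd p" using N(1) by (simp add: p_def)
    then obtain t where "p = P * t" by blast
    then have "W j (n + int p) = W j n" if "j < s" for j
      using periodic_multiple[of "W j" P n t] W(1)[OF that] by simp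
    moreover have "idx (n + int p) = idx n" by (simp add: idx_def rper)
    ultimately show ?thesis unfolding b_def using idx by simp
  qed
  have bb: "bounded (range b)" by (rule bounded_range_abs[OF b_pos(2)])
  \<comment> \<open>The middle of block \<open>j\<close>, at distance \<open>N\<close> from both
    ends.\<close>
  define m where "m = (\<lambda>j. int ((2 * j + 1) * N))"
  define cut where "cut = (\<lambda>j n. if r n = m j then 0 else b n)"
  have mj: "0 \<le> m j" "m j + int N \<le> int p" if "j < s" for j
  proof -
    have "(2 * j + 1) * N + N = (j + 1) * (2 * N)" by (simp add: algebra_simps)
    also have "\<dots> \<le> p" unfolding p_def using that by (intro mult_right_mono) auto
    finally show "m j + int N \<le> int p" unfolding m_def by (simp only: of_nat_add[symmetric] of_nat_le_iff)
  qed (simp add: m_def)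
  have bcut: "bounded (range (cut j))" for j
    by (rule bounded_range_abs[of _ 3]) (use b_pos in \<open>simp add: cut_def\<close>)
  define D where "D = (\<lambda>j. block_poly (cut j) (m j) p)"
  define C where "C = (\<Union>j<s. {y. poly (D j) y = 0})"
  have D0: "D j \<noteq> 0" "degree (D j) = p" for j using degree_block_poly by (auto simp: D_def)
  have finC: "finite C" unfolding C_def by (intro finite_UN_I poly_roots_finite D0) auto
  have "card C \<le> (\<Sum>j<s. card {y. poly (D j) y = 0})" unfolding C_def by (intro card_UN_le) auto
  also have "\<dots> \<le> (\<Sum>j<s. p)" using card_poly_roots_bound[OF D0(1)] D0(2) by (intro sum_mono) metis
  finally have "card C \<le> s * p" by simp
  then have cardC: "real (card C) \<le> real s * real p" by (metis of_nat_le_iff of_nat_mult)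
  define \<theta> where "\<theta> = (1 + g) ^ (N - 1) - 1"
  have \<theta>: "\<theta> > 0" using g N by (simp add: \<theta>_def one_less_power)
  define B where "B = 2 / \<beta> * (1 + g) ^ N"
  have B: "B > 0" using \<beta> g by (simp add: B_def)
  \<comment> \<open>If \<open>norm f < \<beta>' * norm v\<close>, the terms in \<open>norm f\<close>
    of the estimate below add up to at most \<open>norm v / \<theta>\<close>. The 1 serves the
    energies beyond 7.\<close>
  define \<beta>' where "\<beta>' = min 1 ((1 / \<theta>) / (1 + 6 / \<theta> * B))"
  have den: "1 + 6 / \<theta> * B > 0" using B \<theta> by (simp add: add_pos_pos)
  have \<beta>': "\<beta>' > 0" using \<theta> den by (simp add: \<beta>'_def)
  have \<beta>'le: "\<beta>' * (1 + 6 / \<theta> * B) \<le> 1 / \<theta>"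
  proof -
    have "\<beta>' \<le> (1 / \<theta>) / (1 + 6 / \<theta> * B)" by (simp add: \<beta>'_def)
    then show ?thesis using den by (simp only: pos_le_divide_eq)
  qed
  have main: "\<beta>' * norm v \<le> norm (hop b i v - x *\<^sub>R v)" if far: "\<forall>c\<in>C. 12 / \<theta> \<le> \<bar>x - c\<bar>" for i :: 'd and x v
  proof (cases "\<bar>x\<bar> \<le> 7")
    case False
    have "norm (hop b i v) \<le> 2 * 3 * norm v" for v by (rule norm_hop_le[OF b_pos(2)])
    then have "(\<bar>x\<bar> - 2 * 3) * norm v \<le> norm (hop b i v - x *\<^sub>R v)" by (rule bounded_below_at_large)
    moreover have "\<beta>' * norm v \<le> (\<bar>x\<bar> - 2 * 3) * norm v"
      using False by (intro mult_right_mono) (auto simp: \<beta>'_def)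
    ultimately show ?thesis by linarith
  next
    case True
    then obtain j where j: "j < s" "\<And>(i::'d) v. \<beta> * norm v \<le> norm (hop (W j) i v - x *\<^sub>R v)"
      using hyp by blast
    \<comment> \<open>A tent of slope one with peak \<open>N\<close> in the middle of block
      \<open>j\<close>; truncation by \<open>nat\<close> makes it 0 off the block.\<close>
    define h where "h = (\<lambda>n. nat (min (r n - (m j - int N)) (m j + int N - r n)))"
    have mN: "m j - int N = int j * int (2 * N)" by (simp add: m_def algebra_simps)
    then have mN0: "m j - int N \<ge> 0" by simp
    have mU: "m j + int N \<le> int p" by (rule mj(2)[OF j(1)])
    have h1: "h (n + 1) \<le> h n + 1" and h2: "h n \<le> h (n + 1) + 1" for n
      using rsuc[of n] r[of n] mN0 mU by (auto simp: h_def split: if_splits)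
    have h3: "h n \<le> N" for n by (simp add: h_def min_def) linarith
    have agree: "b n = W j n" if "h n > 0 \<or> h (n + 1) > 0" for n
    proof -
      have "m j - int N \<le> r n \<and> r n < m j + int N"
        using that rsuc[of n] r[of n] mN0 mU by (auto simp: h_def split: if_splits)
      then have "r n div int (2 * N) = int j"
        using mN by (intro int_div_pos_eq[of _ _ _ "r n - (m j - int N)"]) auto
      then show ?thesis by (simp add: b_def idx_def)
    qed
    have mid: "h n \<ge> N - 1 \<and> h (n + 1) \<ge> N - 1" if "r n = m j" for n
      using that rsuc[of n] mU N(2) by (auto simp: h_def)
    have bW: "bounded (range (W j))"
      by (rule bounded_range_close[OF bounded_range_abs[of a 2, OF a2] W(2)[OF j(1)]])
    define f where "f = hop b i v - x *\<^sub>R v"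
    let ?R = "wshift (\<lambda>n. (1 + g) ^ h (n $ i) - 1) (\<lambda>n. n) v"
    show ?thesis
    proof (rule ccontr)
      assume "\<not> ?thesis"
      then have f: "norm f < \<beta>' * norm v" by (simp add: f_def)
      then have v0: "v \<noteq> 0" using norm_ge_zero[of f] by auto
      have R: "norm ?R \<le> norm v + B * norm f"
        unfolding B_def f_def
        by (rule hop_localization[where a = b and w = "W j" and h = h, OF b_pos(2) bW h1 h2 h3 agree \<beta> j(2) g])
      have "norm (hop b i v - hop (cut j) i v) \<le> 6 / ((1 + g) ^ (N - 1) - 1) * norm ?R"
        unfolding cut_def by (rule hop_decoupling[where a = b and h = h, OF b_pos(2) h3 mid g(1)]) (use N in auto)
      then have dec: "norm (hop b i v - hop (cut j) i v) \<le> 6 / \<theta> * norm ?R" by (simp add: \<theta>_def)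
      have "hop (cut j) i v - x *\<^sub>R v = f - (hop b i v - hop (cut j) i v)" by (simp add: f_def)
      then have "norm (hop (cut j) i v - x *\<^sub>R v) \<le> norm f + norm (hop b i v - hop (cut j) i v)"
        by (simp only: norm_triangle_ineq4)
      also have "\<dots> \<le> norm f + 6 / \<theta> * (norm v + B * norm f)"
        using dec mult_left_mono[OF R, of "6 / \<theta>"] \<theta> by simp
      also have "\<dots> = (1 + 6 / \<theta> * B) * norm f + 6 / \<theta> * norm v" by (simp add: algebra_simps)
      also have "\<dots> \<le> (1 + 6 / \<theta> * B) * (\<beta>' * norm v) + 6 / \<theta> * norm v"
        using f den by (intro add_right_mono mult_left_mono) auto
      also have "(1 + 6 / \<theta> * B) * (\<beta>' * norm v) \<le> 1 / \<theta> * norm v"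
        using mult_right_mono[OF \<beta>'le, of "norm v"] by (simp only: mult_ac norm_ge_zero)
      \<comment> \<open>One part of the seven comes from the residual and six from the cut; the sum
        stays below the distance 12 / \<theta> assumed from the points of \<open>C\<close>.\<close>
      finally have le: "norm (hop (cut j) i v - x *\<^sub>R v) \<le> 7 / \<theta> * norm v" by (simp add: field_simps)
      obtain y where y: "\<bar>y - x\<bar> \<le> 7 / \<theta>" "\<not> bounded_below_at (hop (cut j) i) y"
        using approx_eigenvalue_imp_spectrum[OF symop_hop[OF bcut] v0 le] by blast
      have "poly (D j) y = 0"
        unfolding D_def
      proof (rule hop_decoupled_spectrum[OF bcut p(1) _ _ _ y(2)])
        show "cut j (n + int p) = cut j n" for n by (simp add: cut_def rper b_per)
        have rm: "r (m j) = m j" using mj[OF j(1)] N(2) by (simp add: r_def mod_pos_pos_trivial)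
        show "cut j (m j) = 0" by (simp add: cut_def rm)
        fix t assume t: "0 < t" "t < int p"
        have "r (m j + t) \<noteq> m j"
        proof
          assume "r (m j + t) = m j"
          then have "(m j + t) mod int p = m j mod int p" using rm by (simp add: r_def)
          then have "int p dvd t" by (simp add: mod_eq_dvd_iff)
          then show False using t by (simp add: zdvd_not_zless)
        qed
        then show "cut j (m j + t) \<noteq> 0" using b_pos(1)[of "m j + t"] by (simp add: cut_def)
      qed
      then have "y \<in> C" using j(1) by (auto simp: C_def)
      then have "12 / \<theta> \<le> \<bar>x - y\<bar>" using far by blast
      moreover have "7 / \<theta> < 12 / \<theta>" using \<theta> by (simp add: divide_strict_right_mono)
      ultimately show False using y(1) by linarith
    qed
  qed
  have "12 / \<theta> < \<kappa>" "real s * real p \<le> (12 / \<theta>) powr (- \<kappa>)"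
    using N(4,5) by (simp_all only: \<theta>_def p_def)
  note \<delta> = this
  show ?thesis
    by (rule exI[of _ b], rule exI[of _ p], rule exI[of _ C], rule exI[of _ "12 / \<theta>"], rule exI[of _ \<beta>'])
      (use p b_per b_close finC \<theta> \<delta> cardC \<beta>' main in auto)
qed

section \<open>The limit-periodic chain\<close>

text \<open>\<open>K\<close> depends on \<open>p\<close> and \<open>R\<close> only, so one radius
  will serve all directions and all nearby weights. The bound on \<open>polyop p B v\<close> is
  carried along because the induction splits off \<open>(A - B)\<close> applied to it.\<close>

lemma polyop_lipschitz:
  assumes "R \<ge> 0"
  shows "\<exists>K\<ge>0. \<forall>A B e. \<forall>v :: 'h::real_normed_vector. linear A \<longrightarrow> linear B \<longrightarrow> (\<forall>v. norm (A v) \<le> R * norm v) \<longrightarrow>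
    (\<forall>v. norm (B v) \<le> R * norm v) \<longrightarrow> (\<forall>v. norm (A v - B v) \<le> e * norm v) \<longrightarrow> e \<ge> 0 \<longrightarrow>
    norm (polyop p A v - polyop p B v) \<le> K * e * norm v \<and> norm (polyop p B v) \<le> K * norm v"
proof (induction p)
  case 0
  show ?case by (rule exI[of _ 0]) simp
next
  case (pCons c p)
  then obtain K where K: "K \<ge> 0" "\<And>A B e v. linear A \<Longrightarrow> linear B \<Longrightarrow> (\<forall>v. norm (A v) \<le> R * norm v) \<Longrightarrow>
    (\<forall>v. norm (B v) \<le> R * norm v) \<Longrightarrow> (\<forall>v. norm (A v - B v) \<le> e * norm v) \<Longrightarrow> e \<ge> 0 \<Longrightarrow>
    norm (polyop p A v - polyop p B v) \<le> K * e * norm (v :: 'h) \<and> norm (polyop p B v) \<le> K * norm v"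
    by blast
  define K' where "K' = \<bar>c\<bar> + R * K + K"
  have "norm (polyop (pCons c p) A v - polyop (pCons c p) B v) \<le> K' * e * norm v \<and> norm (polyop (pCons c p) B v) \<le> K' * norm v"
    if A: "linear A" "\<forall>v. norm (A v) \<le> R * norm v" and B: "linear B" "\<forall>v. norm (B v) \<le> R * norm v"
      and AB: "\<forall>v. norm (A v - B v) \<le> e * norm v" "e \<ge> 0" for A B :: "'h \<Rightarrow> 'h" and e v
  proof
    note K2 = K(2)[OF A(1) B(1) A(2) B(2) AB, of v]
    have R0: "R * norm x \<le> R * y" if "norm x \<le> y" for x :: 'h and y using that assms by (rule mult_left_mono)
    have "polyop (pCons c p) A v - polyop (pCons c p) B v = A (polyop p A v - polyop p B v) + (A (polyop p B v) - B (polyop p B v))"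
      using A B by (simp add: linear_diff)
    then have "norm (polyop (pCons c p) A v - polyop (pCons c p) B v)
        \<le> norm (A (polyop p A v - polyop p B v)) + norm (A (polyop p B v) - B (polyop p B v))"
      by (simp only: norm_triangle_ineq)
    also have "norm (A (polyop p A v - polyop p B v)) \<le> R * (K * e * norm v)"
      using A(2) R0 K2 order_trans by blast
    also have "norm (A (polyop p B v) - B (polyop p B v)) \<le> e * (K * norm v)"
      using AB K2 by (meson mult_left_mono order_trans)
    also have "R * (K * e * norm v) + e * (K * norm v) = (K' - \<bar>c\<bar>) * e * norm v" by (simp add: K'_def algebra_simps)
    also have "\<dots> \<le> K' * e * norm v" using AB by (intro mult_right_mono) auto
    finally show "norm (polyop (pCons c p) A v - polyop (pCons c p) B v) \<le> K' * e * norm v" by simp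
    have "norm (polyop (pCons c p) B v) \<le> \<bar>c\<bar> * norm v + norm (B (polyop p B v))"
      using B norm_triangle_ineq[of "c *\<^sub>R v" "B (polyop p B v)"] by simp
    also have "norm (B (polyop p B v)) \<le> R * (K * norm v)" using B(2) R0 K2 order_trans by blast
    also have "\<bar>c\<bar> * norm v + R * (K * norm v) = (K' - K) * norm v" by (simp add: K'_def algebra_simps)
    also have "\<dots> \<le> K' * norm v" using K(1) by (intro mult_right_mono) auto
    finally show "norm (polyop (pCons c p) B v) \<le> K' * norm v" by simp
  qed
  moreover have "K' \<ge> 0" using K assms by (simp add: K'_def)
  ultimately show ?case by blast
qed

text \<open>\<open>small_cover\<close> controls the spectrum of the chain with weights \<open>b\<close> at one scale;
  \<open>gordon\<close> says that on this scale the chain is indistinguishable from one with period \<open>q\<close>.\<close>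

definition small_cover :: "'d::finite itself \<Rightarrow> nat \<Rightarrow> (int \<Rightarrow> real) \<Rightarrow> bool" where
  "small_cover _ k b \<longleftrightarrow> (\<exists>C \<delta> \<beta>. finite C \<and> 0 < \<delta> \<and> \<delta> < 1 / real (Suc k) \<and>
    real (card C) \<le> \<delta> powr (- (1 / real (Suc k))) \<and> \<beta> > 0 \<and>
    (\<forall>(i::'d) x v. (\<forall>c\<in>C. \<delta> \<le> \<bar>x - c\<bar>) \<longrightarrow> \<beta> * norm v \<le> norm (hop b i v - x *\<^sub>R v)))"

definition gordon :: "'d::finite itself \<Rightarrow> nat \<Rightarrow> (int \<Rightarrow> real) \<Rightarrow> bool" where
  "gordon _ k b \<longleftrightarrow> (\<exists>q p. k \<le> q \<and> (\<forall>(i::'d) v.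
    norm (polyop p (hop b i) v - (translate i (int q) v + translate i (- int q) v)) \<le> norm v / real (Suc k) \<and>
    norm (polyop (p * p) (hop b i) v - (translate i (2 * int q) v + 2 *\<^sub>R v + translate i (- 2 * int q) v)) \<le> norm v / real (Suc k)))"

lemma translate_translate: "translate i x (translate i y u) = translate i (x + y) u"
proof (rule l2_eqI)
  fix n
  have e: "n + axis i x + axis i y = n + axis i (x + y)" by (auto simp: vec_eq_iff axis_def)
  show "entry (translate i x (translate i y u)) n = entry (translate i (x + y) u) n"
    by (simp only: entry_translate e)
qed

lemma translate_zero: "translate i 0 u = u"
  by (rule l2_eqI) simp

lemma translate_add: "translate i x (u + v) = translate i x u + translate i x v"
  by (rule l2_eqI) simp

text \<open>Each property of the periodic chain holds with room to spare: in a small ball the cover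
  is unchanged with \<beta> halved, and the exact translation identities of the discriminant turn
  into the errors allowed by \<open>gordon\<close>.\<close>

lemma exists_good_ball:
  assumes q: "q > 0" and per: "\<And>j. a (j + int q) = a j" and a: "\<And>j. 3 / 4 \<le> a j" "\<And>j. a j \<le> 5 / 4"
    and e: "0 < \<epsilon>" "\<epsilon> \<le> 1 / 4"
  shows "\<exists>b p r. p > 0 \<and> r > 0 \<and> (\<forall>n. b (n + int p) = b n \<and> \<bar>b n - a n\<bar> \<le> \<epsilon>) \<and>
    (\<forall>w. (\<forall>n. \<bar>w n - b n\<bar> \<le> r) \<longrightarrow> small_cover TYPE('d::finite) k w \<and> gordon TYPE('d) k w)"
proof -
  have "1 / 2 \<le> a j" "a j \<le> 2" for j using a[of j] by linarith+
  moreover have "1 / real (Suc k) > 0" by simp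
  ultimately obtain b p C \<delta> \<beta> where p: "p > 0" "k \<le> p" and b: "\<And>n. b (n + int p) = b n" "\<And>n. \<bar>b n - a n\<bar> \<le> \<epsilon>"
    and C: "finite C" "0 < \<delta>" "\<delta> < 1 / real (Suc k)" "real (card C) \<le> \<delta> powr (- (1 / real (Suc k)))" "\<beta> > 0"
    and cov: "\<And>(i::'d) x v. (\<forall>c\<in>C. \<delta> \<le> \<bar>x - c\<bar>) \<Longrightarrow> \<beta> * norm v \<le> norm (hop b i v - x *\<^sub>R v)"
    using exists_small_cover[where ?'d = 'd and a = a and q = q and k = k and \<epsilon> = \<epsilon> and \<kappa> = "1 / real (Suc k)", OF q per _ _ e]
    by metis
  have bpos: "0 < b n" "\<bar>b n\<bar> \<le> 2" for n using b(2)[of n] a[of n] e by linarith+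
  have bb: "bounded (range b)" by (rule bounded_range_abs[OF bpos(2)])
  define D where "D = discriminant b p"
  have D1: "polyop D (hop b i) v = translate i (int p) v + translate i (- int p) v" for i :: 'd and v
    unfolding D_def by (rule polyop_discriminant_hop[OF bb _ b(1)]) (use bpos(1) in \<open>simp add: less_imp_neq[symmetric]\<close>)
  have linb: "linear (hop b i)" for i :: 'd by (rule symopD(2)[OF symop_hop[OF bb]])
  have D2: "polyop (D * D) (hop b i) v = translate i (2 * int p) v + 2 *\<^sub>R v + translate i (- 2 * int p) v" for i :: 'd and v
    by (simp add: linb D1 translate_add translate_translate translate_zero scaleR_2 algebra_simps)
  obtain K1 where K1: "K1 \<ge> 0" "\<And>A B e (v :: (int ^ 'd) l2). linear A \<Longrightarrow> linear B \<Longrightarrow> (\<forall>v. norm (A v) \<le> 6 * norm v) \<Longrightarrow>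
    (\<forall>v. norm (B v) \<le> 6 * norm v) \<Longrightarrow> (\<forall>v. norm (A v - B v) \<le> e * norm v) \<Longrightarrow> e \<ge> 0 \<Longrightarrow>
    norm (polyop D A v - polyop D B v) \<le> K1 * e * norm v"
    using polyop_lipschitz[of 6 D, where ?'h = "(int ^ 'd) l2"] by auto
  obtain K2 where K2: "K2 \<ge> 0" "\<And>A B e (v :: (int ^ 'd) l2). linear A \<Longrightarrow> linear B \<Longrightarrow> (\<forall>v. norm (A v) \<le> 6 * norm v) \<Longrightarrow>
    (\<forall>v. norm (B v) \<le> 6 * norm v) \<Longrightarrow> (\<forall>v. norm (A v - B v) \<le> e * norm v) \<Longrightarrow> e \<ge> 0 \<Longrightarrow>
    norm (polyop (D * D) A v - polyop (D * D) B v) \<le> K2 * e * norm v"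
    using polyop_lipschitz[of 6 "D * D", where ?'h = "(int ^ 'd) l2"] by auto
  define S where "S = K1 + K2 + 1"
  have S: "S > 0" using K1(1) K2(1) by (simp add: S_def)
  \<comment> \<open>Weights at distance \<open>r\<close> give operators at distance
    \<open>2 * r\<close>: at most half of \<beta>, and small enough for both Lipschitz constants.
    The 1 keeps the weights below 3.\<close>
  define r where "r = min (min 1 (\<beta> / 4)) (1 / (real (Suc k) * (2 * S)))"
  have "r \<le> \<beta> / 4" by (simp add: r_def)
  then have r: "r > 0" "r \<le> 1" "2 * r \<le> \<beta> / 2" using C(5) S by (auto simp: r_def)
  have rK: "K * (2 * r) \<le> 1 / real (Suc k)" if "0 \<le> K" "K \<le> S" for K
  proof -
    have "K * (2 * r) \<le> S * (2 * (1 / (real (Suc k) * (2 * S))))"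
      using that r S by (intro mult_mono) (auto simp: r_def)
    also have "\<dots> = 1 / real (Suc k)"
    proof -
      have "S * (2 * (1 / (c * (2 * S)))) = 1 / c" if "c > 0" for c using S that by (simp add: field_simps)
      then show ?thesis by simp
    qed
    finally show ?thesis .
  qed
  have "small_cover TYPE('d) k w \<and> gordon TYPE('d) k w" if w: "\<forall>n. \<bar>w n - b n\<bar> \<le> r" for w
  proof
    have w3: "\<bar>w n\<bar> \<le> 3" for n using w[rule_format, of n] bpos(2)[of n] r by linarith
    have bw: "bounded (range w)" by (rule bounded_range_abs[OF w3])
    have linw: "linear (hop w i)" for i :: 'd by (rule symopD(2)[OF symop_hop[OF bw]])
    have diff: "norm (hop w i v - hop b i v) \<le> 2 * r * norm v" for i :: 'd and v
      by (rule norm_hop_diff_le[OF bb bw]) (use w in blast)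
    show "small_cover TYPE('d) k w"
      unfolding small_cover_def
    proof (intro exI conjI allI impI)
      fix i :: 'd and x v assume "\<forall>c\<in>C. \<delta> \<le> \<bar>x - c\<bar>"
      then have "(\<beta> - 2 * r - 0) * norm v \<le> norm (hop w i v - x *\<^sub>R v)"
        by (intro bounded_below_at_perturb[OF cov diff]) auto
      moreover have "\<beta> / 2 * norm v \<le> (\<beta> - 2 * r - 0) * norm v" using r by (intro mult_right_mono) auto
      ultimately show "\<beta> / 2 * norm v \<le> norm (hop w i v - x *\<^sub>R v)" by linarith
    qed (use C in auto)
    have n6: "\<forall>v. norm (hop w i v) \<le> 6 * norm v" "\<forall>v. norm (hop b i v) \<le> 6 * norm v" for i :: 'd
    proof -
      have "\<bar>b n\<bar> \<le> 3" for n using bpos(2)[of n] by linarith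
      then show "\<forall>v. norm (hop w i v) \<le> 6 * norm v" "\<forall>v. norm (hop b i v) \<le> 6 * norm v"
        using norm_hop_le[of w 3, OF w3, where ?'a = 'd] norm_hop_le[of b 3, where ?'a = 'd] by auto
    qed
    show "gordon TYPE('d) k w"
      unfolding gordon_def
    proof (intro exI[of _ p] exI[of _ D] conjI allI)
      fix i :: 'd and v
      have "norm (polyop D (hop w i) v - polyop D (hop b i) v) \<le> K1 * (2 * r) * norm v"
        using r by (intro K1(2) linw linb n6 allI diff) auto
      also have "\<dots> \<le> 1 / real (Suc k) * norm v" using K1(1) K2(1) by (intro mult_right_mono rK) (auto simp: S_def)
      finally show "norm (polyop D (hop w i) v - (translate i (int p) v + translate i (- int p) v)) \<le> norm v / real (Suc k)"
        unfolding D1 by simp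
      have "norm (polyop (D * D) (hop w i) v - polyop (D * D) (hop b i) v) \<le> K2 * (2 * r) * norm v"
        using r by (intro K2(2) linw linb n6 allI diff) auto
      also have "\<dots> \<le> 1 / real (Suc k) * norm v" using K1(1) K2(1) by (intro mult_right_mono rK) (auto simp: S_def)
      finally show "norm (polyop (D * D) (hop w i) v - (translate i (2 * int p) v + 2 *\<^sub>R v + translate i (- 2 * int p) v)) \<le> norm v / real (Suc k)"
        unfolding D2 by simp
    qed (use p in auto)
  qed
  then show ?thesis using p(1) r(1) b by (intro exI[of _ b], intro exI[of _ p] exI[of _ r]) auto
qed

text \<open>Nested balls: the centre moves by at most half the radius and the radius is at least
  halved, so each ball contains the later ones and the limit lies in all of them.\<close>

lemma exists_limit_periodic_chain:
  "\<exists>a. (\<forall>n. 3 / 4 \<le> a n \<and> a n \<le> 5 / 4) \<and> (\<forall>k. small_cover TYPE('d::finite) k a \<and> gordon TYPE('d) k a) \<and>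
    (\<forall>\<epsilon>>0. \<exists>b p. p > 0 \<and> (\<forall>n. b (n + int p) = b n \<and> \<bar>a n - b n\<bar> < \<epsilon> \<and> 3 / 4 \<le> b n \<and> b n \<le> 5 / 4))"
proof -
  \<comment> \<open>The slack \<open>r\<close> keeps the whole ball of radius \<open>r\<close>
    around \<open>b\<close> between 3/4 and 5/4.\<close>
  define inv where "inv = (\<lambda>(b :: int \<Rightarrow> real, p :: nat, r :: real). p > 0 \<and> r > 0 \<and> (\<forall>n. b (n + int p) = b n \<and> \<bar>b n - 1\<bar> \<le> 1 / 4 - r))"
  define succ_rel where "succ_rel = (\<lambda>k (b :: int \<Rightarrow> real, p :: nat, r :: real) (b' :: int \<Rightarrow> real, p' :: nat, r' :: real).
     r' \<le> r / 2 \<and> (\<forall>n. \<bar>b' n - b n\<bar> \<le> r / 2) \<and>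
     (\<forall>w. (\<forall>n. \<bar>w n - b' n\<bar> \<le> r') \<longrightarrow> small_cover TYPE('d) k w \<and> gordon TYPE('d) k w))"
  have "\<exists>f. \<forall>k. inv (f k) \<and> succ_rel k (f k) (f (Suc k))"
  proof (rule dependent_nat_choice)
    show "\<exists>x. inv x" by (rule exI[of _ "(\<lambda>_. 1, 1, 1 / 4)"]) (simp add: inv_def)
    fix x k assume "inv x"
    obtain b p r where x: "x = (b, p, r)" using prod_cases3 by blast
    have p: "p > 0" and r: "r > 0" and b: "\<And>n. b (n + int p) = b n" "\<And>n. \<bar>b n - 1\<bar> \<le> 1 / 4 - r"
      using \<open>inv x\<close> by (auto simp: inv_def x)
    have b': "3 / 4 \<le> b n" "b n \<le> 5 / 4" for n using b(2)[of n] r by linarith+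
    have "r \<le> 1 / 4" using b(2)[of 0] by linarith
    then have "0 < r / 2" "r / 2 \<le> 1 / 4" using r by auto
    from exists_good_ball[where ?'d = 'd and a = b and q = p and k = k, OF p b(1) b' this]
    obtain c p' r0 where c: "p' > 0" "r0 > 0" "\<And>n. c (n + int p') = c n" "\<And>n. \<bar>c n - b n\<bar> \<le> r / 2"
      "\<And>w. (\<forall>n. \<bar>w n - c n\<bar> \<le> r0) \<Longrightarrow> small_cover TYPE('d) k w \<and> gordon TYPE('d) k w" by blast
    define r' where "r' = min r0 (r / 2)"
    have r': "r' > 0" "r' \<le> r0" "r' \<le> r / 2" using c(2) r by (auto simp: r'_def)
    have "\<bar>c n - 1\<bar> \<le> 1 / 4 - r'" for n using c(4)[of n] b(2)[of n] r' by linarith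
    then have "inv (c, p', r')" using c r' by (simp add: inv_def)
    moreover have "small_cover TYPE('d) k w \<and> gordon TYPE('d) k w" if "\<forall>n. \<bar>w n - c n\<bar> \<le> r'" for w
      using c(5)[of w] that r'(2) by (meson order_trans)
    then have "succ_rel k x (c, p', r')" using c(4) r' by (auto simp: succ_rel_def x)
    ultimately show "\<exists>y. inv y \<and> succ_rel k x y" by blast
  qed
  then obtain f where f: "\<And>k. inv (f k)" "\<And>k. succ_rel k (f k) (f (Suc k))" by blast
  define b where "b = (\<lambda>k. fst (f k))"
  define p where "p = (\<lambda>k. fst (snd (f k)))"
  define r where "r = (\<lambda>k. snd (snd (f k)))"
  have fk: "f k = (b k, p k, r k)" for k by (simp add: b_def p_def r_def)
  have p: "p k > 0" and r: "r k > 0" and b: "b k (n + int (p k)) = b k n" "\<bar>b k n - 1\<bar> \<le> 1 / 4 - r k" for k n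
    using f(1)[of k] by (auto simp: fk inv_def)
  have nxt: "r (Suc k) \<le> r k / 2" "\<bar>b (Suc k) n - b k n\<bar> \<le> r k / 2"
    "(\<forall>n. \<bar>w n - b (Suc k) n\<bar> \<le> r (Suc k)) \<Longrightarrow> small_cover TYPE('d) k w \<and> gordon TYPE('d) k w" for k n w
    using f(2)[of k] by (auto simp: fk succ_rel_def)
  \<comment> \<open>Each move is at most \<open>r k / 2\<close>, hence at most
    \<open>r k - r (Suc k)\<close>, and the sum telescopes.\<close>
  have dist: "\<bar>b (k + m) n - b k n\<bar> \<le> r k - r (k + m)" for k m n
  proof (induction m)
    case (Suc m)
    have "\<bar>b (k + Suc m) n - b (k + m) n\<bar> \<le> r (k + m) / 2" "r (k + Suc m) \<le> r (k + m) / 2"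
      using nxt(1)[of "k + m"] nxt(2)[where k = "k + m" and n = n] by auto
    then show ?case using Suc by linarith
  qed simp
  have rk: "r k \<le> (1 / 2) ^ k * r 0" for k
  proof (induction k)
    case (Suc k)
    then show ?case using nxt(1)[of k] by simp
  qed simp
  have r0: "r \<longlonglongrightarrow> 0"
  proof (rule tendsto_sandwich[OF _ _ tendsto_const])
    show "\<forall>\<^sub>F k in sequentially. 0 \<le> r k" using r by (simp add: less_imp_le)
    show "\<forall>\<^sub>F k in sequentially. r k \<le> (1 / 2) ^ k * r 0" using rk by simp
    show "(\<lambda>k. (1 / 2) ^ k * r 0) \<longlonglongrightarrow> 0" by (intro tendsto_mult_left_zero LIMSEQ_realpow_zero) auto
  qed
  have "convergent (\<lambda>k. b k n)" for n
  proof (rule Cauchy_convergent, rule metric_CauchyI)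
    fix e :: real assume "e > 0"
    then have "e / 2 > 0" by simp
    then obtain M where M: "r M < e / 2" using r0 by (metis LIMSEQ_D abs_le_D1 diff_zero dual_order.refl le_less_trans real_norm_def)
    have near: "\<bar>b k n - b M n\<bar> < e / 2" if "k \<ge> M" for k
      using dist[of M "k - M" n] that M r[of k] by simp
    then have "dist (b i n) (b j n) < e" if "i \<ge> M" "j \<ge> M" for i j
      using near[OF that(1)] near[OF that(2)] unfolding dist_real_def by linarith
    then show "\<exists>M. \<forall>i\<ge>M. \<forall>j\<ge>M. dist (b i n) (b j n) < e" by blast
  qed
  then obtain a where a: "\<And>n. (\<lambda>k. b k n) \<longlonglongrightarrow> a n" unfolding convergent_def by metis
  have close: "\<bar>a n - b k n\<bar> \<le> r k" for n k
  proof (rule LIMSEQ_le_const2)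
    show "(\<lambda>m. \<bar>b m n - b k n\<bar>) \<longlonglongrightarrow> \<bar>a n - b k n\<bar>" by (intro tendsto_intros a)
    have "\<bar>b m n - b k n\<bar> \<le> r k" if "m \<ge> k" for m using dist[of k "m - k" n] that r[of m] by simp
    then show "\<exists>N. \<forall>m\<ge>N. \<bar>b m n - b k n\<bar> \<le> r k" by blast
  qed
  show ?thesis
  proof (rule exI[of _ a], intro conjI allI impI)
    show "3 / 4 \<le> a n" "a n \<le> 5 / 4" for n using close[of n 0] b(2)[of 0 n] by linarith+
    show "small_cover TYPE('d) k a" "gordon TYPE('d) k a" for k using nxt(3)[where w = a and k = k] close by auto
    fix \<epsilon> :: real assume "\<epsilon> > 0"
    then obtain k where k: "r k < \<epsilon>" using r0 by (metis LIMSEQ_D abs_le_D1 diff_zero dual_order.refl le_less_trans real_norm_def)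
    have "3 / 4 \<le> b k n" "b k n \<le> 5 / 4" for n using b(2)[of k n] r[of k] by linarith+
    moreover have "\<bar>a n - b k n\<bar> < \<epsilon>" for n using close[of n k] k by linarith
    ultimately show "\<exists>b p. p > 0 \<and> (\<forall>n. b (n + int p) = b n \<and> \<bar>a n - b n\<bar> < \<epsilon> \<and> 3 / 4 \<le> b n \<and> b n \<le> 5 / 4)"
      using b(1) p by (intro exI[of _ "b k"] exI[of _ "p k"]) auto
  qed
qed

section \<open>The separable weighted Laplacian\<close>

definition lattice_op :: "(int \<Rightarrow> real) \<Rightarrow> (int ^ 'd::finite) l2 \<Rightarrow> (int ^ 'd) l2" where
  "lattice_op a v = (\<Sum>i\<in>UNIV. hop a i v)"

lemma symop_lattice_op:
  assumes "bounded (range a)"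
  shows "symop (lattice_op a)"
proof -
  have eq: "lattice_op a = (\<lambda>v :: (int ^ 'a) l2. \<Sum>i\<in>UNIV. hop a i v)" by (auto simp: lattice_op_def)
  show ?thesis unfolding eq by (rule symop_sum) (auto intro: symop_hop[OF assms])
qed

lemma hop_commute_all:
  assumes "bounded (range a)"
  shows "hop a i (hop a j u) = hop a j (hop a i u)"
  using hop_commute[OF assms assms] by (cases "i = j") auto

text \<open>The slices of Gordon's argument, kept as elements of the full space so that the other
  directions act on them and commute with the restriction.\<close>

definition slab :: "'d::finite \<Rightarrow> int \<Rightarrow> (int ^ 'd) l2 \<Rightarrow> (int ^ 'd) l2" where
  "slab i j = wshift (\<lambda>n. if n $ i = j then 1 else 0) (\<lambda>n. n)"

lemma entry_slab [simp]: "entry (slab i j u) n = (if n $ i = j then entry u n else 0)"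
  unfolding slab_def by (subst entry_wshift) (auto simp: bounded_iff)

lemma bounded_linear_slab: "bounded_linear (slab i j)"
  unfolding slab_def by (rule bounded_linear_wshift) (auto simp: bounded_iff)

lemma norm_slab_le: "norm (slab i j u) \<le> norm u"
  unfolding slab_def using norm_wshift_le[of "\<lambda>n. n" _ 1] by force

lemma slab_hop:
  assumes "bounded (range a)" "k \<noteq> i"
  shows "slab i j (hop a k u) = hop a k (slab i j u)"
  by (rule l2_eqI) (use assms in \<open>simp add: entry_hop axis_def\<close>)

text \<open>All but \<open>e\<^sup>2\<close> of the squared norm of \<open>u\<close> sits on a
  finite set, and a large translation brings only points outside that set into the slab.\<close>

lemma slab_translate_small:
  fixes u :: "(int ^ 'd::finite) l2"
  assumes e: "e > 0"
  shows "\<exists>M. \<forall>m. \<bar>m\<bar> \<ge> M \<longrightarrow> norm (slab i j (translate i m u)) \<le> e"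
proof -
  obtain F where F: "finite F" "(\<Sum>n\<in>F. (norm (entry u n))\<^sup>2) > (norm u)\<^sup>2 - e\<^sup>2"
  proof (rule ccontr)
    assume "\<not> thesis"
    then have "\<And>F. finite F \<Longrightarrow> (\<Sum>n\<in>F. (norm (entry u n))\<^sup>2) \<le> (norm u)\<^sup>2 - e\<^sup>2"
      using that not_le by blast
    then have "(norm u)\<^sup>2 \<le> (norm u)\<^sup>2 - e\<^sup>2"
      unfolding norm_l2_square by (intro infsum_le_finite_sums[OF summable_entry]) auto
    then show False using e by simp
  qed
  define M where "M = (\<Sum>n\<in>F. \<bar>n $ i - j\<bar>) + 1"
  have M: "\<bar>n $ i - j\<bar> < M" if "n \<in> F" for n
    unfolding M_def using member_le_sum[OF that, of "\<lambda>n. \<bar>n $ i - j\<bar>"] F(1) by simp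
  have "norm (slab i j (translate i m u)) \<le> e" if m: "\<bar>m\<bar> \<ge> M" for m
  proof (rule norm_l2_le)
    fix G :: "(int ^ 'd) set" assume G: "finite G"
    define G' where "G' = (\<lambda>n. n + axis i m) ` (G \<inter> {n. n $ i = j})"
    have fin: "finite G'" using G by (simp add: G'_def)
    have "G' \<inter> F = {}" using M m by (auto simp: G'_def) fastforce
    then have "(\<Sum>n\<in>G'. (norm (entry u n))\<^sup>2) + (\<Sum>n\<in>F. (norm (entry u n))\<^sup>2) = (\<Sum>n\<in>G' \<union> F. (norm (entry u n))\<^sup>2)"
      using fin F(1) by (simp add: sum.union_disjoint)
    also have "\<dots> \<le> (norm u)\<^sup>2" using fin F(1) by (intro sum_entry_le_norm) auto
    finally have "(\<Sum>n\<in>G'. (norm (entry u n))\<^sup>2) \<le> e\<^sup>2" using F(2) by linarith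
    moreover have "(\<Sum>n\<in>G'. (norm (entry u n))\<^sup>2) = (\<Sum>n\<in>G \<inter> {n. n $ i = j}. (norm (entry u (n + axis i m)))\<^sup>2)"
      unfolding G'_def by (subst sum.reindex) (auto simp: inj_on_def)
    moreover have "(\<Sum>n\<in>G. (norm (entry (slab i j (translate i m u)) n))\<^sup>2) = (\<Sum>n\<in>G \<inter> {n. n $ i = j}. (norm (entry u (n + axis i m)))\<^sup>2)"
      using G by (subst sum.inter_restrict) (auto intro!: sum.cong)
    ultimately show "(\<Sum>n\<in>G. (norm (entry (slab i j (translate i m u)) n))\<^sup>2) \<le> e\<^sup>2" by simp
  qed (use e in simp)
  then show ?thesis by blast
qed

text \<open>Gordon's argument with operator coefficients: on the slices \<open>u j\<close> orthogonal to one direction,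
  an eigenvector solves the one-dimensional equation with a self-adjoint operator \<open>X\<close> as energy.
  Hence approximately \<open>u (j + q) + u (j - q) = \<Delta>(X) u j\<close> and
  \<open>u (j + 2q) + u (j - 2q) + 2 u j = \<Delta>(X)\<^sup>2 u j\<close>. As \<open>q\<close> grows the shifted slices vanish,
  and pairing the second relation with \<open>u j\<close> gives \<open>2 |u j|\<^sup>2 = |\<Delta>(X) u j|\<^sup>2 = 0\<close> in the limit.\<close>

lemma lattice_op_no_eigenvector:
  fixes u :: "(int ^ 'd::finite) l2"
  assumes b: "bounded (range a)" and gordon: "\<And>k. gordon TYPE('d) k a"
    and eig: "lattice_op a u = E *\<^sub>R u"
  shows "u = 0"
proof -
  define i :: 'd where "i = undefined"
  define A where "A = hop a i"
  \<comment> \<open>\<open>X\<close> moves only in directions other than \<open>i\<close>, so it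
    commutes with \<open>A\<close> and with the slabs; on \<open>u\<close> it agrees with
    \<open>A\<close>.\<close>
  define X where "X = (\<lambda>v. E *\<^sub>R v - (\<Sum>k\<in>UNIV - {i}. hop a k v))"
  have A: "symop A" unfolding A_def by (rule symop_hop[OF b])
  have X: "symop X" unfolding X_def by (intro symop_diff symop_scaleR symop_sum symop_hop[OF b]) auto
  have lin: "linear A" "linear X" by (rule symopD(2)[OF A], rule symopD(2)[OF X])
  have AX: "A (X v) = X (A v)" for v
    using lin(1) unfolding X_def
    by (simp add: linear_diff linear_scale linear_sum) (simp add: A_def hop_commute_all[OF b])
  have "lattice_op a u = A u + (\<Sum>k\<in>UNIV - {i}. hop a k u)"
    unfolding lattice_op_def A_def by (subst sum.remove[of _ i]) auto
  then have Au: "A u = X u" using eig by (simp add: X_def)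
  have pAX: "polyop p A u = polyop p X u" for p by (rule polyop_cong_vector[OF lin AX Au])
  have linP: "linear (slab i j)" for j :: int by (rule bounded_linear.linear[OF bounded_linear_slab])
  have XP: "X (slab i j v) = slab i j (X v)" for j v
    unfolding X_def by (simp add: linear_diff[OF linP] linear_scale[OF linP] linear_sum[OF linP] slab_hop[OF b])
  have "slab i j u = 0" for j
  proof -
    define w where "w = slab i j u"
    define c where "c = norm u"
    have wc: "norm w \<le> c" unfolding w_def c_def by (rule norm_slab_le)
    have c0: "0 \<le> c" by (simp add: c_def)
    have bound: "2 * (norm w)\<^sup>2 \<le> (3 * e)\<^sup>2 + 3 * e * c" if e: "e > 0" for e
    proof -
      obtain M where M: "\<And>m. \<bar>m\<bar> \<ge> M \<Longrightarrow> norm (slab i j (translate i m u)) \<le> e"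
        using slab_translate_small[OF e] by blast
      obtain k0 :: nat where k0: "real k0 \<ge> c / e" using real_arch_simple by blast
      \<comment> \<open>The first entry makes the error in \<open>gordon\<close> at most
        \<open>e\<close>; the second makes the shifts by \<open>q\<close> and \<open>2 * q\<close>
        large enough for \<open>M\<close>.\<close>
      define k where "k = max k0 (nat M)"
      have "c \<le> e * real k0" using k0 e by (simp add: pos_divide_le_eq mult.commute)
      also have "\<dots> \<le> e * real (Suc k)" using e by (intro mult_left_mono) (auto simp: k_def)
      finally have ck: "c / real (Suc k) \<le> e" by (simp add: pos_divide_le_eq)
      obtain q p where q: "k \<le> q" and
        p1: "norm (polyop p A u - (translate i (int q) u + translate i (- int q) u)) \<le> c / real (Suc k)" and
        p2: "norm (polyop (p * p) A u - (translate i (2 * int q) u + 2 *\<^sub>R u + translate i (- 2 * int q) u)) \<le> c / real (Suc k)"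
        using gordon[of k] unfolding gordon_def A_def c_def by blast
      have qM: "int q \<ge> M" using q by (auto simp: k_def)
      define D where "D = polyop p X"
      have D: "symop D" unfolding D_def by (rule symop_polyop[OF X])
      have DP: "slab i j (polyop r X v) = polyop r X (slab i j v)" for r v
        by (rule polyop_commute[of X "slab i j", OF lin(2) linP XP])
      define e1 where "e1 = polyop p A u - (translate i (int q) u + translate i (- int q) u)"
      define e2 where "e2 = polyop (p * p) A u - (translate i (2 * int q) u + 2 *\<^sub>R u + translate i (- 2 * int q) u)"
      have e12: "norm (slab i j e1) \<le> e" "norm (slab i j e2) \<le> e"
        using norm_slab_le[of i j e1] norm_slab_le[of i j e2] p1 p2 ck by (auto simp: e1_def e2_def)
      have "D w = slab i j (polyop p A u)" unfolding D_def w_def pAX by (rule DP[symmetric])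
      also have "polyop p A u = translate i (int q) u + translate i (- int q) u + e1" by (simp add: e1_def)
      finally have Dw: "D w = slab i j (translate i (int q) u) + slab i j (translate i (- int q) u) + slab i j e1"
        by (simp add: linear_add[OF linP])
      have "norm (D w) \<le> norm (slab i j (translate i (int q) u)) + norm (slab i j (translate i (- int q) u)) + norm (slab i j e1)"
        unfolding Dw by (intro norm_triangle_le add_mono order_refl)
      also have "\<dots> \<le> e + e + e" using qM by (intro add_mono M e12) auto
      finally have nD: "norm (D w) \<le> 3 * e" by simp
      have "D (D w) = slab i j (polyop (p * p) A u)"
        unfolding D_def w_def pAX by (simp add: lin DP)
      also have "polyop (p * p) A u = translate i (2 * int q) u + 2 *\<^sub>R u + translate i (- 2 * int q) u + e2" by (simp add: e2_def)
      finally have DDw: "D (D w) = (slab i j (translate i (2 * int q) u) + slab i j (translate i (- 2 * int q) u) + slab i j e2) + 2 *\<^sub>R w"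
        by (simp add: linear_add[OF linP] linear_scale[OF linP] w_def)
      define z where "z = slab i j (translate i (2 * int q) u) + slab i j (translate i (- 2 * int q) u) + slab i j e2"
      have "norm z \<le> norm (slab i j (translate i (2 * int q) u)) + norm (slab i j (translate i (- 2 * int q) u)) + norm (slab i j e2)"
        unfolding z_def by (intro norm_triangle_le add_mono order_refl)
      also have "\<dots> \<le> e + e + e" using qM by (intro add_mono M e12) auto
      finally have nz: "norm z \<le> 3 * e" by simp
      have "(norm (D w))\<^sup>2 = w \<bullet> D (D w)" by (simp add: power2_norm_eq_inner symopD(3)[OF D])
      also have "\<dots> = w \<bullet> z + 2 * (norm w)\<^sup>2"
        unfolding DDw z_def[symmetric] by (simp add: inner_add_right power2_norm_eq_inner)
      finally have "2 * (norm w)\<^sup>2 = (norm (D w))\<^sup>2 - w \<bullet> z" by simp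
      also have "\<dots> \<le> (norm (D w))\<^sup>2 + norm w * norm z"
        using Cauchy_Schwarz_ineq2[of w z] by linarith
      also have "\<dots> \<le> (3 * e)\<^sup>2 + c * (3 * e)"
        using nD nz wc c0 e by (intro add_mono power_mono mult_mono) auto
      finally show ?thesis by (simp add: mult.commute)
    qed
    have "2 * (norm w)\<^sup>2 \<le> 0"
    proof (rule tendsto_lowerbound)
      show "((\<lambda>e. (3 * e)\<^sup>2 + 3 * e * c) \<longlongrightarrow> 0) (at_right 0)" by (auto intro!: tendsto_eq_intros)
      show "\<forall>\<^sub>F e in at_right 0. 2 * (norm w)\<^sup>2 \<le> (3 * e)\<^sup>2 + 3 * e * c"
        using bound by (intro eventually_at_rightI[of 0 1]) auto
    qed simp
    then show ?thesis by (simp add: w_def)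
  qed
  then have "entry u n = 0" for n by (metis entry_slab entry_zero)
  then show ?thesis by (intro l2_eqI) simp
qed

text \<open>Sums of \<open>CARD('d)\<close> points of the one set \<open>C\<close> suffice: radii
  add, and raising the count to the power \<open>CARD('d)\<close> multiplies the exponent.\<close>

lemma finite_cover_spectrum:
  assumes b: "bounded (range a)" and cov: "small_cover TYPE('d::finite) k a"
  shows "\<exists>S \<delta>. finite S \<and> 0 < \<delta> \<and> \<delta> < 1 / real (Suc k) \<and>
    real (card S) \<le> \<delta> powr (- (real CARD('d) / real (Suc k))) \<and>
    {x. \<not> bounded_below_at (lattice_op a :: (int ^ 'd) l2 \<Rightarrow> _) x} \<subseteq> (\<Union>c\<in>S. cball c (real CARD('d) * \<delta>))"
proof -
  obtain C \<delta> \<beta> where C: "finite C" "0 < \<delta>" "\<delta> < 1 / real (Suc k)" "real (card C) \<le> \<delta> powr (- (1 / real (Suc k)))" "\<beta> > 0"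
    and cov: "\<And>(i::'d) x v. (\<forall>c\<in>C. \<delta> \<le> \<bar>x - c\<bar>) \<Longrightarrow> \<beta> * norm v \<le> norm (hop a i v - x *\<^sub>R v)"
    using cov unfolding small_cover_def by blast
  define S where "S = (\<lambda>y. \<Sum>i\<in>UNIV. y i) ` (PiE (UNIV :: 'd set) (\<lambda>_. C))"
  have finPi: "finite (PiE (UNIV :: 'd set) (\<lambda>_. C))" using C(1) by (intro finite_PiE) auto
  have "card S \<le> card (PiE (UNIV :: 'd set) (\<lambda>_. C))" unfolding S_def by (rule card_image_le[OF finPi])
  also have "\<dots> = card C ^ CARD('d)" by (simp add: card_PiE)
  finally have "real (card S) \<le> real (card C) ^ CARD('d)" by (metis of_nat_le_iff of_nat_power)
  also have "\<dots> \<le> (\<delta> powr (- (1 / real (Suc k)))) ^ CARD('d)" using C(4) by (intro power_mono) auto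
  also have "\<dots> = \<delta> powr (- (real CARD('d) / real (Suc k)))"
    using C(2) by (simp add: powr_power)
  finally have cardS: "real (card S) \<le> \<delta> powr (- (real CARD('d) / real (Suc k)))" .
  have "\<exists>c\<in>S. \<bar>x - c\<bar> \<le> real CARD('d) * \<delta>" if x: "\<not> bounded_below_at (lattice_op a :: (int ^ 'd) l2 \<Rightarrow> _) x" for x
  proof -
    have "\<not> bounded_below_at (\<lambda>v :: (int ^ 'd) l2. \<Sum>i\<in>UNIV. hop a i v) x"
      using x by (simp add: lattice_op_def[abs_def])
    from spectrum_sum_subset[OF finite symop_hop[OF b] hop_commute_all[OF b] this]
    obtain y where y: "x = (\<Sum>i\<in>UNIV. y i)" "\<And>i::'d. \<not> bounded_below_at (hop a i) (y i)" by blast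
    have "\<exists>c\<in>C. \<bar>y i - c\<bar> < \<delta>" for i
    proof (rule ccontr)
      assume "\<not> ?thesis"
      then have "\<forall>c\<in>C. \<delta> \<le> \<bar>y i - c\<bar>" by auto
      then have "bounded_below_at (hop a i) (y i)" unfolding bounded_below_at_def using cov C(5) by blast
      then show False using y(2) by blast
    qed
    then obtain c where c: "\<And>i. c i \<in> C" "\<And>i. \<bar>y i - c i\<bar> < \<delta>" by metis
    have "\<bar>x - (\<Sum>i\<in>UNIV. c i)\<bar> = \<bar>\<Sum>i\<in>UNIV. y i - c i\<bar>" by (simp add: y(1) sum_subtractf)
    also have "\<dots> \<le> (\<Sum>i\<in>(UNIV :: 'd set). \<bar>y i - c i\<bar>)" by (rule sum_abs)
    also have "\<dots> \<le> (\<Sum>i\<in>(UNIV :: 'd set). \<delta>)" by (intro sum_mono less_imp_le c)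
    finally show ?thesis using c(1) by (intro bexI[of _ "\<Sum>i\<in>UNIV. c i"]) (auto simp: S_def)
  qed
  then have "{x. \<not> bounded_below_at (lattice_op a :: (int ^ 'd) l2 \<Rightarrow> _) x} \<subseteq> (\<Union>c\<in>S. cball c (real CARD('d) * \<delta>))"
    by (force simp: dist_real_def abs_minus_commute)
  moreover have "finite S" unfolding S_def using finPi by simp
  ultimately show ?thesis using C cardS by (intro exI[of _ S] exI[of _ \<delta>]) auto
qed

text \<open>The weight of the edge from \<open>n\<close> to \<open>n + e\<^sub>i\<close> is \<open>a (n $ i)\<close>, so that the Laplacian is a sum
  of commuting one-dimensional operators. The sum has one nonzero term for adjacent sites.\<close>

definition separable_weight :: "(int \<Rightarrow> real) \<Rightarrow> int ^ 'd::finite \<Rightarrow> int ^ 'd \<Rightarrow> real" where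
  "separable_weight a n m = (\<Sum>i\<in>UNIV. if n $ i = m $ i then 0 else a (min (n $ i) (m $ i)))"

section \<open>Edges and periodicity of separable weights\<close>

lemma adj_iff: "adj m n \<longleftrightarrow> (\<exists>i. m = n + axis i 1 \<or> m = n + axis i (- 1))"
proof
  assume adj: "adj m n"
  then have sum1: "(\<Sum>i\<in>UNIV. \<bar>m $ i - n $ i\<bar>) = 1" by (simp add: adj_def)
  then obtain i where i: "\<bar>m $ i - n $ i\<bar> \<noteq> 0" using sum.neutral[of UNIV "\<lambda>i. \<bar>m $ i - n $ i\<bar>"] by force
  have "(\<Sum>i\<in>UNIV. \<bar>m $ i - n $ i\<bar>) = \<bar>m $ i - n $ i\<bar> + (\<Sum>k\<in>UNIV - {i}. \<bar>m $ k - n $ k\<bar>)"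
    by (rule sum.remove) auto
  moreover have "0 \<le> (\<Sum>k\<in>UNIV - {i}. \<bar>m $ k - n $ k\<bar>)" by (rule sum_nonneg) simp
  ultimately have "(\<Sum>k\<in>UNIV - {i}. \<bar>m $ k - n $ k\<bar>) = 0" and mi: "\<bar>m $ i - n $ i\<bar> = 1"
    using sum1 i by linarith+
  then have "m $ k = n $ k" if "k \<noteq> i" for k using that by (simp add: sum_nonneg_eq_0_iff)
  then have "m = n + axis i (m $ i - n $ i)" by (auto simp: vec_eq_iff axis_def)
  moreover have "m $ i - n $ i = 1 \<or> m $ i - n $ i = - 1" using mi by linarith
  ultimately show "\<exists>i. m = n + axis i 1 \<or> m = n + axis i (- 1)" by metis
next
  assume "\<exists>i. m = n + axis i 1 \<or> m = n + axis i (- 1)"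
  then obtain i x where "m = n + axis i x" "\<bar>x\<bar> = 1" by auto
  then have "(\<Sum>k\<in>UNIV. \<bar>m $ k - n $ k\<bar>) = (\<Sum>k\<in>UNIV. if k = i then 1 else 0)"
    by (intro sum.cong) (auto simp: axis_def)
  then show "adj m n" by (simp add: adj_def)
qed

lemma separable_weight_axis:
  assumes "x \<noteq> 0"
  shows "separable_weight a n (n + axis i x) = a (min (n $ i) (n $ i + x))"
    "separable_weight a (n + axis i x) n = a (min (n $ i) (n $ i + x))"
proof -
  have "(if n $ k = (n + axis i x) $ k then 0 else a (min (n $ k) ((n + axis i x) $ k))) =
      (if k = i then a (min (n $ i) (n $ i + x)) else 0)"
    "(if (n + axis i x) $ k = n $ k then 0 else a (min ((n + axis i x) $ k) (n $ k))) =
      (if k = i then a (min (n $ i) (n $ i + x)) else 0)" for k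
    using assms by (auto simp: axis_def min.commute)
  note h = this
  show "separable_weight a n (n + axis i x) = a (min (n $ i) (n $ i + x))"
    unfolding separable_weight_def h by simp
  show "separable_weight a (n + axis i x) n = a (min (n $ i) (n $ i + x))"
    unfolding separable_weight_def h by simp
qed

lemma separable_weight_adj:
  assumes "adj n m"
  obtains j where "\<And>a. separable_weight a n m = a j" "\<And>a. separable_weight a m n = a j"
proof -
  obtain i x where x: "n = m + axis i x" "x \<noteq> 0" using assms unfolding adj_iff by force
  show ?thesis
    by (rule that[of "min (m $ i) (m $ i + x)"]) (simp_all add: x(1) separable_weight_axis[OF x(2)])
qed

lemma weights_bounded_separable:
  assumes "\<And>j. 3 / 4 \<le> a j" "\<And>j. a j \<le> 5 / 4"
  shows "weights_bounded 2 (separable_weight a)"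
  unfolding weights_bounded_def
proof (intro allI impI)
  fix n m :: "int ^ 'a" assume "adj n m"
  then obtain j where "separable_weight a n m = a j" "separable_weight a m n = a j"
    by (rule separable_weight_adj) blast
  then show "separable_weight a n m = separable_weight a m n \<and> inverse 2 \<le> separable_weight a n m \<and> separable_weight a n m \<le> 2"
    using assms(1)[of j] assms(2)[of j] by simp
qed

lemma full_rank_multiples:
  assumes "p > 0"
  shows "full_rank_subgroup {g :: int ^ 'd::finite. \<forall>i. int p dvd g $ i}"
proof -
  let ?f = "\<lambda>g :: int ^ 'd. (\<chi> i. real_of_int (g $ i)) :: real ^ 'd"
  let ?G = "{g :: int ^ 'd. \<forall>i. int p dvd g $ i}"
  have "axis i 1 \<in> span (?f ` ?G)" for i
  proof -
    have e: "?f (axis i (int p)) = real p *\<^sub>R axis i 1" by (auto simp: vec_eq_iff axis_def)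
    have "?f (axis i (int p)) \<in> ?f ` ?G" by (rule imageI) (auto simp: axis_def)
    then have "real p *\<^sub>R axis i 1 \<in> ?f ` ?G" by (simp only: e)
    then have "real p *\<^sub>R axis i 1 \<in> span (?f ` ?G)" by (rule span_base)
    then have "(1 / real p) *\<^sub>R (real p *\<^sub>R axis i 1) \<in> span (?f ` ?G)" by (rule span_scale)
    then show ?thesis using assms by simp
  qed
  then have "(Basis :: (real ^ 'd) set) \<subseteq> span (?f ` ?G)" by (auto simp: Basis_vec_def)
  then have "span Basis \<subseteq> span (?f ` ?G)" by (rule span_minimal) (rule subspace_span)
  then have "span (?f ` ?G) = UNIV" unfolding span_Basis by (rule top_le)
  then show ?thesis by (auto simp: full_rank_subgroup_def)
qed

lemma periodic_weight_separable:
  assumes a: "\<And>j. 3 / 4 \<le> a j" "\<And>j. a j \<le> 5 / 4" and p: "p > 0" and per: "\<And>j. a (j + int p) = a j"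
  shows "periodic_weight (separable_weight a :: int ^ 'd::finite \<Rightarrow> _)"
  unfolding periodic_weight_def
proof
  show "is_weight (separable_weight a)"
    unfolding is_weight_def using weights_bounded_separable[where a = a, OF a] by (intro exI[of _ 2]) auto
  have perk: "a (j + int p * t) = a j" for j t
  proof (cases "t \<ge> 0")
    case True
    then show ?thesis using periodic_multiple[of a p j "nat t", OF per] by simp
  next
    case False
    then show ?thesis using periodic_multiple[of a p "j + int p * t" "nat (- t)", OF per] by simp
  qed
  show "\<exists>G. full_rank_subgroup G \<and>
    (\<forall>n m g. adj n m \<longrightarrow> g \<in> G \<longrightarrow> separable_weight a (n + g) (m + g) = separable_weight a n (m :: int ^ 'd))"
  proof (intro exI conjI allI impI)
    show "full_rank_subgroup {g :: int ^ 'd. \<forall>i. int p dvd g $ i}" by (rule full_rank_multiples[OF p])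
    fix n m g :: "int ^ 'd" assume g: "g \<in> {g. \<forall>i. int p dvd g $ i}"
    have "a (min (n $ i + g $ i) (m $ i + g $ i)) = a (min (n $ i) (m $ i))" for i
    proof -
      obtain t where "g $ i = int p * t" using g by (auto elim: dvdE)
      moreover have "min (n $ i + g $ i) (m $ i + g $ i) = min (n $ i) (m $ i) + g $ i" by linarith
      ultimately show ?thesis by (simp add: perk)
    qed
    then show "separable_weight a (n + g) (m + g) = separable_weight a n m"
      by (simp add: separable_weight_def cong: if_cong)
  qed
qed

lemma limit_periodic_separable:
  assumes a: "\<And>j. 3 / 4 \<le> a j" "\<And>j. a j \<le> 5 / 4"
    and lim: "\<And>\<epsilon>. \<epsilon> > 0 \<Longrightarrow> \<exists>b p. p > 0 \<and> (\<forall>n. b (n + int p) = b n \<and> \<bar>a n - b n\<bar> < \<epsilon> \<and> 3 / 4 \<le> b n \<and> b n \<le> 5 / 4)"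
  shows "limit_periodic_weight (separable_weight a :: int ^ 'd::finite \<Rightarrow> _)"
  unfolding limit_periodic_weight_def
proof (intro conjI allI impI)
  show "is_weight (separable_weight a)"
    unfolding is_weight_def using weights_bounded_separable[where a = a, OF a] by (intro exI[of _ 2]) auto
  fix \<epsilon> :: real assume "\<epsilon> > 0"
  from lim[OF this] obtain b p where b: "p > 0" "\<And>n. b (n + int p) = b n" "\<And>n. \<bar>a n - b n\<bar> < \<epsilon>"
    "\<And>n. 3 / 4 \<le> b n" "\<And>n. b n \<le> 5 / 4" by blast
  have "\<bar>separable_weight a n m - separable_weight b n m\<bar> < \<epsilon>" if "adj n m" for n m :: "int ^ 'd"
    using that by (rule separable_weight_adj) (simp add: b(3))
  then show "\<exists>w'. periodic_weight w' \<and> (\<forall>n m :: int ^ 'd. adj n m \<longrightarrow> \<bar>separable_weight a n m - w' n m\<bar> < \<epsilon>)"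
    using periodic_weight_separable[where a = b, OF b(4,5,1,2)] by blast
qed

section \<open>From lattice functions to the Hilbert space\<close>

lemma weighted_laplacian_separable:
  fixes u :: "(int ^ 'd::finite) l2"
  assumes b: "bounded (range a)"
  shows "weighted_laplacian (separable_weight a) (entry u) = entry (lattice_op a u)"
proof
  fix n :: "int ^ 'd"
  define f where "f = (\<lambda>m. complex_of_real (separable_weight a n m) * entry u m)"
  define up where "up = (\<lambda>i :: 'd. n + axis i 1)"
  define dn where "dn = (\<lambda>i :: 'd. n + axis i (- 1))"
  have set: "{m. adj m n} = range up \<union> range dn" by (auto simp: adj_iff up_def dn_def)
  have inj: "inj up" "inj dn" by (auto simp: inj_def up_def dn_def axis_eq_axis)
  have disj: "range up \<inter> range dn = {}" by (auto simp: up_def dn_def axis_eq_axis)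
  have "weighted_laplacian (separable_weight a) (entry u) n = sum f (range up) + sum f (range dn)"
    unfolding weighted_laplacian_def set f_def[symmetric] using disj by (subst sum.union_disjoint) (auto simp: f_def)
  also have "\<dots> = (\<Sum>i\<in>UNIV. f (up i)) + (\<Sum>i\<in>UNIV. f (dn i))"
    using inj by (simp add: sum.reindex)
  also have "\<dots> = entry (lattice_op a u) n"
    by (simp add: lattice_op_def entry_hop b f_def up_def dn_def separable_weight_axis sum.distrib scaleR_conv_of_real min_def)
  finally show "weighted_laplacian (separable_weight a) (entry u) n = entry (lattice_op a u) n" .
qed

lemma range_entry: "range entry = (ell2 :: (int ^ 'd::finite \<Rightarrow> complex) set)"
  unfolding ell2_def using type_definition.Rep_range[OF type_definition_l2] by blast

text \<open>\<open>entry\<close> conjugates the operator on functions to the one on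
  \<open>l2\<close>, where bijectivity amounts to a lower bound.\<close>

lemma op_spectrum_separable:
  assumes b: "bounded (range a)"
  shows "op_spectrum (weighted_laplacian (separable_weight a :: int ^ 'd::finite \<Rightarrow> _)) =
    {x. \<not> bounded_below_at (lattice_op a :: (int ^ 'd) l2 \<Rightarrow> _) x}"
proof -
  have "bij_betw (\<lambda>u n. weighted_laplacian (separable_weight a) u n - complex_of_real x * u n) ell2 (ell2 :: (int ^ 'd \<Rightarrow> complex) set)
     \<longleftrightarrow> bounded_below_at (lattice_op a :: (int ^ 'd) l2 \<Rightarrow> _) x" (is "bij_betw ?F _ _ \<longleftrightarrow> _") for x
  proof -
    define G where "G = (\<lambda>v :: (int ^ 'd) l2. lattice_op a v - x *\<^sub>R v)"
    have be: "bij_betw entry UNIV (ell2 :: (int ^ 'd \<Rightarrow> complex) set)"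
      unfolding bij_betw_def range_entry using entry_inject by (auto intro: injI)
    have FG: "?F \<circ> entry = entry \<circ> G"
      by (auto simp: fun_eq_iff G_def weighted_laplacian_separable[OF b] scaleR_conv_of_real)
    have "bij_betw ?F ell2 ell2 \<longleftrightarrow> bij_betw (?F \<circ> entry) UNIV ell2"
      by (rule bij_betw_comp_iff[OF be])
    also have "\<dots> \<longleftrightarrow> bij G"
      unfolding FG by (rule bij_betw_comp_iff2[OF be, symmetric]) simp
    also have "\<dots> \<longleftrightarrow> bounded_below_at (lattice_op a :: (int ^ 'd) l2 \<Rightarrow> _) x"
      unfolding G_def using bounded_below_imp_bij[OF symop_lattice_op[OF b]] bij_imp_bounded_below[OF symop_lattice_op[OF b]] by blast
    finally show ?thesis .
  qed
  then show ?thesis by (simp add: op_spectrum_def)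
qed

lemma Re_ell2_inner: "Re (ell2_inner (entry u) (entry v)) = u \<bullet> v" for u v :: "(int ^ 'd::finite) l2"
proof -
  have "(\<lambda>n. norm (cnj (entry u n) * entry v n)) summable_on UNIV"
  proof (rule summable_on_comparison_test)
    show "(\<lambda>n. (norm (entry u n))\<^sup>2 + (norm (entry v n))\<^sup>2) summable_on UNIV"
      by (intro summable_on_add summable_entry)
    show "norm (cnj (entry u n) * entry v n) \<le> (norm (entry u n))\<^sup>2 + (norm (entry v n))\<^sup>2" for n
      unfolding norm_mult complex_mod_cnj
      using sum_squares_bound[of "norm (entry u n)" "norm (entry v n)"]
        mult_nonneg_nonneg[OF norm_ge_zero norm_ge_zero, of "entry u n" "entry v n"]
      by linarith
  qed auto
  then have "(\<lambda>n. cnj (entry u n) * entry v n) summable_on UNIV" by (rule abs_summable_summable)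
  then show ?thesis unfolding ell2_inner_def inner_l2_def
    by (subst infsum_Re[symmetric]) (auto simp: inner_complex_def)
qed

lemma moment_measure_separable:
  fixes u :: "(int ^ 'd::finite) l2"
  assumes b: "bounded (range a)" and sm: "is_spectral_measure (weighted_laplacian (separable_weight a)) (entry u) \<mu>"
  shows "moment_measure (lattice_op a) u \<mu>"
proof (rule moment_measure.intro)
  show "symop (lattice_op a :: (int ^ 'd) l2 \<Rightarrow> _)" by (rule symop_lattice_op[OF b])
  show "sets \<mu> = sets borel" "finite_measure \<mu>" using sm by (auto simp: is_spectral_measure_def)
  show "integrable \<mu> (\<lambda>x. x ^ k)" for k using sm by (auto simp: is_spectral_measure_def)
  fix k
  have "(weighted_laplacian (separable_weight a) ^^ k) (entry u) = entry ((lattice_op a ^^ k) u)"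
    by (induction k) (auto simp: weighted_laplacian_separable[OF b])
  then have "complex_of_real (\<integral>x. x ^ k \<partial>\<mu>) = ell2_inner (entry u) (entry ((lattice_op a ^^ k) u))"
    using sm by (simp add: is_spectral_measure_def)
  from arg_cong[OF this, of Re] show "(\<integral>x. x ^ k \<partial>\<mu>) = u \<bullet> (lattice_op a ^^ k) u" by (simp add: Re_ell2_inner)
qed

section \<open>Dimension and measure from efficient covers\<close>

lemma covering_number_le:
  "finite C \<Longrightarrow> S \<subseteq> (\<Union>c\<in>C. cball c \<epsilon>) \<Longrightarrow> covering_number S \<epsilon> \<le> card C"
  unfolding covering_number_def by (rule Least_le) blast

text \<open>A lower limit is controlled by the scales \<open>d * \<delta>\<close> alone. There the
  logarithm of the count is at most \<open>d / Suc k\<close> times \<open>- ln \<delta>\<close>, and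
  the factor \<open>d\<close> in the scale costs at most a factor 2 once
  \<open>d * d * \<delta> < 1\<close>.\<close>

lemma lower_box_dim_zero:
  assumes d: "d \<ge> 1"
    and cov: "\<And>k. \<exists>C \<delta>. finite C \<and> 0 < \<delta> \<and> \<delta> < 1 / real (Suc k) \<and>
      real (card C) \<le> \<delta> powr (- (d / real (Suc k))) \<and> S \<subseteq> (\<Union>c\<in>C. cball c (d * \<delta>))"
  shows "lower_box_dim S = 0"
proof (rule antisym)
  define f where "f = (\<lambda>\<epsilon>. ereal (ln (real (covering_number S \<epsilon>)) / - ln \<epsilon>))"
  have ln_nat: "0 \<le> ln (real n)" for n by (cases n) auto
  show "0 \<le> lower_box_dim S"
    unfolding lower_box_dim_def
  proof (rule Liminf_bounded)
    show "\<forall>\<^sub>F \<epsilon> in at_right 0. 0 \<le> ereal (ln (real (covering_number S \<epsilon>)) / - ln \<epsilon>)"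
    proof (rule eventually_at_rightI[of 0 1])
      fix \<epsilon> :: real assume "\<epsilon> \<in> {0<..<1}"
      then have "- ln \<epsilon> \<ge> 0" by simp
      then have "0 \<le> ln (real (covering_number S \<epsilon>)) / - ln \<epsilon>" by (intro divide_nonneg_nonneg ln_nat)
      then show "0 \<le> ereal (ln (real (covering_number S \<epsilon>)) / - ln \<epsilon>)" by simp
    qed simp
  qed
  show "lower_box_dim S \<le> 0"
  proof (rule ccontr)
    assume "\<not> ?thesis"
    then have "0 < lower_box_dim S" by (simp only: not_le)
    then obtain y where "0 < ereal y" "ereal y < lower_box_dim S" using ereal_dense2 by blast
    then have y: "0 < ereal y" "ereal y < Liminf (at_right 0) f" by (simp_all only: lower_box_dim_def f_def)
    from less_LiminfD[OF y(2)] obtain b where b: "b > 0" "\<And>\<epsilon>. 0 < \<epsilon> \<Longrightarrow> \<epsilon> < b \<Longrightarrow> ereal y < f \<epsilon>"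
      unfolding eventually_at_right_field by auto
    \<comment> \<open>The three summands make \<open>d * \<delta>\<close> less than
      \<open>b\<close>, \<open>d * d * \<delta>\<close> less than 1, and the final ratio less than
      \<open>y\<close>.\<close>
    obtain k :: nat where k: "real k > d / b + d * d + 2 * d / y" using reals_Archimedean2 by blast
    have y0: "y > 0" using y by simp
    have kk: "d / b < real k" "d * d < real k" "2 * d / y < real k"
    proof -
      have "0 < d / b" "0 \<le> d * d" "0 < 2 * d / y" using d b y0 by auto
      then show "d / b < real k" "d * d < real k" "2 * d / y < real k" using k by linarith+
    qed
    obtain C \<delta> where C: "finite C" "0 < \<delta>" "\<delta> < 1 / real (Suc k)" "real (card C) \<le> \<delta> powr (- (d / real (Suc k)))"
      "S \<subseteq> (\<Union>c\<in>C. cball c (d * \<delta>))" using cov[of k] by blast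
    have \<delta>k: "\<delta> * real (Suc k) < 1" using C(3) by (simp add: pos_less_divide_eq)
    have "d * \<delta> < b"
    proof -
      have "d < b * real (Suc k)" using kk(1) b by (simp add: pos_divide_less_eq algebra_simps)
      then have "d * \<delta> < b * real (Suc k) * \<delta>" using C(2) by (intro mult_strict_right_mono)
      also have "\<dots> = b * (\<delta> * real (Suc k))" by simp
      also have "\<dots> < b * 1" using b \<delta>k by (intro mult_strict_left_mono)
      finally show ?thesis by simp
    qed
    then have yf: "y < ln (real (covering_number S (d * \<delta>))) / - ln (d * \<delta>)"
      using b(2)[of "d * \<delta>"] d C(2) by (simp add: f_def)
    define l where "l = - ln \<delta>"
    have "d * d * \<delta> < 1"
    proof -
      have "d * d * \<delta> \<le> real (Suc k) * \<delta>" using kk(2) C(2) by (intro mult_right_mono) auto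
      then show ?thesis using \<delta>k by (simp add: mult.commute)
    qed
    then have "ln (d * d * \<delta>) < 0" using d C(2) by (simp add: ln_less_zero_iff)
    moreover have "ln (d * d * \<delta>) = 2 * ln d - l" using d C(2) by (simp add: ln_mult l_def)
    ultimately have ld: "2 * ln d < l" by simp
    have lnd: "0 \<le> ln d" using d by simp
    have den: "- ln (d * \<delta>) > l / 2" using ld d C(2) by (simp add: ln_mult l_def)
    have l0: "l > 0" using ld lnd by linarith
    have "ln (real (covering_number S (d * \<delta>))) \<le> d / real (Suc k) * l"
    proof (cases "covering_number S (d * \<delta>) = 0")
      \<comment> \<open>Here \<open>S\<close> is empty and \<open>ln 0\<close> has the value
        0.\<close>
      case True
      then show ?thesis using d l0 by simp
    next
      case False
      have "real (covering_number S (d * \<delta>)) \<le> \<delta> powr (- (d / real (Suc k)))"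
        using covering_number_le[OF C(1,5)] C(4) by linarith
      then have "ln (real (covering_number S (d * \<delta>))) \<le> ln (\<delta> powr (- (d / real (Suc k))))"
        using False C(2) by (subst ln_le_cancel_iff) auto
      then show ?thesis using C(2) by (simp add: ln_powr l_def)
    qed
    then have "ln (real (covering_number S (d * \<delta>))) / - ln (d * \<delta>) \<le> (d / real (Suc k) * l) / (l / 2)"
      using den l0 d ln_nat by (intro frac_le) auto
    also have "\<dots> = 2 * d / real (Suc k)" using l0 by simp
    also have "\<dots> < y" using kk(3) y0 by (simp add: pos_divide_less_eq algebra_simps)
    finally show False using yf by simp
  qed
qed

text \<open>The total length of the cover is at most \<open>2 * d\<close> times \<delta> to the
  power \<open>1 - d / Suc k\<close>, and from \<open>k \<ge> 2 * d\<close> on this exponent is at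
  least 1/2.\<close>

lemma null_set_of_covers:
  fixes S :: "real set"
  assumes S: "S \<in> sets borel" and d: "d \<ge> 1"
    and cov: "\<And>k. \<exists>C \<delta>. finite C \<and> 0 < \<delta> \<and> \<delta> < 1 / real (Suc k) \<and>
      real (card C) \<le> \<delta> powr (- (d / real (Suc k))) \<and> S \<subseteq> (\<Union>c\<in>C. cball c (d * \<delta>))"
  shows "S \<in> null_sets lborel"
proof -
  obtain k0 :: nat where k0: "real k0 \<ge> 2 * d" using real_arch_simple by blast
  have "emeasure lborel S \<le> ennreal (2 * d * sqrt (1 / real (Suc k)))" if k: "k \<ge> k0" for k
  proof -
    obtain C \<delta> where C: "finite C" "0 < \<delta>" "\<delta> < 1 / real (Suc k)" "real (card C) \<le> \<delta> powr (- (d / real (Suc k)))"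
      "S \<subseteq> (\<Union>c\<in>C. cball c (d * \<delta>))" using cov[of k] by blast
    have "emeasure lborel S \<le> emeasure lborel (\<Union>c\<in>C. cball c (d * \<delta>))"
      using C by (intro emeasure_mono) auto
    also have "\<dots> \<le> (\<Sum>c\<in>C. emeasure lborel (cball c (d * \<delta>)))"
      using C(1) by (intro emeasure_subadditive_finite) auto
    also have "\<dots> = (\<Sum>c\<in>C. ennreal (2 * d * \<delta>))"
    proof (rule sum.cong[OF refl])
      fix c :: real
      have "0 \<le> d * \<delta>" using C(2) d by simp
      then show "emeasure lborel (cball c (d * \<delta>)) = ennreal (2 * d * \<delta>)"
        unfolding cball_eq_atLeastAtMost by (subst emeasure_lborel_Icc) (simp_all add: mult_ac)
    qed
    also have "\<dots> = ennreal (real (card C) * (2 * d * \<delta>))"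
      using C(2) d by (simp add: ennreal_of_nat_eq_real_of_nat ennreal_mult)
    also have "\<dots> \<le> ennreal (2 * d * sqrt (1 / real (Suc k)))"
    proof (rule ennreal_leI)
      have \<delta>1: "\<delta> < 1" using C(3) by (simp add: less_le_trans)
      have "d / real (Suc k) \<le> 1 / 2" using k0 k by (simp add: pos_divide_le_eq)
      then have "\<delta> powr (- (d / real (Suc k))) \<le> \<delta> powr (- (1 / 2))"
        using C(2) \<delta>1 by (intro powr_mono') auto
      then have "real (card C) * \<delta> \<le> \<delta> powr (- (1 / 2)) * \<delta>" using C(2,4) by (intro mult_right_mono) auto
      also have "\<dots> = \<delta> powr (1 / 2)" using C(2) powr_add[of \<delta> "- (1 / 2)" 1] by simp
      also have "\<dots> = sqrt \<delta>" using C(2) by (simp add: powr_half_sqrt)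
      also have "\<dots> \<le> sqrt (1 / real (Suc k))" using C(3) by simp
      finally have "2 * d * (real (card C) * \<delta>) \<le> 2 * d * sqrt (1 / real (Suc k))" using d by (intro mult_left_mono) auto
      then show "real (card C) * (2 * d * \<delta>) \<le> 2 * d * sqrt (1 / real (Suc k))" by (simp add: mult_ac)
    qed
    finally show ?thesis .
  qed
  moreover have "(\<lambda>k. ennreal (2 * d * sqrt (1 / real (Suc k)))) \<longlonglongrightarrow> ennreal 0"
  proof (rule tendsto_ennrealI)
    have "(\<lambda>k. 2 * d * sqrt (1 / real (Suc k))) \<longlonglongrightarrow> 2 * d * sqrt 0"
      by (intro tendsto_intros LIMSEQ_inverse_real_of_nat[unfolded inverse_eq_divide])
    then show "(\<lambda>k. 2 * d * sqrt (1 / real (Suc k))) \<longlonglongrightarrow> 0" by simp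
  qed
  ultimately have "emeasure lborel S \<le> ennreal 0" by (intro LIMSEQ_le_const) auto
  then show ?thesis using S by auto
qed

lemma interior_null_set:
  fixes S :: "real set"
  assumes "S \<in> null_sets lborel"
  shows "interior S = {}"
proof (rule ccontr)
  assume "interior S \<noteq> {}"
  then obtain x where "x \<in> interior S" by blast
  then obtain e where e: "e > 0" "cball x e \<subseteq> S" unfolding mem_interior_cball by blast
  then have "emeasure lborel (cball x e) \<le> emeasure lborel S" using assms by (intro emeasure_mono) auto
  then have "emeasure lborel (cball x e) = 0" using assms by (simp add: null_sets_def)
  then show False using e(1) by (simp add: cball_eq_atLeastAtMost)
qed

theorem theorem1p7:
  shows "\<exists>(w :: int ^ 'd::finite \<Rightarrow> int ^ 'd \<Rightarrow> real) M. M > 1 \<and> weights_bounded M w \<and>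
     limit_periodic_weight w \<and>
     purely_singular_continuous (weighted_laplacian w) \<and>
     cantor_set (op_spectrum (weighted_laplacian w)) \<and>
     lower_box_dim (op_spectrum (weighted_laplacian w)) = 0"
proof -
  obtain a where a: "\<And>n. 3 / 4 \<le> a n" "\<And>n. a n \<le> 5 / 4"
    and cover: "\<And>k. small_cover TYPE('d) k a" and gordon: "\<And>k. gordon TYPE('d) k a"
    and lim: "\<And>\<epsilon>. \<epsilon> > 0 \<Longrightarrow> \<exists>b p. p > 0 \<and> (\<forall>n. b (n + int p) = b n \<and> \<bar>a n - b n\<bar> < \<epsilon> \<and> 3 / 4 \<le> b n \<and> b n \<le> 5 / 4)"
    using exists_limit_periodic_chain[where ?'d = 'd] by blast
  have "\<bar>a n\<bar> \<le> 2" for n using a[of n] by linarith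
  then have b: "bounded (range a)" by (rule bounded_range_abs)
  define w :: "int ^ 'd \<Rightarrow> int ^ 'd \<Rightarrow> real" where "w = separable_weight a"
  define L :: "(int ^ 'd) l2 \<Rightarrow> (int ^ 'd) l2" where "L = lattice_op a"
  define \<Sigma> where "\<Sigma> = {x. \<not> bounded_below_at L x}"
  have L: "symop L" unfolding L_def by (rule symop_lattice_op[OF b])
  have spec: "op_spectrum (weighted_laplacian w) = \<Sigma>"
    unfolding w_def \<Sigma>_def L_def by (rule op_spectrum_separable[OF b])
  have d: "1 \<le> real CARD('d)" by simp
  note covers = finite_cover_spectrum[OF b cover, folded L_def, folded \<Sigma>_def]
  obtain R where R: "R > 0" "\<And>v. norm (L v) \<le> R * norm v" using symop_pos_bound[OF L] by blast
  have compact: "compact \<Sigma>" unfolding \<Sigma>_def by (rule compact_spectrum[OF R(2)])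
  then have closed: "closed \<Sigma>" by (rule compact_imp_closed)
  then have borel: "\<Sigma> \<in> sets borel" by simp
  have null: "\<Sigma> \<in> null_sets lborel" by (rule null_set_of_covers[OF borel d covers])
  have noeig: "v = 0" if "L v = x *\<^sub>R v" for v x
    using lattice_op_no_eigenvector[OF b gordon] that unfolding L_def by blast
  have "x islimpt \<Sigma>" if "x \<in> \<Sigma>" for x
    using isolated_imp_eigenvector[OF L, of x] that noeig unfolding \<Sigma>_def by blast
  then have "cantor_set \<Sigma>" using compact interior_null_set[OF null] by (simp add: cantor_set_def)
  moreover have "lower_box_dim \<Sigma> = 0" by (rule lower_box_dim_zero[OF d covers])
  moreover have "purely_singular_continuous (weighted_laplacian w)"
    unfolding purely_singular_continuous_def
  proof (intro ballI allI impI conjI)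
    fix f :: "int ^ 'd \<Rightarrow> complex" and \<mu> assume "f \<in> ell2" and sm: "is_spectral_measure (weighted_laplacian w) f \<mu>"
    then obtain u where u: "f = entry u" using range_entry by blast
    interpret moment_measure L u \<mu>
      using moment_measure_separable[OF b] sm unfolding u w_def L_def by blast
    have "AE x in \<mu>. x \<in> \<Sigma>" by (rule AE_in_closed_superset[OF closed]) (simp add: \<Sigma>_def)
    moreover have "UNIV - \<Sigma> \<in> sets \<mu>" using borel sets by auto
    ultimately have "emeasure \<mu> (UNIV - \<Sigma>) = 0"
      using AE_iff_measurable[of "UNIV - \<Sigma>" \<mu> "\<lambda>x. x \<in> \<Sigma>"] by auto
    then show "\<exists>N\<in>null_sets lborel. emeasure \<mu> (UNIV - N) = 0" using null by blast
    show "emeasure \<mu> {x} = 0" for x using atom_imp_eigenvector[of x] noeig by blast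
  qed
  moreover have "limit_periodic_weight w" unfolding w_def by (rule limit_periodic_separable[OF a lim])
  moreover have "weights_bounded 2 w" unfolding w_def by (rule weights_bounded_separable[OF a])
  ultimately show ?thesis unfolding spec[symmetric] by (intro exI[of _ w] exI[of _ 2]) auto
qed

end
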